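(* Let $S(\lambda)$ be the differential operator function defined below, and assume $\operatorname{rank}(U(\lambda)-1)$ is constant on $(\sigma,\tau)$. Then for every half-open interval $[\xi_1,\xi_2)$ with $[\xi_1,\xi_2]\subset(\sigma,\tau)$, \[ \mathcal N_S(\xi_1,\xi_2)\geqslant\nu_S(\xi_2)-\nu_S(\xi_1). \]
   Context: Setting: $p_k(x,\lambda)$, $k=0,\dots,n$, are continuous real functions on $[a,b]\times(\sigma,\tau)$; for each fixed $\lambda_0$, $p_0(\cdot,\lambda_0)>0$ and $p_0(\cdot,\lambda_0)\in C^n[a,b]$, and $p_k(\cdot,\lambda_0)\in C^{n-k}[a,b]$ for $k=1,\dots,n-1$. $U(\lambda)$ is a continuous function on $(\sigma,\tau)$ with values in unitary complex $2n\times 2n$ matrices. For fixed $\lambda_0$ define quasi-derivatives $y^{[n+m]}(x)=\sum_{k=0}^m(-1)^{m-k}\big(p_k(x,\lambda_0)y^{(n-k)}(x)\big)^{(m-k)}$, $m=0,\dots,n$, and vectors $y^{\wedge}=(y(a),y'(a),\dots,y^{(n-1)}(a),y(b),\dots,y^{(n-1)}(b))^T$, $y^{\vee}=(y^{[2n-1]}(a),y^{[2n-2]}(a),\dots,y^{[n]}(a),-y^{[2n-1]}(b),\dots,-y^{[n]}(b))^T$ in $\mathbb C^{2n}$. $S(\lambda_0)$ is the operator in $L_2[a,b]$ with domain $\{y\in W_2^{2n}[a,b]:(U(\lambda_0)-1)y^{\vee}+i(U(\lambda_0)+1)y^{\wedge}=0\}$ acting by $S(\lambda_0)y=\sum_{k=0}^n(-1)^{n-k}\big(p_k(x,\lambda_0)y^{(n-k)}\big)^{(n-k)}$.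 A number $\lambda_0$ is an eigenvalue of multiplicity $m$ of $S$ if $0$ is an eigenvalue of multiplicity $m$ of $S(\lambda_0)$; $\mathcal N_S(\xi_1,\xi_2)$ is the number of eigenvalues of $S$ in $[\xi_1,\xi_2)$ counted with multiplicity; $\nu_S(\lambda_0)$ is the number of negative eigenvalues of $S(\lambda_0)$ counted with multiplicity. *)

theory Defs
  imports "HOL-Analysis.Analysis" "HOL-Library.Function_Algebras"
    "Jordan_Normal_Form.Schur_Decomposition" "Jordan_Normal_Form.DL_Rank"
begin

fun nder :: "real \<Rightarrow> real \<Rightarrow> nat \<Rightarrow> (real \<Rightarrow> 'v::real_normed_vector) \<Rightarrow> real \<Rightarrow> 'v" where
  "nder a b 0 f = f"
| "nder a b (Suc k) f = (\<lambda>x. vector_derivative (nder a b k f) (at x within {a..b}))"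

definition Cm :: "nat \<Rightarrow> real \<Rightarrow> real \<Rightarrow> (real \<Rightarrow> 'v::real_normed_vector) \<Rightarrow> bool" where
  "Cm m a b f \<longleftrightarrow> (\<forall>j\<le>m. continuous_on {a..b} (nder a b j f)) \<and>
     (\<forall>j<m. \<forall>x\<in>{a..b}. (nder a b j f has_vector_derivative nder a b (Suc j) f x) (at x within {a..b}))"

(* Sobolev space W_2^m[a,b] (m \<ge> 1): C^(m-1), and the (m-1)-th derivative is
   absolutely continuous with square integrable derivative *)
definition W2 :: "nat \<Rightarrow> real \<Rightarrow> real \<Rightarrow> (real \<Rightarrow> complex) \<Rightarrow> bool" where
  "W2 m a b y \<longleftrightarrow> Cm (m - 1) a b y \<and>
     (\<exists>g. g integrable_on {a..b} \<and> (\<lambda>x. (norm (g x))\<^sup>2) integrable_on {a..b} \<and>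
        (\<forall>x\<in>{a..b}. nder a b (m - 1) y x = nder a b (m - 1) y a + integral {a..x} g))"

(* quasi-derivative y^[n+m] for the parameter value l *)
definition qder :: "nat \<Rightarrow> (nat \<Rightarrow> real \<Rightarrow> real \<Rightarrow> real) \<Rightarrow> real \<Rightarrow> real \<Rightarrow> real
    \<Rightarrow> nat \<Rightarrow> (real \<Rightarrow> complex) \<Rightarrow> real \<Rightarrow> complex" where
  "qder n p a b l m y x = (\<Sum>k=0..m. (-1) ^ (m - k) *
      nder a b (m - k) (\<lambda>t. complex_of_real (p k t l) * nder a b (n - k) y t) x)"

definition yhat :: "nat \<Rightarrow> real \<Rightarrow> real \<Rightarrow> (real \<Rightarrow> complex) \<Rightarrow> complex vec" where
  "yhat n a b y = vec (2 * n) (\<lambda>i. if i < n then nder a b i y a else nder a b (i - n) y b)"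

definition ycheck :: "nat \<Rightarrow> (nat \<Rightarrow> real \<Rightarrow> real \<Rightarrow> real) \<Rightarrow> real \<Rightarrow> real \<Rightarrow> real
    \<Rightarrow> (real \<Rightarrow> complex) \<Rightarrow> complex vec" where
  "ycheck n p a b l y = vec (2 * n) (\<lambda>i. if i < n then qder n p a b l (n - 1 - i) y a
                                          else - qder n p a b l (n - 1 - (i - n)) y b)"

definition Sdom :: "nat \<Rightarrow> (nat \<Rightarrow> real \<Rightarrow> real \<Rightarrow> real) \<Rightarrow> (real \<Rightarrow> complex mat) \<Rightarrow> real \<Rightarrow> real
    \<Rightarrow> real \<Rightarrow> (real \<Rightarrow> complex) \<Rightarrow> bool" where
  "Sdom n p U a b l y \<longleftrightarrow> W2 (2 * n) a b y \<and>
     (U l - 1\<^sub>m (2 * n)) *\<^sub>v ycheck n p a b l y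
       + (\<i> \<cdot>\<^sub>m (U l + 1\<^sub>m (2 * n))) *\<^sub>v yhat n a b y = 0\<^sub>v (2 * n)"

definition Sop :: "nat \<Rightarrow> (nat \<Rightarrow> real \<Rightarrow> real \<Rightarrow> real) \<Rightarrow> real \<Rightarrow> real \<Rightarrow> real
    \<Rightarrow> (real \<Rightarrow> complex) \<Rightarrow> real \<Rightarrow> complex" where
  "Sop n p a b l y = (\<lambda>x. \<Sum>k=0..n. (-1) ^ (n - k) *
      nder a b (n - k) (\<lambda>t. complex_of_real (p k t l) * nder a b (n - k) y t) x)"

(* eigenspace ker(S(l) - mu) in L_2[a,b]; elements are represented by functions
   vanishing outside [a,b] (elements of W_2^{2n} are continuous, so this is a
   faithful representation of the L_2 classes) *)
definition eigsp :: "nat \<Rightarrow> (nat \<Rightarrow> real \<Rightarrow> real \<Rightarrow> real) \<Rightarrow> (real \<Rightarrow> complex mat) \<Rightarrow> real \<Rightarrow> real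
    \<Rightarrow> real \<Rightarrow> complex \<Rightarrow> (real \<Rightarrow> complex) set" where
  "eigsp n p U a b l \<mu> = {y. Sdom n p U a b l y \<and> (\<forall>x. x \<notin> {a..b} \<longrightarrow> y x = 0) \<and>
      (AE x in lebesgue. x \<in> {a..b} \<longrightarrow> Sop n p a b l y x = \<mu> * y x)}"

definition emult :: "nat \<Rightarrow> (nat \<Rightarrow> real \<Rightarrow> real \<Rightarrow> real) \<Rightarrow> (real \<Rightarrow> complex mat) \<Rightarrow> real \<Rightarrow> real
    \<Rightarrow> real \<Rightarrow> complex \<Rightarrow> nat" where
  "emult n p U a b l \<mu> = vector_space.dim (\<lambda>(c::complex) (f::real \<Rightarrow> complex). (\<lambda>x. c * f x))
      (eigsp n p U a b l \<mu>)"

definition esum :: "('a \<Rightarrow> nat) \<Rightarrow> 'a set \<Rightarrow> enat" where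
  "esum f A = (SUP F\<in>{F. finite F \<and> F \<subseteq> A}. enat (\<Sum>x\<in>F. f x))"

definition NS :: "nat \<Rightarrow> (nat \<Rightarrow> real \<Rightarrow> real \<Rightarrow> real) \<Rightarrow> (real \<Rightarrow> complex mat) \<Rightarrow> real \<Rightarrow> real
    \<Rightarrow> real \<Rightarrow> real \<Rightarrow> enat" where
  "NS n p U a b \<xi>1 \<xi>2 = esum (\<lambda>l. emult n p U a b l 0) {\<xi>1..<\<xi>2}"

definition nuS :: "nat \<Rightarrow> (nat \<Rightarrow> real \<Rightarrow> real \<Rightarrow> real) \<Rightarrow> (real \<Rightarrow> complex mat) \<Rightarrow> real \<Rightarrow> real
    \<Rightarrow> real \<Rightarrow> enat" where
  "nuS n p U a b l = esum (\<lambda>\<mu>. emult n p U a b l (complex_of_real \<mu>)) {\<mu>. \<mu> < 0}"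

end

theory Submission
  imports Defs "HOL-Complex_Analysis.Complex_Analysis"
begin

text \<open>
  For fixed \<open>l\<close>, quasi-derivatives turn \<open>S(l) y = \<mu> y\<close> into a first order linear system whose coefficients are
  continuous in \<open>l\<close> and affine in \<open>\<mu>\<close>. Hence the eigenvalues are the zeros of the determinant \<open>D(l, \<mu>)\<close> of the boundary
  conditions applied to a fundamental matrix, which is entire in \<open>\<mu>\<close> and jointly continuous. Green's
  identity shows that all zeros are real and that the order of a zero is the multiplicity of the eigenvalue.
  Green's identity together with interpolation inequalities also bounds the eigenvalues from below, locally uniformly in \<open>l\<close>; here
  the constant rank of \<open>U(l) - 1\<close> is needed, since otherwise eigenvalues may escape to \<open>- \<infinity>\<close>.
  By Rouche's theorem the number of eigenvalues in a real interval whose end points are no eigenvalues is locally constant in \<open>l\<close>.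
  So near \<open>l0\<close> the number of negative eigenvalues of \<open>S(l)\<close> is at least that of \<open>S(l0)\<close> and
  exceeds it by at most the multiplicity of \<open>0\<close> as an eigenvalue of \<open>S(l0)\<close>, and the inequality
  follows by moving from \<open>\<xi>1\<close> to \<open>\<xi>2\<close>.
\<close>

section \<open>Calculus of the iterated derivatives on an interval\<close>

text \<open>The \<open>p k\<close> are jointly continuous in (x, l), but nothing is known about how
  their x-derivatives depend on l. Expanding S(l) y would produce such derivatives as coefficients;
  in the quasi-derivative system only the values of \<open>p k\<close> and 1 / \<open>p 0\<close>
  occur. Self-adjointness enters through one identity, \<open>energy_defect\<close>, valid for every
  complex \<mu> and every solution of the system: it expresses Im \<mu> ||y||^2 by the failure of
  the boundary condition. No failure makes \<mu> real; a failure o(t) at height t above a real point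
  forces y to 0, which rules out Jordan chains. The constant rank is used where the boundary term
  <y^vee, y^wedge> is bounded by |y^wedge|^2. The part of y^vee in ker(U - 1) is orthogonal to
  y^wedge and drops out; the rest comes from inverting U - 1 off its kernel, and that inverse
  explodes if an eigenvalue of U different from 1 moves to 1. The number of crossings may be
  infinite, since 0 may be an eigenvalue for every l. Hence counts live in \<open>enat\<close>, and
  the inequality is proved in additive form.\<close>

lemma vector_derivative_cong:
  assumes "\<And>x. x \<in> S \<Longrightarrow> f x = g x" "x \<in> S"
  shows "vector_derivative f (at x within S) = vector_derivative g (at x within S)"
proof -
  have "(f has_vector_derivative D) (at x within S) \<longleftrightarrow> (g has_vector_derivative D) (at x within S)" for D
    using assms has_vector_derivative_transform[of x S f g D] has_vector_derivative_transform[of x S g f D]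
    by (metis)
  then show ?thesis unfolding vector_derivative_def by simp
qed

lemma nder_cong:
  assumes "\<And>x. x \<in> {a..b} \<Longrightarrow> f x = g x" "x \<in> {a..b}"
  shows "nder a b k f x = nder a b k g x"
  using assms(2)
proof (induction k arbitrary: x)
  case 0
  then show ?case using assms(1) by simp
next
  case (Suc k)
  then show ?case using vector_derivative_cong[of "{a..b}" "nder a b k f" "nder a b k g" x] by simp
qed

lemma nder_nder: "nder a b k (nder a b j f) = nder a b (k + j) f"
  by (induction k) auto

lemma Cm_cong:
  assumes "\<And>x. x \<in> {a..b} \<Longrightarrow> f x = g x"
  shows "Cm m a b f \<longleftrightarrow> Cm m a b g"
proof -
  have e: "nder a b k f x = nder a b k g x" if "x \<in> {a..b}" for x k
    using nder_cong assms that by blast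
  have 1: "continuous_on {a..b} (nder a b k f) \<longleftrightarrow> continuous_on {a..b} (nder a b k g)" for k
    using e by (intro continuous_on_cong) auto
  have 2: "(nder a b j f has_vector_derivative D) (at x within {a..b})
     \<longleftrightarrow> (nder a b j g has_vector_derivative D) (at x within {a..b})" if "x \<in> {a..b}" for x j D
    using e that has_vector_derivative_transform[of x "{a..b}" "nder a b j f" "nder a b j g" D]
     has_vector_derivative_transform[of x "{a..b}" "nder a b j g" "nder a b j f" D]
    by metis
  have 3: "(nder a b j f has_vector_derivative nder a b (Suc j) f x) (at x within {a..b})
     \<longleftrightarrow> (nder a b j g has_vector_derivative nder a b (Suc j) g x) (at x within {a..b})" if "x \<in> {a..b}" for x j
    unfolding 2[OF that] e[OF that, of "Suc j"] by (rule refl)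
  show ?thesis unfolding Cm_def
    by (intro arg_cong2[where f = conj] all_cong ball_cong refl 1 3)
qed

lemma Cm_0: "Cm 0 a b f \<longleftrightarrow> continuous_on {a..b} f"
  by (simp add: Cm_def)

lemma Cm_mono: "Cm m a b f \<Longrightarrow> k \<le> m \<Longrightarrow> Cm k a b f"
  by (auto simp: Cm_def)

lemma Cm_continuous: "Cm m a b f \<Longrightarrow> continuous_on {a..b} f"
  using Cm_mono[of m a b f 0] Cm_0 by auto

lemma Cm_continuous_nder: "Cm m a b f \<Longrightarrow> j \<le> m \<Longrightarrow> continuous_on {a..b} (nder a b j f)"
  by (auto simp: Cm_def)

lemma Cm_nder_has_derivative: "Cm m a b f \<Longrightarrow> j < m \<Longrightarrow> x \<in> {a..b} \<Longrightarrow>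
    (nder a b j f has_vector_derivative nder a b (Suc j) f x) (at x within {a..b})"
  by (auto simp: Cm_def)

lemma Cm_nder: "Cm (m + k) a b f \<Longrightarrow> Cm m a b (nder a b k f)"
  unfolding Cm_def nder_nder using add_Suc[of _ k] by (metis add_le_mono1 add_less_mono1)

text \<open>Splitting off the first derivative instead of the last one allows closure of
  \<open>Cm\<close> under products and inverses to be proved by induction on m from the first-order
  differentiation rules.\<close>

lemma Cm_Suc_iff: "Cm (Suc m) a b f \<longleftrightarrow>
    (\<forall>x\<in>{a..b}. (f has_vector_derivative nder a b 1 f x) (at x within {a..b})) \<and> Cm m a b (nder a b 1 f)"
  (is "?L \<longleftrightarrow> ?R1 \<and> ?R2")
proof
  assume L: ?L
  have "Cm m a b (nder a b 1 f)" using L by (intro Cm_nder) simp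
  moreover have ?R1 using Cm_nder_has_derivative[OF L, of 0] by simp
  ultimately show "?R1 \<and> ?R2" by simp
next
  assume R: "?R1 \<and> ?R2"
  have c0: "continuous_on {a..b} f" using R continuous_on_vector_derivative by blast
  have "continuous_on {a..b} (nder a b j f)" if "j \<le> Suc m" for j
  proof (cases j)
    case 0 then show ?thesis using c0 by simp
  next
    case (Suc i)
    then have "continuous_on {a..b} (nder a b i (nder a b 1 f))"
      using R that Cm_continuous_nder by auto
    then show ?thesis unfolding nder_nder Suc by simp
  qed
  moreover have "(nder a b j f has_vector_derivative nder a b (Suc j) f x) (at x within {a..b})"
    if "j < Suc m" "x \<in> {a..b}" for j x
  proof (cases j)
    case 0 then show ?thesis using R that by simp
  next
    case (Suc i)
    then have "(nder a b i (nder a b 1 f) has_vector_derivative nder a b (Suc i) (nder a b 1 f) x) (at x within {a..b})"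
      using R that Cm_nder_has_derivative[of m a b "nder a b 1 f" i x] by auto
    then show ?thesis unfolding nder_nder Suc by simp
  qed
  ultimately show ?L unfolding Cm_def by blast
qed

context
  fixes a b :: real
  assumes ab: "a < b"
begin

text \<open>As a < b, no point of [a, b] is isolated, so a derivative within [a, b] is unique and is
  the value that \<open>vector_derivative\<close> picks. Every identification of \<open>nder\<close>
  with an explicit derivative rests on this.\<close>

lemma nder_SucI: "x \<in> {a..b} \<Longrightarrow> (nder a b k f has_vector_derivative D) (at x within {a..b}) \<Longrightarrow>
    nder a b (Suc k) f x = D"
  unfolding nder.simps(2) using ab by (intro vector_derivative_within) (auto simp: trivial_limit_within)

lemma nder_1I: "x \<in> {a..b} \<Longrightarrow> (f has_vector_derivative D) (at x within {a..b}) \<Longrightarrow> nder a b 1 f x = D"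
  using nder_SucI[of x 0] by simp

lemma Cm_SucI:
  assumes "\<And>x. x \<in> {a..b} \<Longrightarrow> (f has_vector_derivative f' x) (at x within {a..b})" "Cm m a b f'"
  shows "Cm (Suc m) a b f"
  unfolding Cm_Suc_iff
proof
  have e: "nder a b 1 f x = f' x" if "x \<in> {a..b}" for x using nder_1I assms that by blast
  show "\<forall>x\<in>{a..b}. (f has_vector_derivative nder a b 1 f x) (at x within {a..b})"
    using assms e by auto
  show "Cm m a b (nder a b 1 f)" using Cm_cong[of a b "nder a b 1 f" f'] e assms by blast
qed

lemma Cm_SucE:
  assumes "Cm (Suc m) a b f"
  obtains f' where "\<And>x. x \<in> {a..b} \<Longrightarrow> (f has_vector_derivative f' x) (at x within {a..b})" "Cm m a b f'"
  using assms unfolding Cm_Suc_iff by blast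

lemma Cm_add: "Cm m a b f \<Longrightarrow> Cm m a b g \<Longrightarrow> Cm m a b (\<lambda>x. f x + g x)"
proof (induction m arbitrary: f g)
  case 0 then show ?case by (auto simp: Cm_0 intro!: continuous_intros)
next
  case (Suc m)
  obtain f' where f': "\<And>x. x \<in> {a..b} \<Longrightarrow> (f has_vector_derivative f' x) (at x within {a..b})" "Cm m a b f'"
    using Suc.prems(1) Cm_SucE by blast
  obtain g' where g': "\<And>x. x \<in> {a..b} \<Longrightarrow> (g has_vector_derivative g' x) (at x within {a..b})" "Cm m a b g'"
    using Suc.prems(2) Cm_SucE by blast
  show ?case by (rule Cm_SucI[where f' = "\<lambda>x. f' x + g' x"])
      (use f' g' Suc.IH in \<open>auto intro!: has_vector_derivative_add\<close>)
qed

lemma Cm_const: "Cm m a b (\<lambda>x. c)"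
proof (induction m arbitrary: c)
  case 0 then show ?case by (auto simp: Cm_0)
next
  case (Suc m)
  show ?case by (rule Cm_SucI[where f' = "\<lambda>x. 0"]) (use Suc in auto)
qed

lemma Cm_mult:
  fixes f g :: "real \<Rightarrow> 'v::real_normed_algebra"
  shows "Cm m a b f \<Longrightarrow> Cm m a b g \<Longrightarrow> Cm m a b (\<lambda>x. f x * g x)"
proof (induction m arbitrary: f g)
  case 0 then show ?case by (auto simp: Cm_0 intro!: continuous_intros)
next
  case (Suc m)
  obtain f' where f': "\<And>x. x \<in> {a..b} \<Longrightarrow> (f has_vector_derivative f' x) (at x within {a..b})" "Cm m a b f'"
    using Suc.prems(1) Cm_SucE by blast
  obtain g' where g': "\<And>x. x \<in> {a..b} \<Longrightarrow> (g has_vector_derivative g' x) (at x within {a..b})" "Cm m a b g'"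
    using Suc.prems(2) Cm_SucE by blast
  have "Cm m a b f" "Cm m a b g" using Suc.prems Cm_mono by (metis le_SucI order_refl)+
  then have "Cm m a b (\<lambda>x. f x * g' x + f' x * g x)"
    using f' g' by (intro Cm_add Suc.IH) auto
  then show ?case by (rule Cm_SucI[rotated])
      (use f' g' in \<open>auto intro!: has_vector_derivative_mult\<close>)
qed

lemma Cm_minus:
  fixes f :: "real \<Rightarrow> 'v::real_normed_algebra_1"
  assumes "Cm m a b f" shows "Cm m a b (\<lambda>x. - f x)"
  using Cm_mult[OF Cm_const[of _ "-1"] assms] by simp

lemma Cm_diff:
  fixes f :: "real \<Rightarrow> 'v::real_normed_algebra_1"
  shows "Cm m a b f \<Longrightarrow> Cm m a b g \<Longrightarrow> Cm m a b (\<lambda>x. f x - g x)"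
  using Cm_add[OF _ Cm_minus] by force

lemma Cm_of_real: 
  fixes f :: "real \<Rightarrow> real"
  shows "Cm m a b f \<Longrightarrow> Cm m a b (\<lambda>x. complex_of_real (f x))"
proof (induction m arbitrary: f)
  case 0 then show ?case by (auto simp: Cm_0 intro!: continuous_intros)
next
  case (Suc m)
  obtain f' where f': "\<And>x. x \<in> {a..b} \<Longrightarrow> (f has_vector_derivative f' x) (at x within {a..b})" "Cm m a b f'"
    using Suc.prems(1) Cm_SucE by blast
  show ?case by (rule Cm_SucI[where f' = "\<lambda>x. complex_of_real (f' x)"])
      (use f' Suc.IH in \<open>auto intro!: has_vector_derivative_of_real simp: has_real_derivative_iff_has_vector_derivative\<close>)
qed

lemma Cm_inverse: 
  fixes f :: "real \<Rightarrow> complex"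
  assumes "\<And>x. x \<in> {a..b} \<Longrightarrow> f x \<noteq> 0"
  shows "Cm m a b f \<Longrightarrow> Cm m a b (\<lambda>x. inverse (f x))"
proof (induction m)
  case 0 then show ?case using assms by (auto simp: Cm_0 intro!: continuous_intros)
next
  case (Suc m)
  obtain f' where f': "\<And>x. x \<in> {a..b} \<Longrightarrow> (f has_vector_derivative f' x) (at x within {a..b})" "Cm m a b f'"
    using Suc.prems(1) Cm_SucE by blast
  have "Cm m a b f" using Suc.prems Cm_mono by (metis le_SucI order_refl)
  then have IH: "Cm m a b (\<lambda>x. inverse (f x))" by (rule Suc.IH)
  \<comment> \<open>The derivative - f' / f^2 is spelled with two factors inverse (f x), so that the
    induction hypothesis and \<open>Cm_mult\<close> give its regularity.\<close>
  have "((\<lambda>x. inverse (f x)) has_vector_derivative f' x * (- (inverse (f x) * inverse (f x)))) (at x within {a..b})"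
    if x: "x \<in> {a..b}" for x
    using field_vector_diff_chain_within[OF f'(1)[OF x] DERIV_inverse[OF assms[OF x]]]
    by (simp add: o_def power2_eq_square)
  then show ?case by (rule Cm_SucI) (auto intro!: Cm_mult Cm_minus f' IH simp del: minus_mult_right mult_minus_right)
qed

end

section \<open>Linear systems with parameters\<close>

definition linsol :: "nat \<Rightarrow> (nat \<Rightarrow> nat \<Rightarrow> real \<Rightarrow> complex) \<Rightarrow> real \<Rightarrow> real \<Rightarrow> (nat \<Rightarrow> real \<Rightarrow> complex) \<Rightarrow> bool" where
  "linsol N A a b Y \<longleftrightarrow> (\<forall>i<N. \<forall>x\<in>{a..b}.
     (Y i has_vector_derivative (\<Sum>j<N. A i j x * Y j x)) (at x within {a..b}))"

text \<open>The iterated integrals of the Peano-Baker series; column j is the Picard iteration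
  started at the j-th unit vector. With an explicit series, continuity in parameters and polynomial
  dependence on \<mu> can be checked term by term and carried over by uniform convergence.\<close>

primrec picard_term :: "nat \<Rightarrow> (nat \<Rightarrow> nat \<Rightarrow> real \<Rightarrow> complex) \<Rightarrow> real \<Rightarrow> nat \<Rightarrow> nat \<Rightarrow> nat \<Rightarrow> real \<Rightarrow> complex" where
  "picard_term N A a 0 = (\<lambda>i j x. if i = j then 1 else 0)"
| "picard_term N A a (Suc k) = (\<lambda>i j x. integral {a..x} (\<lambda>s. \<Sum>l<N. A i l s * picard_term N A a k l j s))"

definition fundmat :: "nat \<Rightarrow> (nat \<Rightarrow> nat \<Rightarrow> real \<Rightarrow> complex) \<Rightarrow> real \<Rightarrow> nat \<Rightarrow> nat \<Rightarrow> real \<Rightarrow> complex" where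
  "fundmat N A a i j x = (\<Sum>k. picard_term N A a k i j x)"

lemma linsol_continuous: "linsol N A a b Y \<Longrightarrow> i < N \<Longrightarrow> continuous_on {a..b} (Y i)"
  by (rule continuous_on_vector_derivative[where f' = "\<lambda>x. \<Sum>j<N. A i j x * Y j x"]) (auto simp: linsol_def)

text \<open>A sup norm with weight exp (L (x - a)): integration from a gains the factor 1 / L,
  whatever the length of the interval.\<close>

lemma norm_integral_exp_weight_le:
  fixes F :: "real \<Rightarrow> complex"
  assumes F: "continuous_on {a..b} F" and "L > 0"
    and le: "\<And>s. s \<in> {a..b} \<Longrightarrow> norm (F s) \<le> c * L * exp (L * (s - a))"
    and x: "x \<in> {a..b}" and c: "c \<ge> 0"
  shows "norm (integral {a..x} F) \<le> c * exp (L * (x - a))"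
proof -
  have d: "((\<lambda>s. c * exp (L * (s - a))) has_vector_derivative c * L * exp (L * (s - a))) (at s within {a..x})" for s
    unfolding has_real_derivative_iff_has_vector_derivative[symmetric]
    by (auto intro!: derivative_eq_intros)
  have I: "((\<lambda>s. c * L * exp (L * (s - a))) has_integral c * exp (L * (x - a)) - c * exp (L * (a - a))) {a..x}"
    using x by (intro fundamental_theorem_of_calculus d) auto
  have "norm (integral {a..x} F) \<le> integral {a..x} (\<lambda>s. c * L * exp (L * (s - a)))"
    using x by (intro integral_norm_bound_integral integrable_continuous_interval continuous_on_subset[OF F] le
        has_integral_integrable[OF I]) auto
  also have "\<dots> = c * exp (L * (x - a)) - c" using integral_unique[OF I] by simp
  finally show ?thesis using c by simp
qed

lemma uniform_limit_sum:
  fixes f :: "'i \<Rightarrow> 'n \<Rightarrow> 'x \<Rightarrow> complex"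
  assumes "\<And>i. i \<in> I \<Longrightarrow> uniform_limit X (f i) (g i) F"
  shows "uniform_limit X (\<lambda>n x. \<Sum>i\<in>I. f i n x) (\<lambda>x. \<Sum>i\<in>I. g i x) F"
  using assms by (induction I rule: infinite_finite_induct) (auto intro: uniform_limit_add uniform_limit_const)

text \<open>The weight L = 2 (N M + 1) makes one Picard step a contraction by 1/2 on all of [a, b]:
  multiplication by the matrix costs at most N M \<le> L / 2, integration returns 1 / L. The summand
  1 keeps L positive when N M = 0.\<close>

lemma picard_step_le:
  fixes F :: "nat \<Rightarrow> real \<Rightarrow> complex"
  assumes F: "\<And>l. l < N \<Longrightarrow> continuous_on {a..b} (F l)" and A: "\<And>l. l < N \<Longrightarrow> continuous_on {a..b} (A l)"
    and M: "\<And>l s. l < N \<Longrightarrow> s \<in> {a..b} \<Longrightarrow> norm (A l s) \<le> M" "M \<ge> 0"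
    and L: "L = 2 * (real N * M + 1)"
    and le: "\<And>l s. l < N \<Longrightarrow> s \<in> {a..b} \<Longrightarrow> norm (F l s) \<le> c * exp (L * (s - a))"
    and x: "x \<in> {a..b}" and c: "c \<ge> 0"
  shows "norm (integral {a..x} (\<lambda>s. \<Sum>l<N. A l s * F l s)) \<le> c / 2 * exp (L * (x - a))"
proof (rule norm_integral_exp_weight_le[where b = b])
  show "continuous_on {a..b} (\<lambda>s. \<Sum>l<N. A l s * F l s)" by (intro continuous_intros F A) auto
  show "L > 0" using L M(2) by (simp add: add_nonneg_pos)
  show "x \<in> {a..b}" "c / 2 \<ge> 0" using x c by auto
  fix s assume s: "s \<in> {a..b}"
  have "norm (\<Sum>l<N. A l s * F l s) \<le> (\<Sum>l<N. M * (c * exp (L * (s - a))))"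
    using M le s by (intro sum_norm_le) (auto simp: norm_mult intro!: mult_mono)
  also have "\<dots> = real N * M * (c * exp (L * (s - a)))" by simp
  also have "\<dots> \<le> (L / 2) * (c * exp (L * (s - a)))" using L c by (intro mult_right_mono) auto
  finally show "norm (\<Sum>l<N. A l s * F l s) \<le> c / 2 * L * exp (L * (s - a))" by (simp add: mult_ac)
qed

text \<open>The substitution s = a + r (x - a) moves the variable upper limit into the integrand and
  leaves a parameter integral over the fixed interval [0, 1].\<close>

lemma continuous_on_indefinite_integral_param:
  fixes f :: "'p::topological_space \<Rightarrow> real \<Rightarrow> complex"
  assumes f: "continuous_on (\<Theta> \<times> {a..b}) (\<lambda>(\<theta>, s). f \<theta> s)"
  shows "continuous_on (\<Theta> \<times> {a..b}) (\<lambda>(\<theta>, x). integral {a..x} (f \<theta>))"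
proof -
  let ?g = "\<lambda>(\<theta>, x) r. complex_of_real (x - a) * f \<theta> (a + r * (x - a))"
  have eq: "integral {a..x} (f \<theta>) = integral (cbox 0 1) (?g (\<theta>, x))" if "\<theta> \<in> \<Theta>" "x \<in> {a..b}" for \<theta> x
  proof -
    have fc: "continuous_on {a..x} (f \<theta>)"
    proof -
      have "continuous_on {a..x} ((\<lambda>(\<theta>, s). f \<theta> s) \<circ> (\<lambda>s. (\<theta>, s)))"
        using that by (intro continuous_on_compose continuous_intros continuous_on_subset[OF f]) auto
      then show ?thesis by (simp add: o_def)
    qed
    have "((\<lambda>r. (x - a) *\<^sub>R f \<theta> (a + r * (x - a))) has_integral integral {a + 0 * (x - a)..a + 1 * (x - a)} (f \<theta>)) {0..1}"
    proof (rule has_integral_substitution)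
      show "continuous_on {a..x} (f \<theta>)" by fact
      show "(\<lambda>r. a + r * (x - a)) ` {0..1} \<subseteq> {a..x}"
      proof clarify
        fix r :: real assume "r \<in> {0..1}"
        then have "0 \<le> r * (x - a)" "r * (x - a) \<le> 1 * (x - a)"
          using that mult_right_mono[of r 1 "x - a"] by auto
        then show "a + r * (x - a) \<in> {a..x}" by auto
      qed
      show "((\<lambda>r. a + r * (x - a)) has_real_derivative (x - a)) (at r within {0..1})" for r
        by (auto intro!: derivative_eq_intros)
    qed (use that in auto)
    from integral_unique[OF this] show ?thesis
      unfolding case_prod_conv box_real scaleR_conv_of_real by simp
  qed
  have "continuous_on ((\<Theta> \<times> {a..b}) \<times> cbox 0 1) (\<lambda>(q, r). ?g q r)"
  proof -
    have "continuous_on ((\<Theta> \<times> {a..b}) \<times> cbox 0 1)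
       (\<lambda>z. (\<lambda>(\<theta>, s). f \<theta> s) (fst (fst z), a + snd z * (snd (fst z) - a)))"
    proof (rule continuous_on_compose2[OF f])
      show "continuous_on ((\<Theta> \<times> {a..b}) \<times> cbox 0 1) (\<lambda>z. (fst (fst z), a + snd z * (snd (fst z) - a)))"
        by (intro continuous_intros)
      show "(\<lambda>z. (fst (fst z), a + snd z * (snd (fst z) - a))) ` ((\<Theta> \<times> {a..b}) \<times> cbox 0 1) \<subseteq> \<Theta> \<times> {a..b}"
      proof (rule image_subsetI)
        fix z assume z: "z \<in> (\<Theta> \<times> {a..b}) \<times> cbox 0 (1::real)"
        then have *: "fst (fst z) \<in> \<Theta>" "a \<le> snd (fst z)" "snd (fst z) \<le> b" "0 \<le> snd z" "snd z \<le> 1"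
          by (auto simp: mem_Times_iff)
        define t where "t = snd z * (snd (fst z) - a)"
        have "0 \<le> t" "t \<le> snd (fst z) - a" unfolding t_def
          using * mult_right_mono[of "snd z" 1 "snd (fst z) - a"] by auto
        then have "a \<le> a + t" "a + t \<le> b" using * by linarith+
        then show "(fst (fst z), a + snd z * (snd (fst z) - a)) \<in> \<Theta> \<times> {a..b}"
          using * by (simp add: t_def)
      qed
    qed
    moreover have "continuous_on ((\<Theta> \<times> {a..b}) \<times> cbox 0 (1::real)) (\<lambda>z. complex_of_real (snd (fst z) - a))"
      by (intro continuous_intros)
    ultimately have "continuous_on ((\<Theta> \<times> {a..b}) \<times> cbox 0 1)
       (\<lambda>z. complex_of_real (snd (fst z) - a) * (\<lambda>(\<theta>, s). f \<theta> s) (fst (fst z), a + snd z * (snd (fst z) - a)))"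
      by (rule continuous_on_mult[rotated])
    then show ?thesis by (simp add: case_prod_beta)
  qed
  then have "continuous_on (\<Theta> \<times> {a..b}) (\<lambda>q. integral (cbox 0 1) (?g q))"
    by (rule integral_continuous_on_param)
  then show ?thesis
    by (rule continuous_on_eq) (use eq in auto)
qed

context
  fixes A :: "'p::topological_space \<Rightarrow> nat \<Rightarrow> nat \<Rightarrow> real \<Rightarrow> complex" and N :: nat and a b M :: real and \<Theta> :: "'p set"
  assumes cont: "\<And>i l. i < N \<Longrightarrow> l < N \<Longrightarrow> continuous_on (\<Theta> \<times> {a..b}) (\<lambda>(\<theta>, s). A \<theta> i l s)"
    and bound: "\<And>\<theta> i l s. \<theta> \<in> \<Theta> \<Longrightarrow> i < N \<Longrightarrow> l < N \<Longrightarrow> s \<in> {a..b} \<Longrightarrow> norm (A \<theta> i l s) \<le> M"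
    and M: "M \<ge> 0" and ab: "a \<le> b"
begin

lemma continuous_slice:
  fixes f :: "'p \<Rightarrow> real \<Rightarrow> complex"
  assumes "continuous_on (\<Theta> \<times> {a..b}) (\<lambda>(\<theta>, s). f \<theta> s)" "\<theta> \<in> \<Theta>"
  shows "continuous_on {a..b} (f \<theta>)"
proof -
  have "continuous_on {a..b} ((\<lambda>(\<theta>, s). f \<theta> s) \<circ> (\<lambda>s. (\<theta>, s)))"
    using assms by (intro continuous_on_compose continuous_intros continuous_on_subset[OF assms(1)]) auto
  then show ?thesis by (simp add: o_def)
qed

lemma picard_term_continuous_param:
  "i < N \<Longrightarrow> continuous_on (\<Theta> \<times> {a..b}) (\<lambda>(\<theta>, x). picard_term N (A \<theta>) a k i j x)"
proof (induction k arbitrary: i)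
  case 0 show ?case by (simp add: case_prod_beta)
next
  case (Suc k)
  have "continuous_on (\<Theta> \<times> {a..b}) (\<lambda>(\<theta>, s). \<Sum>l<N. A \<theta> i l s * picard_term N (A \<theta>) a k l j s)"
    using cont Suc unfolding case_prod_beta by (intro continuous_intros) auto
  from continuous_on_indefinite_integral_param[OF this] show ?case by simp
qed

abbreviation "weight \<equiv> 2 * (real N * M + 1)"

lemma picard_term_bound:
  assumes "\<theta> \<in> \<Theta>"
  shows "i < N \<Longrightarrow> x \<in> {a..b} \<Longrightarrow> norm (picard_term N (A \<theta>) a k i j x) \<le> (1/2)^k * exp (weight * (x - a))"
proof (induction k arbitrary: i x)
  case 0
  have "0 \<le> weight * (x - a)" using 0 M by (intro mult_nonneg_nonneg) auto
  then show ?case by simp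
next
  case (Suc k)
  have "norm (integral {a..x} (\<lambda>s. \<Sum>l<N. A \<theta> i l s * picard_term N (A \<theta>) a k l j s)) \<le> (1/2)^k / 2 * exp (weight * (x - a))"
    by (rule picard_step_le[where M = M and b = b])
       (use Suc assms bound M continuous_slice[OF cont] continuous_slice[OF picard_term_continuous_param] in auto)
  then show ?case by simp
qed

text \<open>The majorant 2^(-k) exp (\<open>weight\<close> (b - a)) depends neither on x nor on the
  parameter, so the M-test works jointly in both. The parameter space is left abstract because it is
  later a set of pairs (l, \<mu>), a disc of values \<mu>, or a single point.\<close>

lemma fundmat_uniform_limit:
  assumes i: "i < N"
  shows "uniform_limit (\<Theta> \<times> {a..b}) (\<lambda>K (\<theta>, x). \<Sum>k<K. picard_term N (A \<theta>) a k i j x)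
           (\<lambda>(\<theta>, x). fundmat N (A \<theta>) a i j x) sequentially"
proof -
  have "uniform_limit (\<Theta> \<times> {a..b}) (\<lambda>K q. \<Sum>k<K. picard_term N (A (fst q)) a k i j (snd q))
           (\<lambda>q. \<Sum>k. picard_term N (A (fst q)) a k i j (snd q)) sequentially"
  proof (rule Weierstrass_m_test)
    show "summable (\<lambda>k. (1/2)^k * exp (weight * (b - a)))"
      by (intro summable_mult2 summable_geometric) simp
    fix k and q :: "'p \<times> real" assume q: "q \<in> \<Theta> \<times> {a..b}"
    have "norm (picard_term N (A (fst q)) a k i j (snd q)) \<le> (1/2)^k * exp (weight * (snd q - a))"
      using q i by (intro picard_term_bound) auto
    also have "\<dots> \<le> (1/2)^k * exp (weight * (b - a))"
      using q M by (auto intro!: mult_left_mono)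
    finally show "norm (picard_term N (A (fst q)) a k i j (snd q)) \<le> (1/2)^k * exp (weight * (b - a))" .
  qed
  then show ?thesis unfolding fundmat_def case_prod_unfold .
qed

lemma fundmat_continuous_param:
  assumes "i < N"
  shows "continuous_on (\<Theta> \<times> {a..b}) (\<lambda>(\<theta>, x). fundmat N (A \<theta>) a i j x)"
  by (rule uniform_limit_theorem[OF _ fundmat_uniform_limit[OF assms]])
    (auto simp: case_prod_beta intro!: always_eventually continuous_intros
      picard_term_continuous_param[OF assms, unfolded case_prod_beta])

lemma fundmat_uniform_limit_slice:
  assumes i: "i < N" and \<theta>: "\<theta> \<in> \<Theta>"
  shows "uniform_limit {a..b} (\<lambda>K x. \<Sum>k<K. picard_term N (A \<theta>) a k i j x) (fundmat N (A \<theta>) a i j) sequentially"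
proof -
  have "uniform_limit {a..b} (\<lambda>K x. (\<lambda>(\<theta>, x). \<Sum>k<K. picard_term N (A \<theta>) a k i j x) (\<theta>, x))
    (\<lambda>x. (\<lambda>(\<theta>, x). fundmat N (A \<theta>) a i j x) (\<theta>, x)) sequentially"
    by (rule uniform_limit_compose'[OF fundmat_uniform_limit[OF i]]) (use \<theta> in auto)
  then show ?thesis by simp
qed

text \<open>The partial sums S satisfy S(K + 1) = I + integral of A S(K), and uniform convergence
  carries this recursion to the limit. The differential equation follows from it by the fundamental
  theorem of calculus.\<close>

lemma fundmat_integral_eq:
  assumes i: "i < N" and \<theta>: "\<theta> \<in> \<Theta>" and x: "x \<in> {a..b}"
  shows "fundmat N (A \<theta>) a i j x = (if i = j then 1 else 0) +
    integral {a..x} (\<lambda>s. \<Sum>l<N. A \<theta> i l s * fundmat N (A \<theta>) a l j s)"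
proof -
  let ?S = "\<lambda>K l s. \<Sum>k<K. picard_term N (A \<theta>) a k l j s"
  have pc: "continuous_on {a..b} (picard_term N (A \<theta>) a k l j)" if "l < N" for k l
    using continuous_slice[OF picard_term_continuous_param[OF that] \<theta>] .
  have Ac: "continuous_on {a..b} (A \<theta> i l)" if "l < N" for l
    using continuous_slice[OF cont[OF i that] \<theta>] .
  have S: "?S (Suc K) i x = (if i = j then 1 else 0) + integral {a..x} (\<lambda>s. \<Sum>l<N. A \<theta> i l s * ?S K l s)" for K
  proof -
    have "?S (Suc K) i x = (if i = j then 1 else 0) + (\<Sum>k<K. picard_term N (A \<theta>) a (Suc k) i j x)"
      by (subst sum.lessThan_Suc_shift) simp
    also have "(\<Sum>k<K. picard_term N (A \<theta>) a (Suc k) i j x)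
       = integral {a..x} (\<lambda>s. \<Sum>k<K. \<Sum>l<N. A \<theta> i l s * picard_term N (A \<theta>) a k l j s)"
      unfolding picard_term.simps
      by (subst integral_sum) (use x in \<open>auto intro!: integrable_continuous_interval continuous_intros
          continuous_on_subset[OF pc] continuous_on_subset[OF Ac]\<close>)
    also have "\<dots> = integral {a..x} (\<lambda>s. \<Sum>l<N. A \<theta> i l s * ?S K l s)"
      by (subst sum.swap) (simp add: sum_distrib_left)
    finally show ?thesis .
  qed
  have bA: "bounded (A \<theta> i l ` {a..x})" if "l < N" for l
    using Ac[OF that] x by (intro compact_imp_bounded compact_continuous_image continuous_on_subset[OF Ac[OF that]]) auto
  have bF: "bounded (fundmat N (A \<theta>) a l j ` {a..x})" if "l < N" for l
    using x by (intro compact_imp_bounded compact_continuous_image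
       continuous_on_subset[OF continuous_slice[OF fundmat_continuous_param[OF that] \<theta>]]) auto
  have ul: "uniform_limit {a..x} (\<lambda>K s. \<Sum>l<N. A \<theta> i l s * ?S K l s)
      (\<lambda>s. \<Sum>l<N. A \<theta> i l s * fundmat N (A \<theta>) a l j s) sequentially"
    using x by (intro uniform_limit_sum bounded_bilinear.bounded_uniform_limit[OF bounded_bilinear_mult]
        uniform_limit_on_subset[OF fundmat_uniform_limit_slice[OF _ \<theta>]] uniform_limit_const)
      (auto intro!: bA bF)
  have uc: "continuous_on {a..x} (\<lambda>s. \<Sum>l<N. A \<theta> i l s * ?S K l s)" for K
    using x by (intro continuous_intros continuous_on_subset[OF Ac] continuous_on_subset[OF pc]) auto
  obtain I J where IJ: "\<And>K. ((\<lambda>s. \<Sum>l<N. A \<theta> i l s * ?S K l s) has_integral I K) {a..x}"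
     "((\<lambda>s. \<Sum>l<N. A \<theta> i l s * fundmat N (A \<theta>) a l j s) has_integral J) {a..x}" "(I \<longlongrightarrow> J) sequentially"
    using uniform_limit_integral[OF ul uc] by auto
  have "(\<lambda>K. ?S (Suc K) i x) \<longlonglongrightarrow> (if i = j then 1 else 0) + J"
    unfolding S integral_unique[OF IJ(1)] by (intro tendsto_intros IJ(3))
  moreover have "(\<lambda>K. ?S (Suc K) i x) \<longlonglongrightarrow> fundmat N (A \<theta>) a i j x"
    using LIMSEQ_Suc[OF tendsto_uniform_limitI[OF fundmat_uniform_limit_slice[OF i \<theta>] x]] .
  ultimately have "fundmat N (A \<theta>) a i j x = (if i = j then 1 else 0) + J" by (intro LIMSEQ_unique)
  then show ?thesis unfolding integral_unique[OF IJ(2)] .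
qed

lemma fundmat_linsol:
  assumes \<theta>: "\<theta> \<in> \<Theta>"
  shows "linsol N (A \<theta>) a b (\<lambda>i. fundmat N (A \<theta>) a i j)"
  unfolding linsol_def
proof (intro allI impI ballI)
  fix i x assume i: "i < N" and x: "x \<in> {a..b}"
  have c: "continuous_on {a..b} (\<lambda>s. \<Sum>l<N. A \<theta> i l s * fundmat N (A \<theta>) a l j s)"
    by (intro continuous_intros continuous_slice[OF cont[OF i] \<theta>] continuous_slice[OF fundmat_continuous_param \<theta>]) auto
  have "((\<lambda>x. (if i = j then 1 else 0) + integral {a..x} (\<lambda>s. \<Sum>l<N. A \<theta> i l s * fundmat N (A \<theta>) a l j s))
     has_vector_derivative 0 + (\<Sum>l<N. A \<theta> i l x * fundmat N (A \<theta>) a l j x)) (at x within {a..b})"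
    by (intro has_vector_derivative_add has_vector_derivative_const integral_has_vector_derivative[OF c x])
  then show "(fundmat N (A \<theta>) a i j has_vector_derivative (\<Sum>l<N. A \<theta> i l x * fundmat N (A \<theta>) a l j x)) (at x within {a..b})"
    using has_vector_derivative_transform[OF x fundmat_integral_eq[OF i \<theta>]] by simp
qed

lemma fundmat_initial: "i < N \<Longrightarrow> \<theta> \<in> \<Theta> \<Longrightarrow> fundmat N (A \<theta>) a i j a = (if i = j then 1 else 0)"
  using ab by (subst fundmat_integral_eq) auto

text \<open>Each substitution of the bound into Y = integral of A Y halves it in the weighted norm.
  So |Y| \<le> D 2^(-k) exp (\<open>weight\<close> (x - a)) for every k, which leaves only
  0.\<close>

lemma linsol_zero:
  assumes \<theta>: "\<theta> \<in> \<Theta>" and sol: "linsol N (A \<theta>) a b Y" and "\<And>i. i < N \<Longrightarrow> Y i a = 0"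
    and i: "i < N" and x: "x \<in> {a..b}"
  shows "Y i x = 0"
proof -
  have Yc: "continuous_on {a..b} (Y i)" if "i < N" for i using linsol_continuous sol that by blast
  have Ac: "continuous_on {a..b} (A \<theta> i l)" if "i < N" "l < N" for i l
    using continuous_slice[OF cont[OF that] \<theta>] .
  have Yint: "Y i x = integral {a..x} (\<lambda>s. \<Sum>l<N. A \<theta> i l s * Y l s)" if "i < N" "x \<in> {a..b}" for i x
  proof -
    have "((\<lambda>s. \<Sum>l<N. A \<theta> i l s * Y l s) has_integral Y i x - Y i a) {a..x}"
    proof (rule fundamental_theorem_of_calculus)
      show "a \<le> x" using that by simp
      fix s assume "s \<in> {a..x}"
      then have "(Y i has_vector_derivative (\<Sum>l<N. A \<theta> i l s * Y l s)) (at s within {a..b})"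
        using sol that unfolding linsol_def by auto
      then show "(Y i has_vector_derivative (\<Sum>l<N. A \<theta> i l s * Y l s)) (at s within {a..x})"
        by (rule has_vector_derivative_within_subset) (use that in auto)
    qed
    then show ?thesis using assms(3)[OF that(1)] by (simp add: integral_unique)
  qed
  have "\<exists>C. \<forall>s\<in>{a..b}. norm (Y l s) \<le> C" if "l < N" for l
    using compact_imp_bounded[OF compact_continuous_image[OF Yc[OF that]]] by (auto simp: bounded_iff)
  then obtain C where C: "\<And>l s. l < N \<Longrightarrow> s \<in> {a..b} \<Longrightarrow> norm (Y l s) \<le> C l" by metis
  define D where "D = (\<Sum>l<N. \<bar>C l\<bar>)"
  have D0: "D \<ge> 0" unfolding D_def by (simp add: sum_nonneg)
  have bd: "norm (Y l s) \<le> D * (1/2)^k * exp (weight * (s - a))" if "l < N" "s \<in> {a..b}" for l s k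
    using that
  proof (induction k arbitrary: l s)
    case 0
    have "norm (Y l s) \<le> \<bar>C l\<bar>" using C[OF 0] by linarith
    also have "\<dots> \<le> D" unfolding D_def using 0 by (intro member_le_sum) auto
    also have "D * 1 \<le> D * exp (weight * (s - a))"
      using 0 M D0 by (intro mult_left_mono) auto
    finally show ?case by simp
  next
    case (Suc k)
    have "norm (integral {a..s} (\<lambda>s. \<Sum>m<N. A \<theta> l m s * Y m s)) \<le> (D * (1/2)^k) / 2 * exp (weight * (s - a))"
      by (rule picard_step_le[where M = M and b = b]) (use Suc \<theta> bound M Yc Ac D0 in auto)
    then show ?case using Yint[OF Suc.prems] by simp
  qed
  have "(\<lambda>k. D * (1/2)^k * exp (weight * (x - a))) \<longlonglongrightarrow> D * 0 * exp (weight * (x - a))"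
    by (intro tendsto_intros LIMSEQ_power_zero) simp
  then have "norm (Y i x) \<le> D * 0 * exp (weight * (x - a))"
    by (rule LIMSEQ_le_const) (use bd[OF i x] in auto)
  then show ?thesis by simp
qed

lemma linsol_eq_fundmat:
  assumes \<theta>: "\<theta> \<in> \<Theta>" and sol: "linsol N (A \<theta>) a b Y" and i: "i < N" and x: "x \<in> {a..b}"
  shows "Y i x = (\<Sum>j<N. fundmat N (A \<theta>) a i j x * Y j a)"
proof -
  define Z where "Z = (\<lambda>i x. Y i x - (\<Sum>j<N. fundmat N (A \<theta>) a i j x * Y j a))"
  have "linsol N (A \<theta>) a b Z"
    unfolding linsol_def
  proof (intro allI impI ballI)
    fix i x assume ix: "i < N" "x \<in> {a..b}"
    have "(Z i has_vector_derivative (\<Sum>l<N. A \<theta> i l x * Y l x)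
        - (\<Sum>j<N. (\<Sum>l<N. A \<theta> i l x * fundmat N (A \<theta>) a l j x) * Y j a)) (at x within {a..b})"
      unfolding Z_def using sol fundmat_linsol[OF \<theta>] ix unfolding linsol_def
      by (intro has_vector_derivative_diff has_vector_derivative_sum has_vector_derivative_mult_left) auto
    moreover have "(\<Sum>j<N. (\<Sum>l<N. A \<theta> i l x * fundmat N (A \<theta>) a l j x) * Y j a)
       = (\<Sum>l<N. A \<theta> i l x * (\<Sum>j<N. fundmat N (A \<theta>) a l j x * Y j a))"
      unfolding sum_distrib_left sum_distrib_right by (subst sum.swap) (simp add: mult_ac)
    ultimately show "(Z i has_vector_derivative (\<Sum>l<N. A \<theta> i l x * Z l x)) (at x within {a..b})"
      by (simp add: Z_def right_diff_distrib sum_subtractf)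
  qed
  moreover have "Z i a = 0" if "i < N" for i
    using that by (simp add: Z_def fundmat_initial[OF _ \<theta>] if_distrib[where f="\<lambda>t. t * _"] cong: if_cong)
  ultimately have "Z i x = 0" using linsol_zero[OF \<theta>] i x by blast
  then show ?thesis by (simp add: Z_def)
qed

end

lemma linsol_lincomb:
  assumes "\<And>j. j \<in> J \<Longrightarrow> linsol N A a b (F j)"
  shows "linsol N A a b (\<lambda>i x. \<Sum>j\<in>J. F j i x * c j)"
  unfolding linsol_def
proof (intro allI impI ballI)
  fix i x assume ix: "i < N" "x \<in> {a..b}"
  have "((\<lambda>x. \<Sum>j\<in>J. F j i x * c j) has_vector_derivative (\<Sum>j\<in>J. (\<Sum>l<N. A i l x * F j l x) * c j)) (at x within {a..b})"
    using assms ix unfolding linsol_def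
    by (intro has_vector_derivative_sum has_vector_derivative_mult_left) auto
  moreover have "(\<Sum>j\<in>J. (\<Sum>l<N. A i l x * F j l x) * c j) = (\<Sum>l<N. A i l x * (\<Sum>j\<in>J. F j l x * c j))"
    unfolding sum_distrib_left sum_distrib_right by (subst sum.swap) (simp add: mult_ac)
  ultimately show "((\<lambda>x. \<Sum>j\<in>J. F j i x * c j) has_vector_derivative (\<Sum>l<N. A i l x * (\<Sum>j\<in>J. F j l x * c j))) (at x within {a..b})"
    by simp
qed

section \<open>Analytic dependence on the spectral parameter\<close>

definition poly_param :: "real \<Rightarrow> real \<Rightarrow> (complex \<Rightarrow> real \<Rightarrow> complex) \<Rightarrow> bool" where
  "poly_param a b f \<longleftrightarrow> (\<exists>K q. (\<forall>r. continuous_on {a..b} (q r)) \<and>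
     (\<forall>\<mu>. \<forall>x\<in>{a..b}. f \<mu> x = (\<Sum>r<K. \<mu> ^ r * q r x)))"

lemma poly_param_const: "continuous_on {a..b} g \<Longrightarrow> poly_param a b (\<lambda>\<mu>. g)"
  unfolding poly_param_def by (intro exI[of _ 1] exI[of _ "\<lambda>r. g"]) auto

lemma poly_param_mult_const:
  assumes "poly_param a b f" "continuous_on {a..b} g"
  shows "poly_param a b (\<lambda>\<mu> x. g x * f \<mu> x)"
proof -
  obtain K q where "\<forall>r. continuous_on {a..b} (q r)" "\<forall>\<mu>. \<forall>x\<in>{a..b}. f \<mu> x = (\<Sum>r<K. \<mu> ^ r * q r x)"
    using assms unfolding poly_param_def by blast
  then show ?thesis unfolding poly_param_def using assms(2)
    by (intro exI[of _ K] exI[of _ "\<lambda>r x. g x * q r x"]) (auto simp: sum_distrib_left mult_ac intro!: continuous_intros)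
qed

lemma poly_param_mult_var:
  assumes "poly_param a b f"
  shows "poly_param a b (\<lambda>\<mu> x. \<mu> * f \<mu> x)"
proof -
  obtain K q where "\<forall>r. continuous_on {a..b} (q r)" "\<forall>\<mu>. \<forall>x\<in>{a..b}. f \<mu> x = (\<Sum>r<K. \<mu> ^ r * q r x)"
    using assms unfolding poly_param_def by blast
  then show ?thesis unfolding poly_param_def
    by (intro exI[of _ "Suc K"] exI[of _ "\<lambda>r. if r = 0 then (\<lambda>x. 0) else q (r - 1)"])
       (auto simp: sum_distrib_left sum.lessThan_Suc_shift mult_ac simp del: sum.lessThan_Suc)
qed

lemma poly_param_add:
  assumes "poly_param a b f" "poly_param a b g"
  shows "poly_param a b (\<lambda>\<mu> x. f \<mu> x + g \<mu> x)"
proof -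
  obtain K q where q: "\<forall>r. continuous_on {a..b} (q r)" "\<forall>\<mu>. \<forall>x\<in>{a..b}. f \<mu> x = (\<Sum>r<K. \<mu> ^ r * q r x)"
    using assms unfolding poly_param_def by blast
  obtain K' q' where q': "\<forall>r. continuous_on {a..b} (q' r)" "\<forall>\<mu>. \<forall>x\<in>{a..b}. g \<mu> x = (\<Sum>r<K'. \<mu> ^ r * q' r x)"
    using assms unfolding poly_param_def by blast
  have pad: "(\<Sum>r<K. \<mu> ^ r * q r x) = (\<Sum>r<max K K'. \<mu> ^ r * (if r < K then q r x else 0))" for q :: "nat \<Rightarrow> real \<Rightarrow> complex" and K K' \<mu> x
    by (rule sum.mono_neutral_cong_left) auto
  show ?thesis unfolding poly_param_def
  proof (intro exI[of _ "max K K'"] exI[of _ "\<lambda>r x. (if r < K then q r x else 0) + (if r < K' then q' r x else 0)"] conjI allI ballI)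
    show "continuous_on {a..b} (\<lambda>x. (if r < K then q r x else 0) + (if r < K' then q' r x else 0))" for r
      using q q' by (cases "r < K"; cases "r < K'") (auto intro!: continuous_intros)
    fix \<mu> x assume x: "x \<in> {a..b}"
    have 1: "f \<mu> x = (\<Sum>r<max K K'. \<mu> ^ r * (if r < K then q r x else 0))"
      using q(2) x by (intro trans[OF _ pad]) auto
    have 2: "g \<mu> x = (\<Sum>r<max K K'. \<mu> ^ r * (if r < K' then q' r x else 0))"
      unfolding max.commute[of K K'] using q'(2) x by (intro trans[OF _ pad]) auto
    show "f \<mu> x + g \<mu> x = (\<Sum>r<max K K'. \<mu> ^ r * ((if r < K then q r x else 0) + (if r < K' then q' r x else 0)))"
      unfolding 1 2 by (simp only: sum.distrib distrib_left)
  qed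
qed

lemma poly_param_sum: "finite I \<Longrightarrow> (\<And>i. i \<in> I \<Longrightarrow> poly_param a b (f i)) \<Longrightarrow> poly_param a b (\<lambda>\<mu> x. \<Sum>i\<in>I. f i \<mu> x)"
  by (induction I rule: finite_induct) (auto intro: poly_param_const poly_param_add)

lemma poly_param_integral:
  assumes "poly_param a b f"
  shows "poly_param a b (\<lambda>\<mu> x. integral {a..x} (f \<mu>))"
proof -
  obtain K q where q: "\<forall>r. continuous_on {a..b} (q r)" "\<forall>\<mu>. \<forall>x\<in>{a..b}. f \<mu> x = (\<Sum>r<K. \<mu> ^ r * q r x)"
    using assms unfolding poly_param_def by blast
  show ?thesis unfolding poly_param_def
  proof (intro exI[of _ K] exI[of _ "\<lambda>r x. integral {a..x} (q r)"] conjI allI ballI)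
    show "continuous_on {a..b} (\<lambda>x. integral {a..x} (q r))" for r
      using q by (intro indefinite_integral_continuous_1 integrable_continuous_interval) auto
    fix \<mu> x assume x: "x \<in> {a..b}"
    have "integral {a..x} (f \<mu>) = integral {a..x} (\<lambda>x. \<Sum>r<K. \<mu> ^ r * q r x)"
      using q x by (intro integral_cong) auto
    also have "\<dots> = (\<Sum>r<K. integral {a..x} (\<lambda>x. \<mu> ^ r * q r x))"
      using q x by (intro integral_sum integrable_continuous_interval continuous_intros) (auto intro: continuous_on_subset)
    finally show "integral {a..x} (f \<mu>) = (\<Sum>r<K. \<mu> ^ r * integral {a..x} (q r))" by simp
  qed
qed

lemma poly_param_holomorphic:
  assumes "poly_param a b f" "x \<in> {a..b}" shows "(\<lambda>\<mu>. f \<mu> x) holomorphic_on S"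
proof -
  obtain K q where "\<forall>\<mu>. \<forall>x\<in>{a..b}. f \<mu> x = (\<Sum>r<K. \<mu> ^ r * q r x)"
    using assms unfolding poly_param_def by blast
  then have "(\<lambda>\<mu>. f \<mu> x) = (\<lambda>\<mu>. \<Sum>r<K. \<mu> ^ r * q r x)" using assms(2) by auto
  then show ?thesis by (auto intro!: holomorphic_intros)
qed

text \<open>For coefficients affine in \<mu>, every Picard term is a polynomial in \<mu> whose
  coefficients are continuous in x, since \<open>poly_param\<close> survives multiplication by
  \<mu>, by continuous functions, and integration in x. The series converges uniformly on each disc
  of radius 1, so its sum is entire.\<close>

lemma fundmat_holomorphic:
  fixes A0 A1 :: "nat \<Rightarrow> nat \<Rightarrow> real \<Rightarrow> complex"
  assumes A0: "\<And>i l. i < N \<Longrightarrow> l < N \<Longrightarrow> continuous_on {a..b} (A0 i l)"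
    and A1: "\<And>i l. i < N \<Longrightarrow> l < N \<Longrightarrow> continuous_on {a..b} (A1 i l)"
    and i: "i < N" and x: "x \<in> {a..b}"
  shows "(\<lambda>\<mu>. fundmat N (\<lambda>i l s. A0 i l s + \<mu> * A1 i l s) a i j x) holomorphic_on UNIV"
proof (rule holomorphic_uniform_sequence)
  let ?A = "\<lambda>\<mu> i l s. A0 i l s + \<mu> * A1 i l s"
  have pp: "poly_param a b (\<lambda>\<mu>. picard_term N (?A \<mu>) a k i j)" if "i < N" for k i
    using that
  proof (induction k arbitrary: i)
    case 0 show ?case by (auto intro!: poly_param_const)
  next
    case (Suc k)
    have "poly_param a b (\<lambda>\<mu> s. \<Sum>l<N. A0 i l s * picard_term N (?A \<mu>) a k l j s + \<mu> * (A1 i l s * picard_term N (?A \<mu>) a k l j s))"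
      using A0 A1 Suc by (intro poly_param_sum poly_param_add poly_param_mult_var poly_param_mult_const) auto
    from poly_param_integral[OF this] show ?case by (simp add: algebra_simps)
  qed
  show "(\<lambda>\<mu>. \<Sum>k<K. picard_term N (?A \<mu>) a k i j x) holomorphic_on UNIV" for K
    using pp i x by (intro holomorphic_intros poly_param_holomorphic[where a=a and b=b]) auto
  fix \<mu>0 :: complex
  have ab: "a \<le> b" using x by auto
  have c: "continuous_on (cball \<mu>0 1 \<times> {a..b}) (\<lambda>(\<theta>, s). ?A \<theta> i l s)" if "i < N" "l < N" for i l
    unfolding case_prod_beta
    using continuous_on_compose2[OF A0[OF that] continuous_on_snd[OF continuous_on_id], of "cball \<mu>0 1 \<times> {a..b}"]
      continuous_on_compose2[OF A1[OF that] continuous_on_snd[OF continuous_on_id], of "cball \<mu>0 1 \<times> {a..b}"]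
    by (auto intro!: continuous_intros)
  have "\<exists>C. \<forall>\<theta>\<in>cball \<mu>0 1. \<forall>s\<in>{a..b}. norm (?A \<theta> i l s) \<le> C" if "i < N" "l < N" for i l
  proof -
    have "bounded ((\<lambda>(\<theta>, s). ?A \<theta> i l s) ` (cball \<mu>0 1 \<times> {a..b}))"
      using c[OF that] by (intro compact_imp_bounded compact_continuous_image compact_Times) auto
    then obtain B where "\<forall>z\<in>(\<lambda>(\<theta>, s). ?A \<theta> i l s) ` (cball \<mu>0 1 \<times> {a..b}). norm z \<le> B"
      unfolding bounded_iff by blast
    then show ?thesis by (intro exI[of _ B]) auto
  qed
  then obtain C where C: "\<And>i l \<theta> s. i < N \<Longrightarrow> l < N \<Longrightarrow> \<theta> \<in> cball \<mu>0 1 \<Longrightarrow> s \<in> {a..b} \<Longrightarrow> norm (?A \<theta> i l s) \<le> C i l"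
    by metis
  define M where "M = (\<Sum>i<N. \<Sum>l<N. \<bar>C i l\<bar>)"
  have M: "\<bar>C i l\<bar> \<le> M" if "i < N" "l < N" for i l
  proof -
    have "\<bar>C i l\<bar> \<le> (\<Sum>l<N. \<bar>C i l\<bar>)" using that by (intro member_le_sum) auto
    also have "\<dots> \<le> M" unfolding M_def using that by (intro member_le_sum) (auto intro: sum_nonneg)
    finally show ?thesis .
  qed
  have M0: "M \<ge> 0" unfolding M_def by (intro sum_nonneg) auto
  have bd: "norm (?A \<theta> i l s) \<le> M" if "\<theta> \<in> cball \<mu>0 1" "i < N" "l < N" "s \<in> {a..b}" for \<theta> i l s
    using C[OF that(2,3,1,4)] M[OF that(2,3)] by linarith
  have "uniform_limit (cball \<mu>0 1) (\<lambda>K \<mu>. (\<lambda>(\<mu>, x). \<Sum>k<K. picard_term N (?A \<mu>) a k i j x) (\<mu>, x))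
     (\<lambda>\<mu>. (\<lambda>(\<mu>, x). fundmat N (?A \<mu>) a i j x) (\<mu>, x)) sequentially"
    by (rule uniform_limit_compose'[OF fundmat_uniform_limit[where A = ?A, OF c bd M0 ab i]]) (use x in auto)
  then show "\<exists>d>0. cball \<mu>0 d \<subseteq> UNIV \<and> uniform_limit (cball \<mu>0 d) (\<lambda>K \<mu>. \<Sum>k<K. picard_term N (?A \<mu>) a k i j x)
     (\<lambda>\<mu>. fundmat N (?A \<mu>) a i j x) sequentially"
    by (intro exI[of _ 1]) auto
qed simp

text \<open>The density theorem used here controls the averages over [x, x + h] with h > 0. Applied
  to the reflected function it controls those over [x - h, x] as well, at the price of the reflected
  null set. The extension of g by 0 makes it integrable on every box.\<close>

lemma indefinite_integral_has_vector_derivative_ae: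
  fixes g :: "real \<Rightarrow> complex"
  assumes g: "g integrable_on {a..b}"
  obtains N where "negligible N"
    "\<And>x. x \<in> {a<..<b} \<Longrightarrow> x \<notin> N \<Longrightarrow>
       ((\<lambda>x. integral {a..x} g) has_vector_derivative g x) (at x within {a..b})"
proof -
  define f where "f = (\<lambda>x. if x \<in> {a..b} then g x else 0)"
  have f: "f integrable_on cbox c d" for c d
    using g integrable_restrict_UNIV[of "{a..b}" g] integrable_on_subcbox[of f UNIV c d] unfolding f_def by simp
  have fr: "(\<lambda>x. f (- x)) integrable_on cbox c d" for c d
    using Henstock_Kurzweil_Integration.integrable_reflect_real[where f=f and a="-d" and b="-c", THEN iffD2] f[of "-d" "-c"]
    unfolding minus_minus cbox_interval by blast
  obtain N1 where N1: "negligible N1"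
     "\<And>x e. \<lbrakk>x \<notin> N1; 0 < e\<rbrakk> \<Longrightarrow> \<exists>d>0. \<forall>h. 0 < h \<and> h < d \<longrightarrow>
         norm (integral (cbox x (x + h *\<^sub>R One)) f /\<^sub>R h ^ DIM(real) - f x) < e"
    using integrable_ccontinuous_explicit[OF f] by blast
  obtain N2 where N2: "negligible N2"
     "\<And>x e. \<lbrakk>x \<notin> N2; 0 < e\<rbrakk> \<Longrightarrow> \<exists>d>0. \<forall>h. 0 < h \<and> h < d \<longrightarrow>
         norm (integral (cbox x (x + h *\<^sub>R One)) (\<lambda>x. f (- x)) /\<^sub>R h ^ DIM(real) - f (- x)) < e"
    using integrable_ccontinuous_explicit[OF fr] by blast
  have neg: "negligible (uminus ` N2)"
    using N2(1) by (intro order_refl negligible_differentiable_image_negligible differentiable_on_minus differentiable_on_id[unfolded id_def])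
  show ?thesis
  proof (rule that[of "N1 \<union> uminus ` N2"])
    show "negligible (N1 \<union> uminus ` N2)" using N1(1) neg by (rule negligible_Un)
    fix x assume x: "x \<in> {a<..<b}" "x \<notin> N1 \<union> uminus ` N2"
    then have x1: "x \<notin> N1" and x2: "- x \<notin> N2" by (auto simp: image_iff)
    have fx: "f x = g x" using x by (simp add: f_def)
    have "\<exists>d>0. \<forall>y\<in>{a..b}. norm (y - x) < d \<longrightarrow>
        norm (integral {a..y} g - integral {a..x} g - (y - x) *\<^sub>R g x) \<le> e * norm (y - x)" if e: "e > 0" for e
    proof -
      obtain d1 where d1: "d1 > 0" "\<And>h. 0 < h \<Longrightarrow> h < d1 \<Longrightarrow>
         norm (integral {x..x + h} f /\<^sub>R h - f x) < e" using N1(2)[OF x1 e] by auto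
      obtain d2 where d2: "d2 > 0" "\<And>h. 0 < h \<Longrightarrow> h < d2 \<Longrightarrow>
         norm (integral {- x..- x + h} (\<lambda>x. f (- x)) /\<^sub>R h - f x) < e" using N2(2)[OF x2 e] by auto
      have key: "norm (I - h *\<^sub>R f x) \<le> e * h" if "h > 0" "norm (I /\<^sub>R h - f x) < e" for I :: complex and h :: real
      proof -
        have "I - h *\<^sub>R f x = h *\<^sub>R (I /\<^sub>R h - f x)" using that by (simp add: scaleR_diff_right)
        then have "norm (I - h *\<^sub>R f x) = h * norm (I /\<^sub>R h - f x)" using that by simp
        then show ?thesis using that by (simp add: mult.commute)
      qed
      show ?thesis
      proof (intro exI[of _ "min d1 d2"] conjI ballI impI)
        show "min d1 d2 > 0" using d1 d2 by simp
        fix y assume y: "y \<in> {a..b}" "norm (y - x) < min d1 d2"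
        consider "y = x" | "y > x" | "y < x" by linarith
        then show "norm (integral {a..y} g - integral {a..x} g - (y - x) *\<^sub>R g x) \<le> e * norm (y - x)"
        proof cases
          case 1 then show ?thesis by simp
        next
          case 2
          have "integral {a..x} g + integral {x..y} g = integral {a..y} g"
            using x y 2 by (intro Henstock_Kurzweil_Integration.integral_combine integrable_on_subinterval[OF g]) auto
          moreover have "integral {x..y} g = integral {x..y} f"
            using x y by (intro integral_cong) (auto simp: f_def)
          ultimately have e1: "integral {a..y} g - integral {a..x} g - (y - x) *\<^sub>R g x
             = integral {x..x + (y - x)} f - (y - x) *\<^sub>R f x"
            unfolding fx by (simp add: algebra_simps)
          show ?thesis unfolding e1 using key[of "y - x" "integral {x..x + (y - x)} f"] d1(2)[of "y - x"] y 2 by simp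
        next
          case 3
          have "integral {a..y} g + integral {y..x} g = integral {a..x} g"
            using x y 3 by (intro Henstock_Kurzweil_Integration.integral_combine integrable_on_subinterval[OF g]) auto
          moreover have "integral {y..x} g = integral {y..x} f"
            using x y by (intro integral_cong) (auto simp: f_def)
          ultimately have "integral {a..y} g - integral {a..x} g - (y - x) *\<^sub>R g x
             = - (integral {y..x} f - (x - y) *\<^sub>R f x)"
            unfolding fx by (simp add: algebra_simps)
          moreover have "integral {y..x} f = integral {- x..- x + (x - y)} (\<lambda>x. f (- x))"
            using Henstock_Kurzweil_Integration.integral_reflect_real[of x y f] by simp
          ultimately have e1: "integral {a..y} g - integral {a..x} g - (y - x) *\<^sub>R g x
             = - (integral {- x..- x + (x - y)} (\<lambda>x. f (- x)) - (x - y) *\<^sub>R f x)"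
            by (simp only:)
          show ?thesis unfolding e1 norm_minus_cancel
            using key[of "x - y" "integral {- x..- x + (x - y)} (\<lambda>x. f (- x))"] d2(2)[of "x - y"] y 3 by simp
        qed
      qed
    qed
    then show "((\<lambda>x. integral {a..x} g) has_vector_derivative g x) (at x within {a..b})"
      unfolding has_vector_derivative_def has_derivative_within_alt
      by (auto simp: bounded_linear_scaleR_left)
  qed
qed

section \<open>Eigenfunctions as solutions of the quasi-derivative system\<close>

text \<open>The components are Y i = y^(i) for i < n and Y (n + m) = y^[n+m]. Rows below n - 1
  shift; row n - 1 is (y^(n-1))' = y^[n] / p_0; row n + m is (y^[n+m])' = p_(m+1) y^(n-m-1) -
  y^[n+m+1]. In the last row y^[2n] = \<mu> y closes the system, which puts - \<mu> into column
  0.\<close>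

definition sysmat :: "nat \<Rightarrow> (nat \<Rightarrow> real \<Rightarrow> real) \<Rightarrow> complex \<Rightarrow> nat \<Rightarrow> nat \<Rightarrow> real \<Rightarrow> complex" where
  "sysmat n q \<mu> i j x = (if i < n then (if j = i + 1 then (if i + 1 = n then 1 / of_real (q 0 x) else 1) else 0)
     else (if j = 2 * n - 1 - i then of_real (q (i + 1 - n) x) - (if i + 1 = 2 * n then \<mu> else 0) else 0)
        - (if j = i + 1 then 1 else 0))"

definition sysrhs :: "nat \<Rightarrow> (nat \<Rightarrow> real \<Rightarrow> real) \<Rightarrow> complex \<Rightarrow> (nat \<Rightarrow> real \<Rightarrow> complex) \<Rightarrow> nat \<Rightarrow> real \<Rightarrow> complex" where
  "sysrhs n q \<mu> Y i x = (if i + 1 < n then Y (i + 1) x else if i + 1 = n then Y n x / of_real (q 0 x)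
     else of_real (q (i + 1 - n) x) * Y (2 * n - 1 - i) x - (if i + 1 < 2 * n then Y (i + 1) x else \<mu> * Y 0 x))"

lemma sum_sysmat:
  assumes "i < 2 * n" "n \<ge> 1"
  shows "(\<Sum>j<2 * n. sysmat n q \<mu> i j x * Y j x) = sysrhs n q \<mu> Y i x"
proof (cases "i < n")
  case True
  have "(\<Sum>j<2 * n. sysmat n q \<mu> i j x * Y j x)
     = (\<Sum>j<2 * n. if j = i + 1 then (if i + 1 = n then 1 / of_real (q 0 x) else 1) * Y j x else 0)"
    using True by (intro sum.cong) (auto simp: sysmat_def)
  also have "\<dots> = (if i + 1 = n then 1 / of_real (q 0 x) else 1) * Y (i + 1) x"
    using True by (subst sum.delta) auto
  finally show ?thesis using True by (cases "n = Suc i") (auto simp: sysrhs_def)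
next
  case False
  have "(\<Sum>j<2 * n. sysmat n q \<mu> i j x * Y j x)
     = (\<Sum>j<2 * n. (if j = 2 * n - 1 - i then (of_real (q (i + 1 - n) x) - (if i + 1 = 2 * n then \<mu> else 0)) * Y j x else 0)
         - (if j = i + 1 then Y j x else 0))"
    using False by (intro sum.cong) (auto simp: sysmat_def left_diff_distrib)
  also have "\<dots> = (of_real (q (i + 1 - n) x) - (if i + 1 = 2 * n then \<mu> else 0)) * Y (2 * n - 1 - i) x
      - (if i + 1 < 2 * n then Y (i + 1) x else 0)"
    using assms unfolding sum_subtractf by (subst (1 2) sum.delta) auto
  also have "\<dots> = sysrhs n q \<mu> Y i x"
  proof (cases "i + 1 = 2 * n")
    case True
    then have "2 * n - 1 - i = 0" by simp
    then show ?thesis using True False assms by (simp add: sysrhs_def left_diff_distrib)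
  next
    case False': False
    then show ?thesis using False assms by (simp add: sysrhs_def)
  qed
  finally show ?thesis .
qed

lemma linsol_sysmat_iff:
  assumes "n \<ge> 1"
  shows "linsol (2 * n) (sysmat n q \<mu>) a b Y \<longleftrightarrow>
    (\<forall>i<2 * n. \<forall>x\<in>{a..b}. (Y i has_vector_derivative sysrhs n q \<mu> Y i x) (at x within {a..b}))"
  unfolding linsol_def using sum_sysmat[OF _ assms] by auto

definition quasi :: "nat \<Rightarrow> (nat \<Rightarrow> real \<Rightarrow> real \<Rightarrow> real) \<Rightarrow> real \<Rightarrow> real \<Rightarrow> real \<Rightarrow> (real \<Rightarrow> complex) \<Rightarrow> nat \<Rightarrow> real \<Rightarrow> complex" where
  "quasi n p a b l y i x = (if i < n then nder a b i y x else qder n p a b l (i - n) y x)"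

text \<open>\<open>bhat\<close> and \<open>bcheck\<close> read y^wedge and y^vee off a family of
  components, so that the boundary condition also makes sense for a solution of the system that is
  not yet known to consist of quasi-derivatives.\<close>

definition bhat :: "nat \<Rightarrow> real \<Rightarrow> real \<Rightarrow> (nat \<Rightarrow> real \<Rightarrow> complex) \<Rightarrow> complex Matrix.vec" where
  "bhat n a b Y = Matrix.vec (2 * n) (\<lambda>i. if i < n then Y i a else Y (i - n) b)"

definition bcheck :: "nat \<Rightarrow> real \<Rightarrow> real \<Rightarrow> (nat \<Rightarrow> real \<Rightarrow> complex) \<Rightarrow> complex Matrix.vec" where
  "bcheck n a b Y = Matrix.vec (2 * n) (\<lambda>i. if i < n then Y (2 * n - 1 - i) a else - Y (2 * n - 1 - (i - n)) b)"

definition boundary_condition :: "nat \<Rightarrow> real \<Rightarrow> real \<Rightarrow> complex mat \<Rightarrow> (nat \<Rightarrow> real \<Rightarrow> complex) \<Rightarrow> bool" where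
  "boundary_condition n a b V Y \<longleftrightarrow> (V - 1\<^sub>m (2 * n)) *\<^sub>v bcheck n a b Y
       + (\<i> \<cdot>\<^sub>m (V + 1\<^sub>m (2 * n))) *\<^sub>v bhat n a b Y = 0\<^sub>v (2 * n)"

lemma yhat_eq_bhat: "yhat n a b y = bhat n a b (quasi n p a b l y)"
  by (auto simp: yhat_def bhat_def quasi_def intro!: eq_vecI)

lemma ycheck_eq_bcheck: "ycheck n p a b l y = bcheck n a b (quasi n p a b l y)"
proof (rule eq_vecI)
  fix i assume "i < dim_vec (bcheck n a b (quasi n p a b l y))"
  then have i: "i < 2 * n" by (simp add: bcheck_def)
  have 1: "\<not> (2 * n - 1 - i < n)" "2 * n - 1 - i - n = n - 1 - i" if "i < n" using that by auto
  have 2: "\<not> (2 * n - 1 - (i - n) < n)" "2 * n - 1 - (i - n) - n = n - 1 - (i - n)" if "\<not> i < n" using that i by auto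
  show "vec_index (ycheck n p a b l y) i = vec_index (bcheck n a b (quasi n p a b l y)) i"
    using i 1 2 by (cases "i < n") (simp_all add: ycheck_def bcheck_def quasi_def)
qed (simp add: ycheck_def bcheck_def)

lemma bhat_cong: "a \<le> b \<Longrightarrow> (\<And>i x. i < 2 * n \<Longrightarrow> x \<in> {a..b} \<Longrightarrow> Y i x = Z i x) \<Longrightarrow> bhat n a b Y = bhat n a b Z"
  by (auto simp: bhat_def intro!: eq_vecI)

lemma bcheck_cong: "a \<le> b \<Longrightarrow> (\<And>i x. i < 2 * n \<Longrightarrow> x \<in> {a..b} \<Longrightarrow> Y i x = Z i x) \<Longrightarrow> bcheck n a b Y = bcheck n a b Z"
  by (auto simp: bcheck_def intro!: eq_vecI)

lemma Cm_extend:
  assumes ab: "a < b" and y: "Cm m a b y" and D: "\<And>x. x \<in> {a..b} \<Longrightarrow> (nder a b m y has_vector_derivative D x) (at x within {a..b})"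
    and c: "continuous_on {a..b} D"
  shows "Cm (Suc m) a b y"
proof -
  have e: "nder a b (Suc m) y x = D x" if "x \<in> {a..b}" for x
    using nder_SucI[OF ab that D[OF that]] .
  have top: "continuous_on {a..b} (nder a b (Suc m) y)"
    by (rule continuous_on_eq[OF c]) (rule e[symmetric])
  have "continuous_on {a..b} (nder a b j y)" if "j \<le> Suc m" for j
  proof (cases "j = Suc m")
    case True
    then show ?thesis using top by (simp only:)
  next
    case False
    then show ?thesis using Cm_continuous_nder[OF y, of j] that by simp
  qed
  moreover have "(nder a b j y has_vector_derivative nder a b (Suc j) y x) (at x within {a..b})"
    if "j < Suc m" "x \<in> {a..b}" for j x
  proof (cases "j = m")
    case True
    then show ?thesis using D[OF that(2)] e[OF that(2)] by (simp only:)
  next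
    case False
    then show ?thesis using Cm_nder_has_derivative[OF y _ that(2), of j] that by simp
  qed
  ultimately show ?thesis unfolding Cm_def by blast
qed

text \<open>Only the top derivative of the second factor is left explicit, since it may fail to be differentiable.\<close>

lemma nder_mult_leading:
  fixes f w :: "real \<Rightarrow> complex"
  assumes ab: "a < b" and f: "Cm m a b f" and w: "Cm (m - 1) a b w" and "j \<le> m - 1" "m \<ge> 1"
  shows "\<exists>R. Cm (m - j) a b R \<and> (\<forall>x\<in>{a..b}. nder a b j (\<lambda>t. f t * w t) x = f x * nder a b j w x + R x)"
  using assms(4)
proof (induction j)
  case 0
  show ?case by (intro exI[of _ "\<lambda>x. 0"]) (auto intro: Cm_const[OF ab])
next
  case (Suc j)
  then obtain R where R: "Cm (m - j) a b R"
    "\<And>x. x \<in> {a..b} \<Longrightarrow> nder a b j (\<lambda>t. f t * w t) x = f x * nder a b j w x + R x" by auto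
  have mj: "m - j = Suc (m - Suc j)" "m = Suc (m - 1)" "m - 1 = (m - Suc j) + j" using Suc.prems assms by auto
  obtain R' where R': "\<And>x. x \<in> {a..b} \<Longrightarrow> (R has_vector_derivative R' x) (at x within {a..b})" "Cm (m - Suc j) a b R'"
    using Cm_SucE[OF ab] R(1) mj(1) by metis
  obtain f' where f': "\<And>x. x \<in> {a..b} \<Longrightarrow> (f has_vector_derivative f' x) (at x within {a..b})" "Cm (m - 1) a b f'"
    using Cm_SucE[OF ab] f mj(2) by metis
  have wj: "Cm (m - Suc j) a b (nder a b j w)" using w Cm_nder mj(3) by metis
  show ?case
  proof (intro exI[of _ "\<lambda>x. f' x * nder a b j w x + R' x"] conjI ballI)
    show "Cm (m - Suc j) a b (\<lambda>x. f' x * nder a b j w x + R' x)"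
      by (intro Cm_add[OF ab] Cm_mult[OF ab] wj R' Cm_mono[OF f'(2)]) auto
    fix x assume x: "x \<in> {a..b}"
    have dw: "(nder a b j w has_vector_derivative nder a b (Suc j) w x) (at x within {a..b})"
      using Cm_nder_has_derivative[OF w _ x, of j] Suc.prems by simp
    have "((\<lambda>x. f x * nder a b j w x + R x) has_vector_derivative
       (f x * nder a b (Suc j) w x + f' x * nder a b j w x) + R' x) (at x within {a..b})"
      by (intro has_vector_derivative_add has_vector_derivative_mult f'(1)[OF x] dw R'(1)[OF x])
    then have "(nder a b j (\<lambda>t. f t * w t) has_vector_derivative
       (f x * nder a b (Suc j) w x + f' x * nder a b j w x) + R' x) (at x within {a..b})"
      by (rule has_vector_derivative_transform[OF x R(2), rotated])
    from nder_SucI[OF ab x this]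
    show "nder a b (Suc j) (\<lambda>t. f t * w t) x = f x * nder a b (Suc j) w x + (f' x * nder a b j w x + R' x)"
      by (simp only: add.assoc)
  qed
qed

context
  fixes n :: nat and a b l :: real and p :: "nat \<Rightarrow> real \<Rightarrow> real \<Rightarrow> real"
  assumes n: "n \<ge> 1" and ab: "a < b" and p0: "\<And>x. x \<in> {a..b} \<Longrightarrow> p 0 x l > 0"
    and pC: "\<And>k. k \<le> n \<Longrightarrow> Cm (n - k) a b (\<lambda>x. p k x l)"
begin

abbreviation qterm :: "nat \<Rightarrow> (real \<Rightarrow> complex) \<Rightarrow> real \<Rightarrow> complex" where
  "qterm k y \<equiv> (\<lambda>t. complex_of_real (p k t l) * nder a b (n - k) y t)"

text \<open>The recursion y^[n+r+1] = p_(r+1) y^(n-r-1) - (y^[n+r])': differentiating the sum raises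
  every order r - k by one, and the alternating signs account for the minus.\<close>

lemma qder_has_derivative:
  assumes "\<And>k. k \<le> r \<Longrightarrow> Cm (Suc r - k) a b (qterm k y)" "x \<in> {a..b}"
  shows "(qder n p a b l r y has_vector_derivative qterm (Suc r) y x - qder n p a b l (Suc r) y x) (at x within {a..b})"
proof -
  have "((\<lambda>x. \<Sum>k=0..r. (-1) ^ (r - k) * nder a b (r - k) (qterm k y) x) has_vector_derivative
     (\<Sum>k=0..r. (-1) ^ (r - k) * nder a b (Suc (r - k)) (qterm k y) x)) (at x within {a..b})"
  proof (intro has_vector_derivative_sum has_vector_derivative_mult_right)
    fix k assume "k \<in> {0..r}"
    then show "(nder a b (r - k) (qterm k y) has_vector_derivative nder a b (Suc (r - k)) (qterm k y) x) (at x within {a..b})"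
      using assms by (intro Cm_nder_has_derivative[of "Suc r - k"]) auto
  qed
  moreover have "qder n p a b l (Suc r) y x
     = qterm (Suc r) y x - (\<Sum>k=0..r. (-1) ^ (r - k) * nder a b (Suc (r - k)) (qterm k y) x)"
  proof -
    have "qder n p a b l (Suc r) y x
     = (\<Sum>k=0..r. (-1) ^ (Suc r - k) * nder a b (Suc r - k) (qterm k y) x) + qterm (Suc r) y x"
      unfolding qder_def by simp
    also have "(\<Sum>k=0..r. (-1) ^ (Suc r - k) * nder a b (Suc r - k) (qterm k y) x)
       = (\<Sum>k=0..r. - ((-1) ^ (r - k) * nder a b (Suc (r - k)) (qterm k y) x))"
      by (intro sum.cong) (auto simp: Suc_diff_le simp del: nder.simps)
    finally show ?thesis by (simp only: sum_negf) simp
  qed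
  moreover have "qder n p a b l r y = (\<lambda>x. \<Sum>k=0..r. (-1) ^ (r - k) * nder a b (r - k) (qterm k y) x)"
    by (auto simp: qder_def)
  ultimately show ?thesis by (simp only:) simp
qed

lemma Sop_eq_qder: "Sop n p a b l y x = qder n p a b l n y x"
  by (simp add: Sop_def qder_def)

lemma Cm_qterm:
  assumes y: "Cm (2 * n) a b y" and k: "k \<le> n"
  shows "Cm (n - k) a b (qterm k y)"
proof -
  have "2 * n = (n + k) + (n - k)" using k by simp
  then have "Cm (n + k) a b (nder a b (n - k) y)" using Cm_nder y by metis
  then have "Cm (n - k) a b (nder a b (n - k) y)" by (rule Cm_mono) simp
  then show ?thesis by (intro Cm_mult[OF ab] Cm_of_real[OF ab] pC k)
qed

lemma quasi_linsol:
  assumes y: "Cm (2 * n) a b y" and S: "\<And>x. x \<in> {a..b} \<Longrightarrow> Sop n p a b l y x = \<mu> * y x"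
  shows "linsol (2 * n) (sysmat n (\<lambda>k x. p k x l) \<mu>) a b (quasi n p a b l y)"
  unfolding linsol_sysmat_iff[OF n]
proof (intro allI impI ballI)
  fix i x assume i: "i < 2 * n" and x: "x \<in> {a..b}"
  let ?Y = "quasi n p a b l y"
  consider "i + 1 < n" | "i + 1 = n" | "i \<ge> n" by linarith
  then show "(?Y i has_vector_derivative sysrhs n (\<lambda>k x. p k x l) \<mu> ?Y i x) (at x within {a..b})"
  proof cases
    case 1
    then have "?Y i = nder a b i y" by (auto simp: quasi_def)
    then show ?thesis using 1 Cm_nder_has_derivative[OF y i x] by (simp add: sysrhs_def quasi_def)
  next
    case 2
    then have "?Y i = nder a b i y" by (auto simp: quasi_def)
    moreover have "nder a b (Suc i) y x = ?Y n x / of_real (p 0 x l)"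
      using 2 p0[OF x] by (simp add: quasi_def qder_def)
    ultimately show ?thesis using 2 Cm_nder_has_derivative[OF y i x] by (simp add: sysrhs_def del: nder.simps)
  next
    case 3
    define r where "r = i - n"
    have r: "i = n + r" "r < n" using 3 i by (auto simp: r_def)
    have Y: "?Y i = qder n p a b l r y" using r by (auto simp: quasi_def)
    have "(qder n p a b l r y has_vector_derivative qterm (Suc r) y x - qder n p a b l (Suc r) y x) (at x within {a..b})"
    proof (rule qder_has_derivative[OF _ x])
      fix k assume "k \<le> r"
      then show "Cm (Suc r - k) a b (qterm k y)" using r by (intro Cm_mono[OF Cm_qterm[OF y]]) auto
    qed
    moreover have "qterm (Suc r) y x = of_real (p (i + 1 - n) x l) * ?Y (2 * n - 1 - i) x"
    proof -
      have "i + 1 - n = Suc r" "2 * n - 1 - i = n - Suc r" "n - Suc r < n" using r by auto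
      then show ?thesis by (simp add: quasi_def)
    qed
    moreover have "qder n p a b l (Suc r) y x = (if i + 1 < 2 * n then ?Y (i + 1) x else \<mu> * ?Y 0 x)"
    proof (cases "i + 1 < 2 * n")
      case True
      then show ?thesis using r by (simp add: quasi_def)
    next
      case False
      then have "Suc r = n" using r by simp
      then show ?thesis using False S[OF x] n by (simp add: quasi_def Sop_eq_qder)
    qed
    ultimately have "(qder n p a b l r y has_vector_derivative of_real (p (i + 1 - n) x l) * ?Y (2 * n - 1 - i) x
        - (if i + 1 < 2 * n then ?Y (i + 1) x else \<mu> * ?Y 0 x)) (at x within {a..b})" by (simp only:)
    then show ?thesis unfolding Y sysrhs_def using 3 by simp
  qed
qed

text \<open>Membership in W_2^{2n} gives y^(2n-1) only as an integral of some g, and at points where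
  it is not differentiable \<open>nder\<close> has an arbitrary value. Almost everywhere, however,
  the derivative is g and the equation holds; solving it for the top derivative yields g = G with G
  continuous. Replacing g by G under the integral shows that y^(2n-1) is of class C^1, and then the
  equation holds at every point.\<close>

lemma eigenfunction_regular:
  assumes W: "W2 (2 * n) a b y" and S: "AE x in lebesgue. x \<in> {a..b} \<longrightarrow> Sop n p a b l y x = \<mu> * y x"
  shows "Cm (2 * n) a b y" "\<And>x. x \<in> {a..b} \<Longrightarrow> Sop n p a b l y x = \<mu> * y x"
proof -
  define w where "w = nder a b (2 * n - 1) y"
  have y: "Cm (2 * n - 1) a b y" using W by (simp add: W2_def)
  obtain g where g: "g integrable_on {a..b}" "\<And>x. x \<in> {a..b} \<Longrightarrow> w x = w a + integral {a..x} g"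
    using W unfolding W2_def w_def by blast
  have yk: "Cm (n + k - 1) a b (nder a b (n - k) y)" if "k \<le> n" for k
  proof -
    have "2 * n - 1 = (n + k - 1) + (n - k)" using that n by simp
    then show ?thesis using y Cm_nder by metis
  qed
  have hk: "Cm (n - k) a b (qterm k y)" if "1 \<le> k" "k \<le> n" for k
    using that by (intro Cm_mult[OF ab] Cm_of_real[OF ab] pC Cm_mono[OF yk]) auto
  let ?f = "\<lambda>x. complex_of_real (p 0 x l)"
  have fC: "Cm n a b ?f" using Cm_of_real[OF ab pC[of 0]] by simp
  have "\<exists>R. Cm (n - (n - 1)) a b R \<and> (\<forall>x\<in>{a..b}. nder a b (n - 1) (\<lambda>t. ?f t * nder a b n y t) x
       = ?f x * nder a b (n - 1) (nder a b n y) x + R x)"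
    using yk[of 0] n by (intro nder_mult_leading[OF ab fC]) auto
  then obtain R where R: "Cm 1 a b R"
     "\<And>x. x \<in> {a..b} \<Longrightarrow> nder a b (n - 1) (qterm 0 y) x = ?f x * w x + R x"
    unfolding nder_nder w_def using n by (auto simp: mult_2)
  obtain R' where R': "\<And>x. x \<in> {a..b} \<Longrightarrow> (R has_vector_derivative R' x) (at x within {a..b})" "Cm 0 a b R'"
    using Cm_SucE[OF ab, of 0 R] R(1) by auto
  obtain f' where f': "\<And>x. x \<in> {a..b} \<Longrightarrow> (?f has_vector_derivative f' x) (at x within {a..b})" "Cm (n - 1) a b f'"
    using Cm_SucE[OF ab, of "n - 1" ?f] fC n by auto
  have top: "nder a b n (qterm 0 y) x = ?f x * D + f' x * w x + R' x"
    if x: "x \<in> {a..b}" and D: "(w has_vector_derivative D) (at x within {a..b})" for x D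
  proof -
    have "((\<lambda>x. ?f x * w x + R x) has_vector_derivative (?f x * D + f' x * w x) + R' x) (at x within {a..b})"
      by (intro has_vector_derivative_add has_vector_derivative_mult f'(1)[OF x] D R'(1)[OF x])
    then have "(nder a b (n - 1) (qterm 0 y) has_vector_derivative (?f x * D + f' x * w x) + R' x) (at x within {a..b})"
      by (rule has_vector_derivative_transform[OF x R(2), rotated])
    from nder_SucI[OF ab x this] show ?thesis using n by (simp del: nder.simps)
  qed
  define rest where "rest = (\<lambda>x. \<Sum>k=1..n. (-1) ^ (n - k) * nder a b (n - k) (qterm k y) x)"
  have restc: "continuous_on {a..b} rest"
    unfolding rest_def by (intro continuous_intros Cm_continuous_nder[OF hk]) auto
  have Sop: "Sop n p a b l y x = (-1) ^ n * nder a b n (qterm 0 y) x + rest x" for x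
    unfolding Sop_def rest_def by (subst sum.atLeast_Suc_atMost) simp_all
  \<comment> \<open>The equation solved for y^(2n). The leading factor is (-1)^n p_0, and (-1)^n is
    its own inverse; \<open>f' x * w x + R' x\<close> collects what the product rule adds to p_0
    y^(2n).\<close>
  define G where "G = (\<lambda>x. ((-1) ^ n * (\<mu> * y x - rest x) - f' x * w x - R' x) / ?f x)"
  have wc: "continuous_on {a..b} w" unfolding w_def using Cm_continuous_nder[OF y] by simp
  have Gc: "continuous_on {a..b} G"
    unfolding G_def using p0
    by (intro continuous_intros restc wc Cm_continuous[OF y] Cm_continuous[OF f'(2)] Cm_continuous[OF R'(2)] Cm_continuous[OF fC]) force
  have sq: "(-1) ^ n * ((-1) ^ n * z) = z" for z :: complex
    by (simp flip: mult.assoc power_mult_distrib)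
  have solve: "D = G x \<longleftrightarrow> Sop n p a b l y x = \<mu> * y x"
    if x: "x \<in> {a..b}" and D: "(w has_vector_derivative D) (at x within {a..b})" for x D
  proof -
    have f0: "?f x \<noteq> 0" using p0[OF x] by simp
    have "Sop n p a b l y x = \<mu> * y x \<longleftrightarrow> (-1) ^ n * (?f x * D + f' x * w x + R' x) = \<mu> * y x - rest x"
      unfolding Sop top[OF x D] by (auto simp: algebra_simps)
    also have "\<dots> \<longleftrightarrow> ?f x * D + f' x * w x + R' x = (-1) ^ n * (\<mu> * y x - rest x)"
      by (metis sq)
    also have "\<dots> \<longleftrightarrow> D = G x" unfolding G_def using f0 by (auto simp: field_simps)
    finally show ?thesis by simp
  qed
  obtain N1 where N1: "negligible N1"
    "\<And>x. x \<in> {a<..<b} \<Longrightarrow> x \<notin> N1 \<Longrightarrow> ((\<lambda>x. integral {a..x} g) has_vector_derivative g x) (at x within {a..b})"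
    using indefinite_integral_has_vector_derivative_ae[OF g(1)] by metis
  obtain N2 where N2: "N2 \<in> null_sets lebesgue" "{x. \<not> (x \<in> {a..b} \<longrightarrow> Sop n p a b l y x = \<mu> * y x)} \<subseteq> N2"
    using S by (auto simp: eventually_ae_filter)
  \<comment> \<open>The end points join the exceptional set because \<open>N1\<close> gives
    differentiability at interior points only.\<close>
  have neg: "negligible (N1 \<union> N2 \<union> {a, b})"
    using N1(1) N2(1) by (intro negligible_Un) (auto simp: negligible_iff_null_sets)
  have gG: "g x = G x" if "x \<in> {a..b} - (N1 \<union> N2 \<union> {a, b})" for x
  proof -
    have x: "x \<in> {a..b}" using that by simp
    have "((\<lambda>x. w a + integral {a..x} g) has_vector_derivative 0 + g x) (at x within {a..b})"
      using that by (intro has_vector_derivative_add has_vector_derivative_const N1(2)) auto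
    then have "(w has_vector_derivative g x) (at x within {a..b})"
      using has_vector_derivative_transform[OF x g(2)] by simp
    moreover have "Sop n p a b l y x = \<mu> * y x" using that N2(2) by auto
    ultimately show ?thesis using solve[OF x] by blast
  qed
  have wG: "w x = w a + integral {a..x} G" if "x \<in> {a..b}" for x
  proof -
    have "integral {a..x} g = integral {a..x} G"
      by (rule integral_spike[OF neg]) (use gG that in auto)
    then show ?thesis using g(2)[OF that] by simp
  qed
  have wd: "(w has_vector_derivative G x) (at x within {a..b})" if x: "x \<in> {a..b}" for x
  proof -
    have "((\<lambda>x. w a + integral {a..x} G) has_vector_derivative 0 + G x) (at x within {a..b})"
      by (intro has_vector_derivative_add has_vector_derivative_const integral_has_vector_derivative Gc x)
    then show ?thesis using has_vector_derivative_transform[OF x wG] by simp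
  qed
  show "Cm (2 * n) a b y"
    using Cm_extend[OF ab y, of G] wd Gc n unfolding w_def by simp
  show "Sop n p a b l y x = \<mu> * y x" if "x \<in> {a..b}" for x
    using solve[OF that wd[OF that]] by simp
qed

text \<open>One step of a bootstrap. The cap 2n - i fits the hypotheses exactly: row i \<ge> n
  contains p_k with k = i + 1 - n, which is of class C^(n-k), and n - k = 2n - (i + 1).\<close>

lemma sysrhs_Cm:
  assumes Y: "\<And>i. i < 2 * n \<Longrightarrow> Cm (min s (2 * n - i)) a b (Y i)" and i: "i < 2 * n"
  shows "Cm (min s (2 * n - Suc i)) a b (sysrhs n (\<lambda>k x. p k x l) \<mu> Y i)"
proof -
  let ?k = "min s (2 * n - Suc i)"
  consider "i + 1 < n" | "i + 1 = n" | "i \<ge> n" by linarith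
  then show ?thesis
  proof cases
    case 1
    then have "sysrhs n (\<lambda>k x. p k x l) \<mu> Y i = Y (i + 1)" by (auto simp: sysrhs_def)
    then show ?thesis using Y[of "i + 1"] 1 by simp
  next
    case 2
    then have "sysrhs n (\<lambda>k x. p k x l) \<mu> Y i = (\<lambda>x. Y n x * inverse (of_real (p 0 x l)))"
      by (auto simp: sysrhs_def divide_inverse)
    moreover have "Cm ?k a b (\<lambda>x. Y n x * inverse (of_real (p 0 x l)))"
      using 2 p0 pC[of 0] Y[of n] n
      by (intro Cm_mult[OF ab] Cm_inverse[OF ab] Cm_of_real[OF ab]) (force intro: Cm_mono)+
    ultimately show ?thesis by simp
  next
    case 3
    have e: "sysrhs n (\<lambda>k x. p k x l) \<mu> Y i = (\<lambda>x. of_real (p (i + 1 - n) x l) * Y (2 * n - 1 - i) x -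
        (if i + 1 < 2 * n then Y (i + 1) x else \<mu> * Y 0 x))" using 3 by (auto simp: sysrhs_def)
    have "Cm ?k a b (\<lambda>x. complex_of_real (p (i + 1 - n) x l))"
      using 3 i by (intro Cm_of_real[OF ab] Cm_mono[OF pC]) auto
    moreover have "Cm ?k a b (Y (2 * n - 1 - i))"
      using 3 i by (intro Cm_mono[OF Y]) auto
    moreover have "Cm ?k a b (\<lambda>x. if i + 1 < 2 * n then Y (i + 1) x else \<mu> * Y 0 x)"
    proof (cases "i + 1 < 2 * n")
      case True then show ?thesis using Y[of "i + 1"] by simp
    next
      case False
      then show ?thesis using n by (auto intro!: Cm_mult[OF ab] Cm_const[OF ab] Cm_mono[OF Y])
    qed
    ultimately show ?thesis unfolding e by (intro Cm_diff[OF ab] Cm_mult[OF ab])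
  qed
qed

lemma linsol_Cm:
  assumes sol: "linsol (2 * n) (sysmat n (\<lambda>k x. p k x l) \<mu>) a b Y"
  shows "i < 2 * n \<Longrightarrow> Cm (min s (2 * n - i)) a b (Y i)"
proof (induction s arbitrary: i)
  case 0
  then show ?case using linsol_continuous[OF sol] by (simp add: Cm_0)
next
  case (Suc s)
  have "Cm (Suc (min s (2 * n - Suc i))) a b (Y i)"
    using sol Suc.prems unfolding linsol_sysmat_iff[OF n]
    by (intro Cm_SucI[OF ab _ sysrhs_Cm[where \<mu> = \<mu>, OF Suc.IH Suc.prems]]) auto
  moreover have "Suc (min s (2 * n - Suc i)) = min (Suc s) (2 * n - i)" using Suc.prems by simp
  ultimately show ?case by simp
qed

text \<open>Going up the rows, the quasi-derivative of y and the corresponding component of Y are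
  identified by writing the derivative of one and the same function in two ways, through
  \<open>qder_has_derivative\<close> and through the system. Thus no solution of the system is
  spurious.\<close>

lemma quasi_of_linsol:
  assumes sol: "linsol (2 * n) (sysmat n (\<lambda>k x. p k x l) \<mu>) a b Y"
    and y: "\<And>x. x \<in> {a..b} \<Longrightarrow> y x = Y 0 x"
  shows "Cm (2 * n) a b y"
    "\<And>i x. i < 2 * n \<Longrightarrow> x \<in> {a..b} \<Longrightarrow> quasi n p a b l y i x = Y i x"
    "\<And>x. x \<in> {a..b} \<Longrightarrow> Sop n p a b l y x = \<mu> * y x"
proof -
  have d: "(Y i has_vector_derivative sysrhs n (\<lambda>k x. p k x l) \<mu> Y i x) (at x within {a..b})"
    if "i < 2 * n" "x \<in> {a..b}" for i x using sol that unfolding linsol_sysmat_iff[OF n] by blast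
  have "Cm (min (2 * n) (2 * n - 0)) a b (Y 0)" using n by (intro linsol_Cm[OF sol]) simp
  then show yC: "Cm (2 * n) a b y" using Cm_cong[of a b y "Y 0"] y by simp
  have nd: "nder a b i y x = Y i x" if "i < n" "x \<in> {a..b}" for i x
    using that
  proof (induction i arbitrary: x)
    case 0 then show ?case using y by simp
  next
    case (Suc i)
    have "(Y i has_vector_derivative Y (Suc i) x) (at x within {a..b})"
      using d[of i x] Suc.prems by (simp add: sysrhs_def)
    moreover have "nder a b i y x = Y i x" if "x \<in> {a..b}" for x using Suc that by simp
    ultimately have "(nder a b i y has_vector_derivative Y (Suc i) x) (at x within {a..b})"
      using has_vector_derivative_transform[OF Suc.prems(2), of "nder a b i y" "Y i"] by blast
    then show ?case using nder_SucI[OF ab Suc.prems(2)] by blast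
  qed
  \<comment> \<open>The case r = n is included with value \<mu> y: it is the last row of the system,
    and it is the eigenvalue equation.\<close>
  have qd: "qder n p a b l r y x = (if r < n then Y (n + r) x else \<mu> * Y 0 x)" if "r \<le> n" "x \<in> {a..b}" for r x
    using that
  proof (induction r arbitrary: x)
    case 0
    have "(Y (n - 1) has_vector_derivative Y n x / of_real (p 0 x l)) (at x within {a..b})"
      using d[of "n - 1" x] 0 n by (simp add: sysrhs_def)
    moreover have "nder a b (n - 1) y x = Y (n - 1) x" if "x \<in> {a..b}" for x using nd that n by simp
    ultimately have "(nder a b (n - 1) y has_vector_derivative Y n x / of_real (p 0 x l)) (at x within {a..b})"
      using has_vector_derivative_transform[OF 0(2), of "nder a b (n - 1) y" "Y (n - 1)"] by blast
    then have "nder a b (Suc (n - 1)) y x = Y n x / of_real (p 0 x l)" using nder_SucI[OF ab 0(2)] by blast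
    then have "nder a b n y x = Y n x / of_real (p 0 x l)" using n by (simp del: nder.simps)
    then show ?case using p0[OF 0(2)] n by (simp add: qder_def)
  next
    case (Suc r)
    have r: "r < n" using Suc.prems by simp
    have "(qder n p a b l r y has_vector_derivative qterm (Suc r) y x - qder n p a b l (Suc r) y x) (at x within {a..b})"
    proof (rule qder_has_derivative[OF _ Suc.prems(2)])
      fix k assume "k \<le> r"
      then show "Cm (Suc r - k) a b (qterm k y)" using r by (intro Cm_mono[OF Cm_qterm[OF yC]]) auto
    qed
    moreover have "(qder n p a b l r y has_vector_derivative sysrhs n (\<lambda>k x. p k x l) \<mu> Y (n + r) x) (at x within {a..b})"
      using has_vector_derivative_transform[OF Suc.prems(2) _ d[of "n + r" x]] Suc r by simp
    ultimately have "qterm (Suc r) y x - qder n p a b l (Suc r) y x = sysrhs n (\<lambda>k x. p k x l) \<mu> Y (n + r) x"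
      by (elim trans[OF nder_1I[OF ab Suc.prems(2), symmetric] nder_1I[OF ab Suc.prems(2)]])
    moreover have "2 * n - 1 - (n + r) = n - Suc r" using r by simp
    moreover have "nder a b (n - Suc r) y x = Y (n - Suc r) x" using nd Suc.prems n by simp
    ultimately show ?case using r by (auto simp: sysrhs_def)
  qed
  show "quasi n p a b l y i x = Y i x" if "i < 2 * n" "x \<in> {a..b}" for i x
    using that nd qd[of "i - n" x] by (auto simp: quasi_def)
  show "Sop n p a b l y x = \<mu> * y x" if "x \<in> {a..b}" for x
    using qd[of n x] that y[OF that] by (simp add: Sop_eq_qder)
qed

lemma Cm_imp_W2:
  assumes "Cm (2 * n) a b y" shows "W2 (2 * n) a b y"
proof -
  have m: "2 * n = Suc (2 * n - 1)" using n by simp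
  have c: "continuous_on {a..b} (nder a b (2 * n) y)" using Cm_continuous_nder[OF assms] by simp
  have ftc: "nder a b (2 * n - 1) y x = nder a b (2 * n - 1) y a + integral {a..x} (nder a b (2 * n) y)"
    if x: "x \<in> {a..b}" for x
  proof -
    have "(nder a b (2 * n) y has_integral nder a b (2 * n - 1) y x - nder a b (2 * n - 1) y a) {a..x}"
    proof (rule fundamental_theorem_of_calculus)
      show "a \<le> x" using x by simp
      fix s assume "s \<in> {a..x}"
      then have "(nder a b (2 * n - 1) y has_vector_derivative nder a b (Suc (2 * n - 1)) y s) (at s within {a..b})"
        using x n by (intro Cm_nder_has_derivative[OF assms]) auto
      then show "(nder a b (2 * n - 1) y has_vector_derivative nder a b (2 * n) y s) (at s within {a..x})"
        unfolding m[symmetric] by (rule has_vector_derivative_within_subset) (use x in auto)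
    qed
    then show ?thesis by (simp add: integral_unique)
  qed
  have int: "nder a b (2 * n) y integrable_on {a..b}" "(\<lambda>x. (norm (nder a b (2 * n) y x))\<^sup>2) integrable_on {a..b}"
    using c by (auto intro!: integrable_continuous_interval continuous_intros)
  have "Cm (2 * n - 1) a b y" using assms by (rule Cm_mono) simp
  then show ?thesis unfolding W2_def
    by (intro conjI exI[of _ "nder a b (2 * n) y"] ballI int ftc)
qed

lemma eigsp_imp_linsol:
  assumes "y \<in> eigsp n p U a b l \<mu>"
  shows "linsol (2 * n) (sysmat n (\<lambda>k x. p k x l) \<mu>) a b (quasi n p a b l y)"
    "boundary_condition n a b (U l) (quasi n p a b l y)"
  using assms eigenfunction_regular[of y \<mu>] quasi_linsol[of y \<mu>]
  unfolding eigsp_def Sdom_def boundary_condition_def yhat_eq_bhat[where p = p and l = l] ycheck_eq_bcheck by auto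

text \<open>The extension by 0 outside [a, b] is the representative that \<open>eigsp\<close> asks
  for. Derivatives are taken within [a, b], so the extension leaves the quasi-derivatives and
  boundary vectors unchanged.\<close>

lemma linsol_imp_eigsp:
  assumes sol: "linsol (2 * n) (sysmat n (\<lambda>k x. p k x l) \<mu>) a b Y" and bc: "boundary_condition n a b (U l) Y"
  shows "(\<lambda>x. if x \<in> {a..b} then Y 0 x else 0) \<in> eigsp n p U a b l \<mu>"
    "\<And>i x. i < 2 * n \<Longrightarrow> x \<in> {a..b} \<Longrightarrow> quasi n p a b l (\<lambda>x. if x \<in> {a..b} then Y 0 x else 0) i x = Y i x"
proof -
  let ?y = "\<lambda>x. if x \<in> {a..b} then Y 0 x else 0"
  note q = quasi_of_linsol[OF sol, of ?y]
  show *: "quasi n p a b l ?y i x = Y i x" if "i < 2 * n" "x \<in> {a..b}" for i x using q(2) that by simp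
  have "bhat n a b (quasi n p a b l ?y) = bhat n a b Y" "bcheck n a b (quasi n p a b l ?y) = bcheck n a b Y"
    using ab * by (auto intro!: bhat_cong bcheck_cong)
  then have "Sdom n p U a b l ?y"
    using bc q(1) Cm_imp_W2 unfolding Sdom_def boundary_condition_def yhat_eq_bhat[where p = p and l = l] ycheck_eq_bcheck
    by simp
  moreover have "AE x in lebesgue. x \<in> {a..b} \<longrightarrow> Sop n p a b l ?y x = \<mu> * ?y x"
    by (rule AE_I2) (use q(3) in auto)
  ultimately show "?y \<in> eigsp n p U a b l \<mu>" unfolding eigsp_def by auto
qed

end

section \<open>Column independence and constant rank\<close>

text \<open>Independence of an indexed family of columns, so two equal columns with different
  indices count as dependent. Entries are given by a function of two indices, which is convenient
  when they depend on a parameter.\<close>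

definition col_indep :: "nat \<Rightarrow> (nat \<Rightarrow> nat \<Rightarrow> complex) \<Rightarrow> nat set \<Rightarrow> bool" where
  "col_indep N A J \<longleftrightarrow> (\<forall>x. (\<forall>i<N. (\<Sum>j\<in>J. A i j * x j) = 0) \<longrightarrow> (\<forall>j\<in>J. x j = 0))"

lemma col_indepD:
  assumes "col_indep N A J" "\<And>i. i < N \<Longrightarrow> (\<Sum>j\<in>J. A i j * x j) = 0" "j \<in> J"
  shows "x j = 0"
proof -
  have "\<forall>i<N. (\<Sum>j\<in>J. A i j * x j) = 0" using assms(2) by simp
  then have "\<forall>j\<in>J. x j = 0" using assms(1) unfolding col_indep_def by (elim allE[of _ x] impE)
  then show ?thesis using assms(3) by (rule bspec)
qed

lemma col_indepI:
  assumes "\<And>x j. (\<And>i. i < N \<Longrightarrow> (\<Sum>j\<in>J. A i j * x j) = 0) \<Longrightarrow> j \<in> J \<Longrightarrow> x j = 0"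
  shows "col_indep N A J"
  unfolding col_indep_def
proof (intro allI impI ballI)
  fix x j assume x: "\<forall>i<N. (\<Sum>j\<in>J. A i j * x j) = 0" and j: "j \<in> J"
  show "x j = 0" by (rule assms[OF _ j]) (rule x[rule_format])
qed

lemma col_indep_cong:
  assumes A: "col_indep N A J" and eq: "\<And>i j. i < N \<Longrightarrow> j \<in> J \<Longrightarrow> A i j = B i j"
  shows "col_indep N B J"
proof (rule col_indepI)
  fix x j assume x: "\<And>i. i < N \<Longrightarrow> (\<Sum>j\<in>J. B i j * x j) = 0" and j: "j \<in> J"
  have "(\<Sum>j\<in>J. A i j * x j) = 0" if "i < N" for i
  proof -
    have "(\<Sum>j\<in>J. A i j * x j) = (\<Sum>j\<in>J. B i j * x j)" by (intro sum.cong) (simp_all add: eq that)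
    then show ?thesis using x[OF that] by simp
  qed
  then show "x j = 0" by (rule col_indepD[OF A _ j])
qed

lemma mult_mat_vec_index_sum:
  assumes "A \<in> carrier_mat m N" "v \<in> carrier_vec N" "i < m"
  shows "vec_index (A *\<^sub>v v) i = (\<Sum>j<N. A $$ (i, j) * vec_index v j)"
  using assms by (auto simp: scalar_prod_def atLeast0LessThan intro!: sum.cong)

lemma det_nonzero_iff_col_indep:
  assumes A: "A \<in> carrier_mat N N"
  shows "Determinant.det A \<noteq> 0 \<longleftrightarrow> col_indep N (\<lambda>i j. A $$ (i, j)) {..<N}"
proof -
  have "Determinant.det A = 0 \<longleftrightarrow> (\<exists>v. v \<in> carrier_vec N \<and> v \<noteq> 0\<^sub>v N \<and> A *\<^sub>v v = 0\<^sub>v N)"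
    by (rule det_0_iff_vec_prod_zero[OF A])
  also have "\<dots> \<longleftrightarrow> (\<exists>x. (\<forall>i<N. (\<Sum>j\<in>{..<N}. A $$ (i, j) * x j) = 0) \<and> (\<exists>j\<in>{..<N}. x j \<noteq> 0))"
  proof safe
    fix v assume v: "v \<in> carrier_vec N" "v \<noteq> 0\<^sub>v N" "A *\<^sub>v v = 0\<^sub>v N"
    have "\<forall>i<N. (\<Sum>j\<in>{..<N}. A $$ (i, j) * vec_index v j) = 0"
      using mult_mat_vec_index_sum[OF A v(1)] v(3) by (metis index_zero_vec(1))
    moreover have "\<exists>j\<in>{..<N}. vec_index v j \<noteq> 0"
    proof (rule ccontr)
      assume "\<not> ?thesis"
      then have "v = 0\<^sub>v N" using v(1) by (intro eq_vecI) auto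
      then show False using v(2) by simp
    qed
    ultimately show "\<exists>x. (\<forall>i<N. (\<Sum>j\<in>{..<N}. A $$ (i, j) * x j) = 0) \<and> (\<exists>j\<in>{..<N}. x j \<noteq> 0)" by blast
  next
    fix x j assume x: "\<forall>i<N. (\<Sum>j\<in>{..<N}. A $$ (i, j) * x j) = 0" "j < N" "x j \<noteq> 0"
    have v: "Matrix.vec N x \<in> carrier_vec N" by simp
    have "Matrix.vec N x \<noteq> 0\<^sub>v N"
    proof
      assume "Matrix.vec N x = 0\<^sub>v N"
      then have "vec_index (Matrix.vec N x) j = vec_index (0\<^sub>v N) j" by simp
      then show False using x by simp
    qed
    moreover have "A *\<^sub>v Matrix.vec N x = 0\<^sub>v N"
    proof (rule eq_vecI)
      fix i assume "i < dim_vec (0\<^sub>v N)"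
      then have i: "i < N" by simp
      have "vec_index (A *\<^sub>v Matrix.vec N x) i = (\<Sum>j<N. A $$ (i, j) * vec_index (Matrix.vec N x) j)"
        by (rule mult_mat_vec_index_sum[OF A v i])
      also have "\<dots> = (\<Sum>j<N. A $$ (i, j) * x j)" by (intro sum.cong) auto
      finally show "vec_index (A *\<^sub>v Matrix.vec N x) i = vec_index (0\<^sub>v N) i" using x i by simp
    qed (use A in simp)
    ultimately show "\<exists>v. v \<in> carrier_vec N \<and> v \<noteq> 0\<^sub>v N \<and> A *\<^sub>v v = 0\<^sub>v N" using v by blast
  qed
  finally show ?thesis unfolding col_indep_def by blast
qed

text \<open>If the columns in J spanned everything, solving for each unit vector would give a right
  inverse of the square matrix with all columns outside J set to 0. Its determinant would be nonzero
  although column k vanishes.\<close>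

lemma ex_not_in_col_span:
  fixes N :: nat
  assumes J: "J \<subseteq> {..<N}" "k < N" "k \<notin> J"
  shows "\<exists>b. \<forall>x. \<exists>i<N. (\<Sum>j\<in>J. A i j * x j) \<noteq> (b i :: complex)"
proof (rule ccontr)
  assume "\<not> ?thesis"
  then have b: "\<exists>x. \<forall>i<N. (\<Sum>j\<in>J. A i j * x j) = b i" for b by blast
  have "\<exists>x. \<forall>i<N. (\<Sum>j\<in>J. A i j * x j) = (if i = m then 1 else 0)" for m
    by (rule b)
  then obtain X where X: "\<And>m i. i < N \<Longrightarrow> (\<Sum>j\<in>J. A i j * X m j) = (if i = m then 1 else 0)" by metis
  define A' where "A' = mat N N (\<lambda>(i, j). if j \<in> J then A i j else 0)"
  define X' where "X' = mat N N (\<lambda>(j, m). X m j)"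
  have c: "A' \<in> carrier_mat N N" "X' \<in> carrier_mat N N" by (auto simp: A'_def X'_def)
  have "A' * X' = 1\<^sub>m N"
  proof (rule eq_matI)
    fix i m assume "i < dim_row (1\<^sub>m N :: complex mat)" "m < dim_col (1\<^sub>m N :: complex mat)"
    then have im: "i < N" "m < N" by auto
    have "(A' * X') $$ (i, m) = (\<Sum>j<N. (if j \<in> J then A i j else 0) * X m j)"
      using im by (auto simp: A'_def X'_def scalar_prod_def atLeast0LessThan intro!: sum.cong)
    also have "\<dots> = (\<Sum>j\<in>J. A i j * X m j)"
      using J by (intro sum.mono_neutral_cong_right) auto
    finally show "(A' * X') $$ (i, m) = 1\<^sub>m N $$ (i, m)" using X im by simp
  qed (use c in auto)
  then have "Determinant.det A' * Determinant.det X' = 1" using det_mult[OF c] by simp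
  then have "Determinant.det A' \<noteq> 0" by auto
  then have "col_indep N (\<lambda>i j. A' $$ (i, j)) {..<N}" using det_nonzero_iff_col_indep[OF c(1)] by simp
  moreover have "\<forall>i<N. (\<Sum>j\<in>{..<N}. A' $$ (i, j) * (if j = k then 1 else 0)) = 0"
    using J by (auto simp: A'_def intro!: sum.neutral)
  ultimately have "(if k = k then 1 else 0 :: complex) = 0"
    using J(2) by (intro col_indepD[where x = "\<lambda>j. if j = k then 1 else 0"]) auto
  then show False by simp
qed

text \<open>Completion to a basis, keeping the given columns. It serves to invert an injective but
  non-square block with a bound, and to adapt a basis to the kernel of the boundary matrix.\<close>

lemma col_indep_extend:
  assumes "J \<subseteq> {..<N}" "col_indep N A J"
  shows "\<exists>F. (\<forall>j\<in>J. \<forall>i. F i j = A i j) \<and> col_indep N F {..<N}"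
  using assms
proof (induction "N - card J" arbitrary: J A rule: less_induct)
  case less
  have fin: "finite J" using less.prems finite_subset by blast
  show ?case
  proof (cases "J = {..<N}")
    case True
    then show ?thesis using less.prems by blast
  next
    case False
    then obtain k where k: "k < N" "k \<notin> J" using less.prems by blast
    obtain b where b: "\<And>x. \<exists>i<N. (\<Sum>j\<in>J. A i j * x j) \<noteq> b i"
      using ex_not_in_col_span[OF less.prems(1) k] by blast
    define A2 where "A2 = (\<lambda>i j. if j = k then b i else A i j)"
    have s: "(\<Sum>j\<in>insert k J. A2 i j * x j) = b i * x k + (\<Sum>j\<in>J. A i j * x j)" for x i
      using k fin by (auto simp: A2_def intro!: sum.cong)
    have "col_indep N A2 (insert k J)"
      unfolding col_indep_def
    proof (intro allI impI)
      fix x assume x: "\<forall>i<N. (\<Sum>j\<in>insert k J. A2 i j * x j) = 0"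
      have x': "(\<Sum>j\<in>J. A i j * x j) = - (b i * x k)" if "i < N" for i
        using x that s[of i x] by (simp add: eq_neg_iff_add_eq_0 add.commute)
      have xk: "x k = 0"
      proof (rule ccontr)
        assume nz: "x k \<noteq> 0"
        have "(\<Sum>j\<in>J. A i j * (- x j / x k)) = b i" if "i < N" for i
        proof -
          have "(\<Sum>j\<in>J. A i j * (- x j / x k)) = - (\<Sum>j\<in>J. A i j * x j) / x k"
            by (simp add: sum_negf sum_divide_distrib)
          then show ?thesis using x'[OF that] nz by simp
        qed
        then show False using b[of "\<lambda>j. - x j / x k"] by blast
      qed
      have "x j = 0" if "j \<in> J" for j
        by (rule col_indepD[OF less.prems(2) _ that]) (simp add: x' xk)
      then show "\<forall>j\<in>insert k J. x j = 0" using xk by simp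
    qed
    moreover have sub: "insert k J \<subseteq> {..<N}" using less.prems k by auto
    moreover have "N - card (insert k J) < N - card J"
      using k fin card_mono[OF _ sub] by simp
    ultimately obtain F where F: "\<forall>j\<in>insert k J. \<forall>i. F i j = A2 i j" "col_indep N F {..<N}"
      using less.hyps[of "insert k J" A2] by blast
    then show ?thesis using k by (intro exI[of _ F]) (auto simp: A2_def)
  qed
qed

lemma col_indep_left_inverse:
  assumes "col_indep N F {..<N}"
  shows "\<exists>L. \<forall>x. \<forall>j<N. x j = (\<Sum>i<N. L j i * (\<Sum>k<N. F i k * x k))"
proof -
  define FM where "FM = mat N N (\<lambda>(i, j). F i j)"
  have c: "FM \<in> carrier_mat N N" by (simp add: FM_def)
  have "col_indep N (\<lambda>i j. FM $$ (i, j)) {..<N}"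
    by (rule col_indep_cong[OF assms]) (simp add: FM_def)
  then have "Determinant.det FM \<noteq> 0" using det_nonzero_iff_col_indep[OF c] by simp
  then obtain L where L: "L \<in> carrier_mat N N" "L * FM = 1\<^sub>m N"
    using det_non_zero_imp_unit[OF c] unfolding Units_def by (auto simp: ring_mat_def)
  show ?thesis
  proof (intro exI[of _ "\<lambda>j i. L $$ (j, i)"] allI impI)
    fix x j assume j: "j < N"
    have e: "(\<Sum>i<N. L $$ (j, i) * F i k) = (if j = k then 1 else 0)" if "k < N" for k
    proof -
      have "(L * FM) $$ (j, k) = (\<Sum>i<N. L $$ (j, i) * F i k)"
        using j that L(1) by (auto simp: FM_def scalar_prod_def atLeast0LessThan intro!: sum.cong)
      then show ?thesis using L(2) j that by simp
    qed
    have "(\<Sum>i<N. L $$ (j, i) * (\<Sum>k<N. F i k * x k)) = (\<Sum>k<N. (\<Sum>i<N. L $$ (j, i) * F i k) * x k)"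
      unfolding sum_distrib_left sum_distrib_right by (subst sum.swap) (simp add: mult.assoc)
    also have "\<dots> = (\<Sum>k<N. if k = j then x k else 0)" using e by (intro sum.cong) auto
    finally show "x j = (\<Sum>i<N. L $$ (j, i) * (\<Sum>k<N. F i k * x k))" using j by simp
  qed
qed

text \<open>The rank is defined through the set of columns, where equal columns collapse.
  Coefficients 1 and -1 at two equal columns would contradict \<open>col_indep\<close>, so passing
  from indices to columns is injective on J.\<close>

lemma card_col_indep_le_rank:
  assumes A: "A \<in> carrier_mat N N" and J: "J \<subseteq> {..<N}" and ind: "col_indep N (\<lambda>i j. A $$ (i, j)) J"
  shows "card J \<le> vec_space.rank N (A :: complex mat)"
proof -
  interpret vec_space "TYPE(complex)" N .
  have fin: "finite J" using J finite_subset by blast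
  have inj: "inj_on (col A) J"
  proof (rule inj_onI, rule ccontr)
    fix i j assume ij: "i \<in> J" "j \<in> J" "col A i = col A j" "i \<noteq> j"
    have "(\<Sum>k\<in>J. A $$ (m, k) * ((if k = i then 1 else 0) - (if k = j then 1 else 0))) = 0" if "m < N" for m
    proof -
      have e: "A $$ (m, i) = A $$ (m, j)"
      proof -
        have "i < N" "j < N" using J ij by auto
        then show ?thesis using index_col[of m A i] index_col[of m A j] ij(3) A that by simp
      qed
      have "(\<Sum>k\<in>J. A $$ (m, k) * ((if k = i then 1 else 0) - (if k = j then 1 else 0)))
         = (\<Sum>k\<in>J. (if k = i then A $$ (m, k) else 0) - (if k = j then A $$ (m, k) else 0))"
        by (intro sum.cong) auto
      also have "\<dots> = 0" using fin ij e by (simp add: sum_subtractf)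
      finally show ?thesis .
    qed
    then have "(if i = i then 1 else 0) - (if i = j then 1 else 0) = (0 :: complex)"
      by (rule col_indepD[OF ind _ ij(1)])
    then show False using ij by simp
  qed
  have sub: "col A ` J \<subseteq> set (cols A)" using J A by (auto simp: cols_def)
  have carr: "col A ` J \<subseteq> carrier_vec N" using J A by auto
  have "lin_indpt (col A ` J)"
  proof
    assume "lin_dep (col A ` J)"
    then obtain T f v where T: "finite T" "T \<subseteq> col A ` J" "lincomb f T = 0\<^sub>v N" "v \<in> T" "f v \<noteq> 0"
      unfolding lin_dep_def by auto
    define x where "x = (\<lambda>j. if col A j \<in> T then f (col A j) else 0)"
    have "(\<Sum>j\<in>J. A $$ (i, j) * x j) = 0" if i: "i < N" for i
    proof -
      have "(\<Sum>j\<in>J. A $$ (i, j) * x j) = (\<Sum>j\<in>J. if col A j \<in> T then f (col A j) * vec_index (col A j) i else 0)"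
        using A J i by (intro sum.cong) (auto simp: x_def subset_iff)
      also have "\<dots> = (\<Sum>u\<in>col A ` J. if u \<in> T then f u * vec_index u i else 0)"
        by (simp add: sum.reindex[OF inj])
      also have "\<dots> = (\<Sum>u\<in>T. f u * vec_index u i)"
        using T fin by (intro sum.mono_neutral_cong_right) auto
      also have "\<dots> = vec_index (lincomb f T) i"
        using T carr i by (subst lincomb_index) auto
      finally show ?thesis using T(3) i by simp
    qed
    then have "x j = 0" if "j \<in> J" for j by (rule col_indepD[OF ind _ that])
    moreover obtain j where j: "j \<in> J" "v = col A j" using T by auto
    moreover have "x j = f v" using j T(4) by (simp add: x_def)
    ultimately show False using T(5) by simp
  qed
  from rank_ge_card_indpt[OF A sub this] show ?thesis using card_image[OF inj] by simp
qed

text \<open>A maximal independent set of columns has as many elements as the rank; choosing one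
  index for each of its members turns it into an index set.\<close>

lemma ex_col_indep_card_rank:
  assumes A: "A \<in> carrier_mat N N"
  shows "\<exists>J\<subseteq>{..<N}. card J = vec_space.rank N (A :: complex mat) \<and> col_indep N (\<lambda>i j. A $$ (i, j)) J"
proof -
  interpret vec_space "TYPE(complex)" N .
  have "lin_indpt {}" by (auto simp: lin_dep_def)
  then obtain S where S: "finite S" "maximal S (\<lambda>T. T \<subseteq> set (cols A) \<and> lin_indpt T)"
    using maximal_exists_superset[of "set (cols A)" "\<lambda>T. T \<subseteq> set (cols A) \<and> lin_indpt T" "{}"] by auto
  have card: "rank A = card S" by (rule rank_card_indpt[OF A S(2)])
  have sub: "S \<subseteq> set (cols A)" and ind: "lin_indpt S" using S(2) by (auto simp: maximal_def)
  have "\<forall>s\<in>S. \<exists>i<N. col A i = s" using sub A by (force simp: cols_def)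
  then obtain f where f: "\<And>s. s \<in> S \<Longrightarrow> f s < N" "\<And>s. s \<in> S \<Longrightarrow> col A (f s) = s" by metis
  have inj: "inj_on f S" using f(2) by (metis inj_onI)
  have carr: "S \<subseteq> carrier_vec N" using sub A cols_dim by blast
  show ?thesis
  proof (intro exI[of _ "f ` S"] conjI)
    show "f ` S \<subseteq> {..<N}" using f by auto
    show "card (f ` S) = rank A" using card card_image[OF inj] by simp
    show "col_indep N (\<lambda>i j. A $$ (i, j)) (f ` S)"
      unfolding col_indep_def
    proof (intro allI impI)
      fix x assume x: "\<forall>i<N. (\<Sum>j\<in>f ` S. A $$ (i, j) * x j) = 0"
      have "lincomb (\<lambda>s. x (f s)) S = 0\<^sub>v N"
      proof (rule eq_vecI)
        fix i assume "i < dim_vec (0\<^sub>v N :: complex Matrix.vec)"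
        then have i: "i < N" by simp
        have "vec_index (lincomb (\<lambda>s. x (f s)) S) i = (\<Sum>s\<in>S. x (f s) * vec_index s i)"
          using carr i by (subst lincomb_index) auto
        also have "\<dots> = (\<Sum>s\<in>S. A $$ (i, f s) * x (f s))"
        proof (rule sum.cong)
          fix s assume s: "s \<in> S"
          have "A $$ (i, f s) = vec_index (col A (f s)) i" using A i f(1)[OF s] by simp
          then show "x (f s) * vec_index s i = A $$ (i, f s) * x (f s)" using f(2)[OF s] by simp
        qed simp
        also have "\<dots> = (\<Sum>j\<in>f ` S. A $$ (i, j) * x j)" by (simp add: sum.reindex[OF inj])
        finally show "vec_index (lincomb (\<lambda>s. x (f s)) S) i = vec_index (0\<^sub>v N) i" using x i by simp
      qed (use lincomb_dim[OF S(1) carr] in simp)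
      then have "\<forall>s\<in>S. x (f s) = 0"
        using ind S(1) unfolding lin_dep_def by fastforce
      then show "\<forall>j\<in>f ` S. x j = 0" by simp
    qed
  qed
qed

text \<open>By maximality, adding a further index k to J creates a dependence. The coefficient of
  column k in it is nonzero because J alone is independent, so column k can be expressed by the
  columns in J.\<close>

lemma col_span_of_card_rank:
  assumes A: "A \<in> carrier_mat N N" and J: "J \<subseteq> {..<N}" and ind: "col_indep N (\<lambda>i j. A $$ (i, j)) J"
    and card: "card J = vec_space.rank N (A :: complex mat)"
  shows "\<exists>x. \<forall>i<N. (\<Sum>j\<in>J. A $$ (i, j) * x j) = (\<Sum>j<N. A $$ (i, j) * w j)"
proof -
  have fin: "finite J" using J finite_subset by blast
  have "\<exists>x. \<forall>i<N. (\<Sum>j\<in>J. A $$ (i, j) * x j) = A $$ (i, k)" if k: "k < N" for k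
  proof (cases "k \<in> J")
    case True
    then have "\<forall>i<N. (\<Sum>j\<in>J. A $$ (i, j) * (if j = k then 1 else 0)) = A $$ (i, k)"
      using fin by (simp add: if_distrib[where f = "\<lambda>t. _ * t"] cong: if_cong)
    then show ?thesis by (rule exI[of _ "\<lambda>j. if j = k then 1 else 0"])
  next
    case False
    have "\<not> col_indep N (\<lambda>i j. A $$ (i, j)) (insert k J)"
      using card_col_indep_le_rank[OF A, of "insert k J"] False J k fin card by auto
    then obtain x where x0: "\<forall>i<N. (\<Sum>j\<in>insert k J. A $$ (i, j) * x j) = 0" and xn: "\<exists>j\<in>insert k J. x j \<noteq> 0"
      unfolding col_indep_def by blast
    have x: "A $$ (i, k) * x k + (\<Sum>j\<in>J. A $$ (i, j) * x j) = 0" if "i < N" for i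
      using x0[rule_format, OF that] fin False by simp
    have xk: "x k \<noteq> 0"
    proof
      assume xk: "x k = 0"
      have s0: "(\<Sum>j\<in>J. A $$ (i, j) * x j) = 0" if "i < N" for i using x[OF that] xk by simp
      have "x j = 0" if "j \<in> J" for j by (rule col_indepD[OF ind s0 that])
      then show False using xn xk by auto
    qed
    have "(\<Sum>j\<in>J. A $$ (i, j) * (- x j / x k)) = A $$ (i, k)" if "i < N" for i
    proof -
      have "(\<Sum>j\<in>J. A $$ (i, j) * (- x j / x k)) = - (\<Sum>j\<in>J. A $$ (i, j) * x j) / x k"
        by (simp add: sum_negf sum_divide_distrib)
      also have "(\<Sum>j\<in>J. A $$ (i, j) * x j) = - (A $$ (i, k) * x k)"
        using x[OF that] by (simp add: eq_neg_iff_add_eq_0 add.commute)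
      finally show ?thesis using xk by simp
    qed
    then show ?thesis by (intro exI[of _ "\<lambda>j. - x j / x k"]) blast
  qed
  then obtain X where X: "\<And>k i. k < N \<Longrightarrow> i < N \<Longrightarrow> (\<Sum>j\<in>J. A $$ (i, j) * X k j) = A $$ (i, k)" by metis
  have "(\<Sum>j\<in>J. A $$ (i, j) * (\<Sum>k<N. X k j * w k)) = (\<Sum>k<N. A $$ (i, k) * w k)" if "i < N" for i
  proof -
    have "(\<Sum>j\<in>J. A $$ (i, j) * (\<Sum>k<N. X k j * w k)) = (\<Sum>k<N. (\<Sum>j\<in>J. A $$ (i, j) * X k j) * w k)"
      unfolding sum_distrib_left sum_distrib_right by (subst sum.swap) (simp add: mult.assoc)
    then show ?thesis using X that by simp
  qed
  then show ?thesis by (intro exI[of _ "\<lambda>j. \<Sum>k<N. X k j * w k"]) blast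
qed

text \<open>Constant rank makes the pseudo-inverse locally bounded: columns that form a basis of the range
  at one parameter value still do so nearby.\<close>

lemma constant_rank_bounded_preimage:
  fixes A :: "real \<Rightarrow> complex mat"
  assumes carr: "\<And>t. t \<in> T \<Longrightarrow> A t \<in> carrier_mat N N"
    and cont: "\<And>i j. i < N \<Longrightarrow> j < N \<Longrightarrow> continuous_on T (\<lambda>t. A t $$ (i, j))"
    and rank: "\<And>t. t \<in> T \<Longrightarrow> vec_space.rank N (A t) = r" and t0: "t0 \<in> T"
  shows "\<exists>C\<ge>0. \<exists>\<delta>>0. \<forall>t\<in>T. dist t t0 < \<delta> \<longrightarrow> (\<forall>w. \<exists>w'.
     (\<forall>i<N. (\<Sum>j<N. A t $$ (i, j) * w' j) = (\<Sum>j<N. A t $$ (i, j) * w j)) \<and>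
     (\<Sum>j<N. norm (w' j)) \<le> C * (\<Sum>i<N. norm (\<Sum>j<N. A t $$ (i, j) * w j)))"
proof -
  obtain J where J: "J \<subseteq> {..<N}" "card J = r" "col_indep N (\<lambda>i j. A t0 $$ (i, j)) J"
    using ex_col_indep_card_rank[OF carr[OF t0]] rank[OF t0] by auto
  have fin: "finite J" using J finite_subset by blast
  obtain F where F: "\<And>i j. j \<in> J \<Longrightarrow> F i j = A t0 $$ (i, j)" "col_indep N F {..<N}"
    using col_indep_extend[OF J(1,3)] by blast
  obtain L where L: "\<And>x j. j < N \<Longrightarrow> x j = (\<Sum>i<N. L j i * (\<Sum>k<N. F i k * x k))"
    using col_indep_left_inverse[OF F(2)] by blast
  \<comment> \<open>\<open>K\<close> dominates the left inverse of the completed matrix at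
    \<open>t0\<close>, and so bounds the coefficients on J by the vector they produce. The summand 1
    makes it safe to divide by.\<close>
  define K where "K = 1 + (\<Sum>j<N. \<Sum>i<N. norm (L j i))"
  have K: "K \<ge> 1" unfolding K_def by (simp add: sum_nonneg)
  have base: "(\<Sum>j\<in>J. norm (x j)) \<le> K * (\<Sum>i<N. norm (\<Sum>j\<in>J. A t0 $$ (i, j) * x j))" for x :: "nat \<Rightarrow> complex"
  proof -
    let ?y = "\<lambda>i. \<Sum>j\<in>J. A t0 $$ (i, j) * x j"
    let ?s = "\<Sum>i<N. norm (?y i)"
    have "norm (x j) \<le> (\<Sum>i<N. norm (L j i)) * ?s" if j: "j \<in> J" for j
    proof -
      have "(\<Sum>k<N. F i k * (if k \<in> J then x k else 0)) = ?y i" for i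
        using J(1) F(1) by (intro sum.mono_neutral_cong_right) auto
      then have "x j = (\<Sum>i<N. L j i * ?y i)"
        using L[of j "\<lambda>k. if k \<in> J then x k else 0"] j J(1) by auto
      then have "norm (x j) \<le> (\<Sum>i<N. norm (L j i) * norm (?y i))"
        using norm_sum[of "\<lambda>i. L j i * ?y i" "{..<N}"] by (simp add: norm_mult)
      also have "\<dots> \<le> (\<Sum>i<N. norm (L j i) * ?s)"
        by (intro sum_mono mult_left_mono member_le_sum) auto
      finally show ?thesis by (simp add: sum_distrib_right)
    qed
    then have "(\<Sum>j\<in>J. norm (x j)) \<le> (\<Sum>j\<in>J. (\<Sum>i<N. norm (L j i)) * ?s)" by (rule sum_mono)
    also have "\<dots> = (\<Sum>j\<in>J. \<Sum>i<N. norm (L j i)) * ?s" by (simp add: sum_distrib_right)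
    also have "\<dots> \<le> K * ?s"
    proof (rule mult_right_mono)
      have "(\<Sum>j\<in>J. \<Sum>i<N. norm (L j i)) \<le> (\<Sum>j<N. \<Sum>i<N. norm (L j i))"
        using J(1) by (intro sum_mono2) (auto intro: sum_nonneg)
      then show "(\<Sum>j\<in>J. \<Sum>i<N. norm (L j i)) \<le> K" by (simp add: K_def)
    qed (simp add: sum_nonneg)
    finally show ?thesis .
  qed
  \<comment> \<open>Chosen so that K N e \<le> 1/2: changing each entry by at most e costs half of
    the left-hand side, which is absorbed and leaves the constant 2 K.\<close>
  define e where "e = 1 / (2 * K * (real N + 1))"
  have e: "e > 0" using K unfolding e_def by (intro divide_pos_pos mult_pos_pos) auto
  have "\<forall>i\<in>{..<N}. \<forall>j\<in>{..<N}. \<exists>d>0. \<forall>t\<in>T. dist t t0 < d \<longrightarrow> dist (A t $$ (i, j)) (A t0 $$ (i, j)) < e"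
    using cont t0 e unfolding continuous_on_iff by (metis lessThan_iff)
  then obtain d where d: "\<And>i j. i < N \<Longrightarrow> j < N \<Longrightarrow> d i j > 0"
    "\<And>i j t. i < N \<Longrightarrow> j < N \<Longrightarrow> t \<in> T \<Longrightarrow> dist t t0 < d i j \<Longrightarrow> dist (A t $$ (i, j)) (A t0 $$ (i, j)) < e"
    by (metis lessThan_iff)
  define \<delta> where "\<delta> = Min (insert 1 ((\<lambda>(i, j). d i j) ` ({..<N} \<times> {..<N})))"
  have \<delta>: "\<delta> > 0" unfolding \<delta>_def using d(1) by (subst Min_gr_iff) auto
  have \<delta>d: "\<delta> \<le> d i j" if "i < N" "j < N" for i j
    unfolding \<delta>_def using that by (intro Min_le) auto
  have main: "(\<Sum>j\<in>J. norm (x j)) \<le> 2 * K * (\<Sum>i<N. norm (\<Sum>j\<in>J. A t $$ (i, j) * x j))"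
    if t: "t \<in> T" "dist t t0 < \<delta>" for t and x :: "nat \<Rightarrow> complex"
  proof -
    let ?s = "\<Sum>j\<in>J. norm (x j)"
    have "norm (\<Sum>j\<in>J. A t0 $$ (i, j) * x j) \<le> norm (\<Sum>j\<in>J. A t $$ (i, j) * x j) + e * ?s" if i: "i < N" for i
    proof -
      have "(\<Sum>j\<in>J. A t0 $$ (i, j) * x j) = (\<Sum>j\<in>J. A t $$ (i, j) * x j) + (\<Sum>j\<in>J. (A t0 $$ (i, j) - A t $$ (i, j)) * x j)"
        by (simp add: sum_subtractf left_diff_distrib)
      moreover have "norm (\<Sum>j\<in>J. (A t0 $$ (i, j) - A t $$ (i, j)) * x j) \<le> (\<Sum>j\<in>J. e * norm (x j))"
      proof (rule sum_norm_le)
        fix j assume "j \<in> J"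
        then have j: "j < N" using J by auto
        have "dist (A t $$ (i, j)) (A t0 $$ (i, j)) < e"
          using d(2)[OF i j t(1)] \<delta>d[OF i j] t(2) by linarith
        then show "norm ((A t0 $$ (i, j) - A t $$ (i, j)) * x j) \<le> e * norm (x j)"
          by (auto simp: norm_mult dist_norm norm_minus_commute intro!: mult_right_mono)
      qed
      ultimately show ?thesis
        using norm_triangle_ineq[of "\<Sum>j\<in>J. A t $$ (i, j) * x j" "\<Sum>j\<in>J. (A t0 $$ (i, j) - A t $$ (i, j)) * x j"]
        by (simp add: sum_distrib_left)
    qed
    then have "(\<Sum>i<N. norm (\<Sum>j\<in>J. A t0 $$ (i, j) * x j)) \<le> (\<Sum>i<N. norm (\<Sum>j\<in>J. A t $$ (i, j) * x j) + e * ?s)"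
      by (intro sum_mono) auto
    also have "\<dots> = (\<Sum>i<N. norm (\<Sum>j\<in>J. A t $$ (i, j) * x j)) + real N * e * ?s"
      by (simp add: sum.distrib)
    finally have "K * (\<Sum>i<N. norm (\<Sum>j\<in>J. A t0 $$ (i, j) * x j))
       \<le> K * ((\<Sum>i<N. norm (\<Sum>j\<in>J. A t $$ (i, j) * x j)) + real N * e * ?s)"
      using K by (intro mult_left_mono) auto
    moreover have "K * (real N * e * ?s) \<le> ?s / 2"
    proof -
      have "K * (real N * e) = real N / (2 * (real N + 1))" unfolding e_def using K by simp
      also have "\<dots> \<le> 1 / 2" by (simp add: divide_simps)
      finally have "K * (real N * e) \<le> 1 / 2" .
      then have "K * (real N * e) * ?s \<le> 1 / 2 * ?s" by (intro mult_right_mono sum_nonneg) auto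
      then show ?thesis by (simp add: mult_ac)
    qed
    ultimately show ?thesis using base[of x] by (simp add: distrib_left)
  qed
  have "\<exists>w'. (\<forall>i<N. (\<Sum>j<N. A t $$ (i, j) * w' j) = (\<Sum>j<N. A t $$ (i, j) * w j)) \<and>
     (\<Sum>j<N. norm (w' j)) \<le> 2 * K * (\<Sum>i<N. norm (\<Sum>j<N. A t $$ (i, j) * w j))"
    if t: "t \<in> T" "dist t t0 < \<delta>" for t w
  proof -
    have ind: "col_indep N (\<lambda>i j. A t $$ (i, j)) J"
      unfolding col_indep_def
    proof (intro allI impI)
      fix x :: "nat \<Rightarrow> complex" assume "\<forall>i<N. (\<Sum>j\<in>J. A t $$ (i, j) * x j) = 0"
      then have "(\<Sum>j\<in>J. norm (x j)) \<le> 0" using main[OF t, of x] by simp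
      then have "(\<Sum>j\<in>J. norm (x j)) = 0" by (simp add: order_antisym sum_nonneg)
      then show "\<forall>j\<in>J. x j = 0" using fin by (simp add: sum_nonneg_eq_0_iff)
    qed
    \<comment> \<open>Here constancy of the rank acts: J is independent at t and has as many
      elements as the rank there, so its columns span the range of \<open>A t\<close> and not merely
      a part of it.\<close>
    obtain x where x: "\<And>i. i < N \<Longrightarrow> (\<Sum>j\<in>J. A t $$ (i, j) * x j) = (\<Sum>j<N. A t $$ (i, j) * w j)"
      using col_span_of_card_rank[OF carr[OF t(1)] J(1) ind] rank[OF t(1)] J(2) by blast
    let ?w' = "\<lambda>j. if j \<in> J then x j else 0"
    have "(\<Sum>j<N. A t $$ (i, j) * ?w' j) = (\<Sum>j<N. A t $$ (i, j) * w j)" if "i < N" for i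
    proof -
      have "(\<Sum>j<N. A t $$ (i, j) * ?w' j) = (\<Sum>j\<in>J. A t $$ (i, j) * x j)"
        using J(1) by (intro sum.mono_neutral_cong_right) auto
      then show ?thesis using x that by simp
    qed
    moreover have "(\<Sum>j<N. norm (?w' j)) \<le> 2 * K * (\<Sum>i<N. norm (\<Sum>j<N. A t $$ (i, j) * w j))"
    proof -
      have "(\<Sum>j<N. norm (?w' j)) = (\<Sum>j\<in>J. norm (x j))"
        using J(1) by (intro sum.mono_neutral_cong_right) auto
      then show ?thesis using main[OF t, of x] x by simp
    qed
    ultimately show ?thesis by (intro exI[of _ ?w'] conjI allI impI)
  qed
  then have "\<exists>\<delta>>0. \<forall>t\<in>T. dist t t0 < \<delta> \<longrightarrow> (\<forall>w. \<exists>w'.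
     (\<forall>i<N. (\<Sum>j<N. A t $$ (i, j) * w' j) = (\<Sum>j<N. A t $$ (i, j) * w j)) \<and>
     (\<Sum>j<N. norm (w' j)) \<le> 2 * K * (\<Sum>i<N. norm (\<Sum>j<N. A t $$ (i, j) * w j)))"
    using \<delta> by (intro exI[of _ \<delta>] conjI ballI impI allI)
  moreover have "2 * K \<ge> 0" using K by simp
  ultimately show ?thesis by (rule exI[of _ "2 * K", OF conjI[rotated]])
qed

section \<open>Interpolation inequalities\<close>

lemma young_ineq: "(0::real) < e \<Longrightarrow> 2 * (u * v) \<le> e * v\<^sup>2 + u\<^sup>2 / e"
proof -
  assume e: "0 < e"
  have "0 \<le> (u - e * v)\<^sup>2" by simp
  then have "2 * e * (u * v) \<le> e * (e * v\<^sup>2) + u\<^sup>2" by (simp add: power2_eq_square algebra_simps)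
  then have "2 * e * (u * v) / e \<le> (e * (e * v\<^sup>2) + u\<^sup>2) / e" using e by (intro divide_right_mono) auto
  then show ?thesis using e by (simp add: add_divide_distrib)
qed

text \<open>The derivative of |f|^2 is at most 2 |f| |f'|, which is split by Young's inequality.
  Hence |f(x)|^2 exceeds |f(t)|^2 by at most H for every t, and averaging over t gives the term 1 /
  (b - a).\<close>

lemma norm_sq_le_integral:
  fixes f f' :: "real \<Rightarrow> complex"
  assumes ab: "a < b" and e: "e > 0"
    and d: "\<And>x. x \<in> {a..b} \<Longrightarrow> (f has_vector_derivative f' x) (at x within {a..b})"
    and c: "continuous_on {a..b} f'" and x: "x \<in> {a..b}"
  shows "(norm (f x))\<^sup>2 \<le> e * integral {a..b} (\<lambda>t. (norm (f' t))\<^sup>2)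
    + (1 / e + 1 / (b - a)) * integral {a..b} (\<lambda>t. (norm (f t))\<^sup>2)"
proof -
  have cf: "continuous_on {a..b} f" using d by (rule continuous_on_vector_derivative)
  let ?\<phi> = "\<lambda>t. (norm (f t))\<^sup>2"
  let ?h = "\<lambda>t. e * (norm (f' t))\<^sup>2 + (norm (f t))\<^sup>2 / e"
  have hi: "?h integrable_on {a..b}"
    using e by (intro integrable_continuous_interval continuous_intros cf c) auto
  define H where "H = integral {a..b} ?h"
  have dphi: "(?\<phi> has_vector_derivative (f t \<bullet> f' t + f' t \<bullet> f t)) (at t within {a..b})" if "t \<in> {a..b}" for t
    unfolding power2_norm_eq_inner
    by (intro bounded_bilinear.has_vector_derivative[OF bounded_bilinear_inner] d that)
  have step: "\<bar>?\<phi> v - ?\<phi> u\<bar> \<le> H" if uv: "a \<le> u" "u \<le> v" "v \<le> b" for u v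
  proof -
    have "((\<lambda>t. f t \<bullet> f' t + f' t \<bullet> f t) has_integral ?\<phi> v - ?\<phi> u) {u..v}"
    proof (rule fundamental_theorem_of_calculus[OF uv(2)])
      fix t assume "t \<in> {u..v}"
      then have "t \<in> {a..b}" using uv by auto
      from dphi[OF this] show "(?\<phi> has_vector_derivative (f t \<bullet> f' t + f' t \<bullet> f t)) (at t within {u..v})"
        by (rule has_vector_derivative_within_subset) (use uv in auto)
    qed
    then have eq: "?\<phi> v - ?\<phi> u = integral {u..v} (\<lambda>t. f t \<bullet> f' t + f' t \<bullet> f t)"
      and int: "(\<lambda>t. f t \<bullet> f' t + f' t \<bullet> f t) integrable_on {u..v}"
      by (simp_all add: integral_unique has_integral_integrable)
    have "norm (integral {u..v} (\<lambda>t. f t \<bullet> f' t + f' t \<bullet> f t)) \<le> integral {u..v} ?h"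
    proof (rule integral_norm_bound_integral[OF int])
      show "?h integrable_on {u..v}" using integrable_on_subinterval[OF hi] uv by auto
      fix t assume "t \<in> {u..v}"
      have "norm (f t \<bullet> f' t + f' t \<bullet> f t) = 2 * \<bar>f t \<bullet> f' t\<bar>" by (simp add: inner_commute)
      also have "\<dots> \<le> 2 * (norm (f t) * norm (f' t))" using Cauchy_Schwarz_ineq2[of "f t" "f' t"] by simp
      also have "\<dots> \<le> ?h t" by (rule young_ineq[OF e])
      finally show "norm (f t \<bullet> f' t + f' t \<bullet> f t) \<le> ?h t" .
    qed
    also have "\<dots> \<le> H" unfolding H_def
      using uv e by (intro integral_subset_le hi integrable_on_subinterval[OF hi]) auto
    finally show ?thesis unfolding eq by simp
  qed
  have le: "?\<phi> x \<le> ?\<phi> t + H" if "t \<in> {a..b}" for t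
    using step[of t x] step[of x t] x that by (cases "t \<le> x") auto
  have \<phi>i: "?\<phi> integrable_on {a..b}" by (intro integrable_continuous_interval continuous_intros cf)
  have f'i: "(\<lambda>t. (norm (f' t))\<^sup>2) integrable_on {a..b}" by (intro integrable_continuous_interval continuous_intros c)
  have "integral {a..b} (\<lambda>t. ?\<phi> x) \<le> integral {a..b} (\<lambda>t. ?\<phi> t + H)"
    using le by (intro integral_le integrable_add \<phi>i) auto
  then have "(b - a) * ?\<phi> x \<le> integral {a..b} ?\<phi> + (b - a) * H"
    using ab integral_add[OF \<phi>i integrable_const_ivl[of H a b]] by simp
  then have "?\<phi> x \<le> integral {a..b} ?\<phi> / (b - a) + H" using ab by (simp add: field_simps)
  also have "H = e * integral {a..b} (\<lambda>t. (norm (f' t))\<^sup>2) + integral {a..b} ?\<phi> / e"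
  proof -
    have "H = integral {a..b} (\<lambda>t. e * (norm (f' t))\<^sup>2) + integral {a..b} (\<lambda>t. (norm (f t))\<^sup>2 / e)"
      unfolding H_def using f'i \<phi>i by (intro integral_add integrable_on_mult_right integrable_on_divide)
    then show ?thesis by simp
  qed
  finally show ?thesis by (simp add: algebra_simps)
qed

text \<open>Partial integration writes the integral of |f'|^2 as boundary terms Re(f cnj f') minus
  the integral of Re(f cnj f''). The boundary values are estimated by
  \<open>norm_sq_le_integral\<close>, for f and for f', and what returns of the integral of |f'|^2
  is absorbed. \<open>K\<close> is chosen before the functions; this uniformity is what the bound on
  eigenvalues relies on.\<close>

lemma integral_deriv_interpolation:
  assumes ab: "a < b" and e: "e > 0"
  shows "\<exists>K\<ge>0. \<forall>f f' f'' :: real \<Rightarrow> complex.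
     (\<forall>x\<in>{a..b}. (f has_vector_derivative f' x) (at x within {a..b})) \<longrightarrow>
     (\<forall>x\<in>{a..b}. (f' has_vector_derivative f'' x) (at x within {a..b})) \<longrightarrow> continuous_on {a..b} f'' \<longrightarrow>
     integral {a..b} (\<lambda>t. (norm (f' t))\<^sup>2) \<le> e * integral {a..b} (\<lambda>t. (norm (f'' t))\<^sup>2)
        + K * integral {a..b} (\<lambda>t. (norm (f t))\<^sup>2)"
proof -
  define K1 where "K1 = 1 + 1 / (b - a)"
  have K1: "K1 \<ge> 1" using ab by (simp add: K1_def)
  \<comment> \<open>The bound e / 4 gives 3 \<delta> \<le> e for the integral of |f''|^2; the bound
    1 / (4 K1) gives 2 \<delta> K1 \<le> 1/2, which lets a first half of \<open>B\<close> be
    absorbed.\<close>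
  define \<delta> where "\<delta> = min (e / 4) (1 / (4 * K1))"
  have \<delta>: "\<delta> > 0" "\<delta> \<le> e / 4" "\<delta> * K1 \<le> 1 / 4"
  proof -
    show "\<delta> > 0" "\<delta> \<le> e / 4" using e K1 by (auto simp: \<delta>_def)
    have "\<delta> \<le> 1 / (4 * K1)" by (simp add: \<delta>_def)
    then have "\<delta> * K1 \<le> 1 / (4 * K1) * K1" using K1 by (intro mult_right_mono) auto
    then show "\<delta> * K1 \<le> 1 / 4" using K1 by simp
  qed
  \<comment> \<open>Then 2 \<eta> / \<delta> = 1/2, the second half of \<open>B\<close> to be
    absorbed. The estimate starts from 2 B, so one B remains on the left.\<close>
  define \<eta> where "\<eta> = \<delta> / 4"
  have \<eta>: "\<eta> > 0" using \<delta> by (simp add: \<eta>_def)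
  define K2 where "K2 = 1 / \<eta> + 1 / (b - a)"
  have K2: "K2 \<ge> 0" using \<eta> ab by (simp add: K2_def)
  define K where "K = 2 * (K2 / \<delta> + 1 / (2 * \<delta>))"
  have K: "K \<ge> 0" using K2 \<delta> by (simp add: K_def)
  have "integral {a..b} (\<lambda>t. (norm (f' t))\<^sup>2) \<le> e * integral {a..b} (\<lambda>t. (norm (f'' t))\<^sup>2)
        + K * integral {a..b} (\<lambda>t. (norm (f t))\<^sup>2)"
    if d: "\<forall>x\<in>{a..b}. (f has_vector_derivative f' x) (at x within {a..b})"
      and d': "\<forall>x\<in>{a..b}. (f' has_vector_derivative f'' x) (at x within {a..b})"
      and c'': "continuous_on {a..b} f''" for f f' f'' :: "real \<Rightarrow> complex"
  proof -
    have c: "continuous_on {a..b} f" using d by (intro continuous_on_vector_derivative) auto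
    have c': "continuous_on {a..b} f'" using d' by (intro continuous_on_vector_derivative) auto
    define A where "A = integral {a..b} (\<lambda>t. (norm (f t))\<^sup>2)"
    define B where "B = integral {a..b} (\<lambda>t. (norm (f' t))\<^sup>2)"
    define C where "C = integral {a..b} (\<lambda>t. (norm (f'' t))\<^sup>2)"
    have pos: "A \<ge> 0" "B \<ge> 0" "C \<ge> 0" unfolding A_def B_def C_def by (auto intro!: integral_nonneg integrable_continuous_interval continuous_intros c c' c'')
    have S0: "(norm (f x))\<^sup>2 \<le> \<eta> * B + K2 * A" if "x \<in> {a..b}" for x
      unfolding A_def B_def K2_def using d by (intro norm_sq_le_integral ab \<eta> c' that) auto
    have S1: "(norm (f' x))\<^sup>2 \<le> C + K1 * B" if "x \<in> {a..b}" for x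
      using norm_sq_le_integral[of a b 1 f' f'' x] ab d' c'' that by (simp add: B_def C_def K1_def)
    have end_bound: "2 * \<bar>f x \<bullet> f' x\<bar> \<le> \<delta> * (C + K1 * B) + (\<eta> * B + K2 * A) / \<delta>" if "x \<in> {a..b}" for x
    proof -
      have "2 * \<bar>f x \<bullet> f' x\<bar> \<le> 2 * (norm (f x) * norm (f' x))" using Cauchy_Schwarz_ineq2[of "f x" "f' x"] by simp
      also have "\<dots> \<le> \<delta> * (norm (f' x))\<^sup>2 + (norm (f x))\<^sup>2 / \<delta>" by (rule young_ineq[OF \<delta>(1)])
      also have "\<dots> \<le> \<delta> * (C + K1 * B) + (\<eta> * B + K2 * A) / \<delta>"
        using S0[OF that] S1[OF that] \<delta>(1) by (intro add_mono mult_left_mono divide_right_mono) auto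
      finally show ?thesis .
    qed
    have ftc: "((\<lambda>t. f t \<bullet> f'' t + f' t \<bullet> f' t) has_integral (f b \<bullet> f' b - f a \<bullet> f' a)) {a..b}"
    proof (rule fundamental_theorem_of_calculus)
      fix x assume x: "x \<in> {a..b}"
      show "((\<lambda>t. f t \<bullet> f' t) has_vector_derivative (f x \<bullet> f'' x + f' x \<bullet> f' x)) (at x within {a..b})"
        using d d' x by (intro bounded_bilinear.has_vector_derivative[OF bounded_bilinear_inner]) auto
    qed (use ab in simp)
    have i1: "(\<lambda>t. f t \<bullet> f'' t) integrable_on {a..b}" by (intro integrable_continuous_interval continuous_intros c c'')
    have i2: "(\<lambda>t. f' t \<bullet> f' t) integrable_on {a..b}" by (intro integrable_continuous_interval continuous_intros c')
    have i3: "(\<lambda>t. \<delta> * (norm (f'' t))\<^sup>2 + (norm (f t))\<^sup>2 / \<delta>) integrable_on {a..b}"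
      using \<delta> by (intro integrable_continuous_interval continuous_intros c c'') auto
    have Beq: "f b \<bullet> f' b - f a \<bullet> f' a = integral {a..b} (\<lambda>t. f t \<bullet> f'' t) + B"
      using integral_unique[OF ftc] integral_add[OF i1 i2] by (simp add: B_def power2_norm_eq_inner)
    have "norm (integral {a..b} (\<lambda>t. 2 * (f t \<bullet> f'' t))) \<le> integral {a..b} (\<lambda>t. \<delta> * (norm (f'' t))\<^sup>2 + (norm (f t))\<^sup>2 / \<delta>)"
    proof (rule integral_norm_bound_integral)
      show "(\<lambda>t. 2 * (f t \<bullet> f'' t)) integrable_on {a..b}" using i1 by (rule integrable_on_mult_right)
      fix t
      have "norm (2 * (f t \<bullet> f'' t)) \<le> 2 * (norm (f t) * norm (f'' t))" using Cauchy_Schwarz_ineq2[of "f t" "f'' t"] by simp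
      also have "\<dots> \<le> \<delta> * (norm (f'' t))\<^sup>2 + (norm (f t))\<^sup>2 / \<delta>" by (rule young_ineq[OF \<delta>(1)])
      finally show "norm (2 * (f t \<bullet> f'' t)) \<le> \<delta> * (norm (f'' t))\<^sup>2 + (norm (f t))\<^sup>2 / \<delta>" .
    qed (rule i3)
    also have "\<dots> = \<delta> * C + A / \<delta>"
    proof -
      have "integral {a..b} (\<lambda>t. \<delta> * (norm (f'' t))\<^sup>2 + (norm (f t))\<^sup>2 / \<delta>)
        = integral {a..b} (\<lambda>t. \<delta> * (norm (f'' t))\<^sup>2) + integral {a..b} (\<lambda>t. (norm (f t))\<^sup>2 / \<delta>)"
        using \<delta> by (intro integral_add integrable_continuous_interval continuous_intros c c'') auto
      then show ?thesis by (simp add: A_def C_def)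
    qed
    finally have half: "2 * \<bar>integral {a..b} (\<lambda>t. f t \<bullet> f'' t)\<bar> \<le> \<delta> * C + A / \<delta>" by simp
    define X where "X = \<delta> * (C + K1 * B) + (\<eta> * B + K2 * A) / \<delta>"
    have "2 * \<bar>f a \<bullet> f' a\<bar> \<le> X" "2 * \<bar>f b \<bullet> f' b\<bar> \<le> X"
      unfolding X_def using end_bound[of a] end_bound[of b] ab by simp_all
    then have "2 * B \<le> 2 * X + (\<delta> * C + A / \<delta>)"
      using half Beq by linarith
    then have "2 * B \<le> 2 * (\<delta> * (C + K1 * B) + (\<eta> * B + K2 * A) / \<delta>) + (\<delta> * C + A / \<delta>)"
      by (simp only: X_def)
    also have "\<dots> = 3 * \<delta> * C + 2 * (\<delta> * K1) * B + B / 2 + K * A"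
      using \<delta>(1) by (simp add: \<eta>_def K_def field_simps)
    finally have 1: "2 * B \<le> 3 * \<delta> * C + 2 * (\<delta> * K1) * B + B / 2 + K * A" .
    have 2: "2 * (\<delta> * K1) * B \<le> 1 / 2 * B" using \<delta>(3) pos by (intro mult_right_mono) auto
    have 3: "3 * \<delta> * C \<le> e * C" using \<delta>(2) e pos by (intro mult_right_mono) auto
    have "B \<le> e * C + K * A" using 1 2 3 by linarith
    then show ?thesis by (simp add: A_def B_def C_def)
  qed
  then show ?thesis using K by (intro exI[of _ K] conjI allI impI)
qed

text \<open>A chain f 0, ..., f n of successive derivatives, stated for families and not through
  \<open>nder\<close>, because it is applied to components of a solution with Y n / q 0 in the top
  place.\<close>

definition deriv_chain :: "nat \<Rightarrow> real \<Rightarrow> real \<Rightarrow> (nat \<Rightarrow> real \<Rightarrow> complex) \<Rightarrow> bool" where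
  "deriv_chain n a b f \<longleftrightarrow> (\<forall>j<n. \<forall>x\<in>{a..b}. (f j has_vector_derivative f (Suc j) x) (at x within {a..b}))
     \<and> continuous_on {a..b} (f n)"

abbreviation sqint :: "real \<Rightarrow> real \<Rightarrow> (real \<Rightarrow> complex) \<Rightarrow> real" where
  "sqint a b f \<equiv> integral {a..b} (\<lambda>t. (norm (f t))\<^sup>2)"

lemma deriv_chain_continuous:
  assumes "deriv_chain n a b f" "j \<le> n" shows "continuous_on {a..b} (f j)"
proof (cases "j = n")
  case True then show ?thesis using assms by (simp add: deriv_chain_def)
next
  case False
  then show ?thesis using assms
    by (intro continuous_on_vector_derivative[where f' = "f (Suc j)"]) (auto simp: deriv_chain_def)
qed

lemma sqint_nonneg: "continuous_on {a..b} f \<Longrightarrow> sqint a b f \<ge> 0"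
  by (intro integral_nonneg integrable_continuous_interval continuous_intros) auto

lemma deriv_chain_nonneg: "deriv_chain n a b f \<Longrightarrow> j \<le> n \<Longrightarrow> sqint a b (f j) \<ge> 0"
  by (intro sqint_nonneg deriv_chain_continuous)

text \<open>The interpolation inequality bounds f (j + 1) by f (j + 2) and f j; the induction
  hypothesis returns f j to f (j + 1) with the small factor \<open>e2\<close>. As K' e2 \<le> 1/2,
  half of the left-hand side is absorbed.\<close>

lemma deriv_chain_step:
  assumes ab: "a < b"
  shows "e > 0 \<Longrightarrow> j < n \<Longrightarrow> \<exists>K\<ge>0. \<forall>f. deriv_chain n a b f \<longrightarrow> sqint a b (f j) \<le> e * sqint a b (f (Suc j)) + K * sqint a b (f 0)"
proof (induction j arbitrary: e)
  case 0
  have "sqint a b (f 0) \<le> e * sqint a b (f (Suc 0)) + 1 * sqint a b (f 0)" if "deriv_chain n a b f" for f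
    using deriv_chain_nonneg[OF that, of "Suc 0"] 0 by simp
  then show ?case by (intro exI[of _ 1] conjI allI impI) auto
next
  case (Suc j)
  obtain K' where K': "K' \<ge> 0" "\<And>f f' f'' :: real \<Rightarrow> complex.
     \<forall>x\<in>{a..b}. (f has_vector_derivative f' x) (at x within {a..b}) \<Longrightarrow>
     \<forall>x\<in>{a..b}. (f' has_vector_derivative f'' x) (at x within {a..b}) \<Longrightarrow> continuous_on {a..b} f'' \<Longrightarrow>
     sqint a b f' \<le> e / 2 * sqint a b f'' + K' * sqint a b f"
    using integral_deriv_interpolation[OF ab, of "e / 2"] Suc.prems(1) by (auto simp del: divide_const_simps)
  define e2 where "e2 = 1 / (2 * K' + 2)"
  have e2: "e2 > 0" "K' * e2 \<le> 1 / 2" using K'(1) by (auto simp: e2_def field_simps)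
  obtain K2 where K2: "K2 \<ge> 0" "\<forall>f. deriv_chain n a b f \<longrightarrow> sqint a b (f j) \<le> e2 * sqint a b (f (Suc j)) + K2 * sqint a b (f 0)"
    using Suc.IH[OF e2(1) Suc_lessD[OF Suc.prems(2)]]
    by (elim exE conjE) (rule that, assumption, assumption)
  have "sqint a b (f (Suc j)) \<le> e * sqint a b (f (Suc (Suc j))) + (2 * K' * K2) * sqint a b (f 0)" if f: "deriv_chain n a b f" for f
  proof -
    have 1: "sqint a b (f (Suc j)) \<le> e / 2 * sqint a b (f (Suc (Suc j))) + K' * sqint a b (f j)"
      using f Suc.prems by (intro K'(2) deriv_chain_continuous[OF f]) (auto simp: deriv_chain_def)
    have "K' * sqint a b (f j) \<le> K' * (e2 * sqint a b (f (Suc j)) + K2 * sqint a b (f 0))"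
      using K2(2)[rule_format, OF f] K'(1) by (rule mult_left_mono)
    also have "\<dots> = (K' * e2) * sqint a b (f (Suc j)) + K' * K2 * sqint a b (f 0)" by (simp add: algebra_simps)
    also have "(K' * e2) * sqint a b (f (Suc j)) \<le> 1 / 2 * sqint a b (f (Suc j))"
      using deriv_chain_nonneg[OF f, of "Suc j"] Suc.prems by (intro mult_right_mono e2) auto
    finally show ?thesis using 1 by simp
  qed
  then show ?case using K'(1) K2(1) by (intro exI[of _ "2 * K' * K2"] conjI allI impI) auto
qed

lemma deriv_chain_interpolation:
  assumes ab: "a < b"
  shows "j < m \<Longrightarrow> m \<le> n \<Longrightarrow> e > 0 \<Longrightarrow> \<exists>K\<ge>0. \<forall>f. deriv_chain n a b f \<longrightarrow> sqint a b (f j) \<le> e * sqint a b (f m) + K * sqint a b (f 0)"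
proof (induction m arbitrary: e)
  case 0 then show ?case by simp
next
  case (Suc m)
  show ?case
  proof (cases "j = m")
    case True
    then show ?thesis using deriv_chain_step[OF ab Suc.prems(3), of m n] Suc.prems by simp
  next
    case False
    then have jm: "j < m" "m \<le> n" "m < n" using Suc.prems by auto
    have pos1: "(0::real) < 1" by simp
    obtain K1 where K1: "K1 \<ge> 0" "\<forall>f. deriv_chain n a b f \<longrightarrow> sqint a b (f j) \<le> 1 * sqint a b (f m) + K1 * sqint a b (f 0)"
      using Suc.IH[OF jm(1,2) pos1]
      by (elim exE conjE) (rule that, assumption, assumption)
    obtain K2 where K2: "K2 \<ge> 0" "\<forall>f. deriv_chain n a b f \<longrightarrow> sqint a b (f m) \<le> e * sqint a b (f (Suc m)) + K2 * sqint a b (f 0)"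
      using deriv_chain_step[OF ab Suc.prems(3) jm(3)]
      by (elim exE conjE) (rule that, assumption, assumption)
    have "sqint a b (f j) \<le> e * sqint a b (f (Suc m)) + (K1 + K2) * sqint a b (f 0)" if "deriv_chain n a b f" for f
      using K1(2)[rule_format, OF that] K2(2)[rule_format, OF that] by (simp add: distrib_right)
    then show ?thesis using K1(1) K2(1) by (intro exI[of _ "K1 + K2"] conjI allI impI) auto
  qed
qed

text \<open>An Ehrling inequality: every derivative below the top, in mean square and at each point,
  costs an arbitrarily small part of the top one plus a multiple of the function. The pointwise
  bound for f j needs the next derivative f (j + 1), which may be the top one itself; hence the
  bound with factor 1 for it.\<close>

lemma deriv_chain_bounds:
  assumes ab: "a < b" and e: "e > 0"
  shows "\<exists>K\<ge>0. \<forall>f. deriv_chain n a b f \<longrightarrow> (\<forall>j<n. \<forall>x\<in>{a..b}.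
     sqint a b (f j) \<le> e * sqint a b (f n) + K * sqint a b (f 0) \<and>
     (norm (f j x))\<^sup>2 \<le> e * sqint a b (f n) + K * sqint a b (f 0))"
proof -
  define Ks where "Ks = 1 / (e / 2) + 1 / (b - a)"
  have Ks: "Ks \<ge> 0" using e ab by (simp add: Ks_def)
  define e2 where "e2 = min e (e / (2 * (Ks + 1)))"
  have e2: "e2 > 0" "e2 \<le> e" "Ks * e2 \<le> e / 2"
  proof -
    show "e2 > 0" "e2 \<le> e" using e Ks by (auto simp: e2_def)
    have "Ks * e2 \<le> Ks * (e / (2 * (Ks + 1)))" using Ks by (intro mult_left_mono) (auto simp: e2_def)
    also have "\<dots> \<le> e / 2" using Ks e by (simp add: field_simps)
    finally show "Ks * e2 \<le> e / 2" .
  qed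
  have "\<exists>K\<ge>0. \<forall>f. deriv_chain n a b f \<longrightarrow> (\<forall>x\<in>{a..b}.
     sqint a b (f j) \<le> e * sqint a b (f n) + K * sqint a b (f 0) \<and>
     (norm (f j x))\<^sup>2 \<le> e * sqint a b (f n) + K * sqint a b (f 0))" if j: "j < n" for j
  proof -
    obtain K1 where K1: "K1 \<ge> 0" "\<forall>f. deriv_chain n a b f \<longrightarrow> sqint a b (f j) \<le> e2 * sqint a b (f n) + K1 * sqint a b (f 0)"
      using deriv_chain_interpolation[OF ab j order_refl e2(1)]
      by (elim exE conjE) (rule that, assumption, assumption)
    have "\<exists>K\<ge>0. \<forall>f. deriv_chain n a b f \<longrightarrow> sqint a b (f (Suc j)) \<le> 1 * sqint a b (f n) + K * sqint a b (f 0)"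
    proof (cases "Suc j = n")
      case True
      then show ?thesis by (intro exI[of _ 0]) simp
    next
      case False
      then show ?thesis using deriv_chain_interpolation[OF ab, of "Suc j" n n 1] j by simp
    qed
    then obtain K2 where K2: "K2 \<ge> 0" "\<forall>f. deriv_chain n a b f \<longrightarrow> sqint a b (f (Suc j)) \<le> 1 * sqint a b (f n) + K2 * sqint a b (f 0)"
      by (elim exE conjE) (rule that, assumption, assumption)
    define K where "K = K1 + e / 2 * K2 + Ks * K1"
    have K: "K \<ge> K1" "K \<ge> e / 2 * K2 + Ks * K1" "K \<ge> 0" using K1(1) K2(1) Ks e by (auto simp: K_def)
    have "sqint a b (f j) \<le> e * sqint a b (f n) + K * sqint a b (f 0) \<and>
     (norm (f j x))\<^sup>2 \<le> e * sqint a b (f n) + K * sqint a b (f 0)"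
      if f: "deriv_chain n a b f" and x: "x \<in> {a..b}" for f x
    proof
      have n0: "sqint a b (f n) \<ge> 0" "sqint a b (f 0) \<ge> 0" using deriv_chain_nonneg[OF f] by auto
      have "e2 * sqint a b (f n) \<le> e * sqint a b (f n)" "K1 * sqint a b (f 0) \<le> K * sqint a b (f 0)"
        using n0 e2 K by (auto intro!: mult_right_mono)
      then show "sqint a b (f j) \<le> e * sqint a b (f n) + K * sqint a b (f 0)" using K1(2)[rule_format, OF f] by linarith
      have "(norm (f j x))\<^sup>2 \<le> e / 2 * sqint a b (f (Suc j)) + Ks * sqint a b (f j)"
        unfolding Ks_def using f j e by (intro norm_sq_le_integral ab x deriv_chain_continuous[OF f]) (auto simp: deriv_chain_def)
      also have "\<dots> \<le> e / 2 * (1 * sqint a b (f n) + K2 * sqint a b (f 0)) + Ks * (e2 * sqint a b (f n) + K1 * sqint a b (f 0))"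
        using K1(2)[rule_format, OF f] K2(2)[rule_format, OF f] Ks e by (intro add_mono mult_left_mono) auto
      also have "\<dots> = e / 2 * sqint a b (f n) + (Ks * e2) * sqint a b (f n) + (e / 2 * K2 + Ks * K1) * sqint a b (f 0)"
        by (simp add: algebra_simps)
      also have "\<dots> \<le> e / 2 * sqint a b (f n) + e / 2 * sqint a b (f n) + K * sqint a b (f 0)"
        using n0 e2(3) K(2) by (intro add_mono mult_right_mono) auto
      finally show "(norm (f j x))\<^sup>2 \<le> e * sqint a b (f n) + K * sqint a b (f 0)" by simp
    qed
    then show ?thesis using K(3) by (intro exI[of _ K] conjI allI impI ballI) auto
  qed
  then obtain k where k: "\<And>j. j < n \<Longrightarrow> k j \<ge> 0" "\<And>j f x. j < n \<Longrightarrow> deriv_chain n a b f \<Longrightarrow> x \<in> {a..b} \<Longrightarrow>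
     sqint a b (f j) \<le> e * sqint a b (f n) + k j * sqint a b (f 0) \<and>
     (norm (f j x))\<^sup>2 \<le> e * sqint a b (f n) + k j * sqint a b (f 0)" by metis
  have kj: "k j \<le> (\<Sum>i<n. k i)" if "j < n" for j using that k(1) by (intro member_le_sum) auto
  have "sqint a b (f j) \<le> e * sqint a b (f n) + (\<Sum>i<n. k i) * sqint a b (f 0) \<and>
     (norm (f j x))\<^sup>2 \<le> e * sqint a b (f n) + (\<Sum>i<n. k i) * sqint a b (f 0)"
     if "j < n" "deriv_chain n a b f" "x \<in> {a..b}" for f j x
  proof -
    have "k j * sqint a b (f 0) \<le> (\<Sum>i<n. k i) * sqint a b (f 0)"
      using kj[OF that(1)] deriv_chain_nonneg[OF that(2)] by (intro mult_right_mono) auto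
    then show ?thesis using k(2)[OF that] by linarith
  qed
  moreover have "(\<Sum>i<n. k i) \<ge> 0" using k(1) by (intro sum_nonneg) auto
  ultimately show ?thesis by (intro exI[of _ "\<Sum>i<n. k i"] conjI allI impI ballI) auto
qed

section \<open>Energy identity and lower bound for the eigenvalues\<close>

lemma sum_lessThan_add: "(\<Sum>i<n + (m::nat). f i) = (\<Sum>i<n. f i) + (\<Sum>i<m. f (n + i))"
  for f :: "nat \<Rightarrow> 'a::comm_monoid_add"
  by (induction m) (simp_all add: add.assoc)

definition lagrange_form :: "nat \<Rightarrow> (nat \<Rightarrow> real \<Rightarrow> complex) \<Rightarrow> real \<Rightarrow> complex" where
  "lagrange_form n Y x = (\<Sum>j<n. Y (2 * n - 1 - j) x * cnj (Y j x))"

text \<open>The density of the quadratic form of S(l), the sum of p_k |y^(n-k)|^2 over k \<le> n.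
  Its term with k = 0 is written with y^[n] = p_0 y^(n), as y^(n) is not a component of the
  system.\<close>

definition energy_density :: "nat \<Rightarrow> (nat \<Rightarrow> real \<Rightarrow> real) \<Rightarrow> (nat \<Rightarrow> real \<Rightarrow> complex) \<Rightarrow> real \<Rightarrow> real" where
  "energy_density n q Y x = (\<Sum>j<n. q (n - j) x * (norm (Y j x))\<^sup>2) + (norm (Y n x))\<^sup>2 / q 0 x"

definition boundary_pairing :: "nat \<Rightarrow> real \<Rightarrow> real \<Rightarrow> (nat \<Rightarrow> real \<Rightarrow> complex) \<Rightarrow> complex" where
  "boundary_pairing n a b Y = (\<Sum>i<2 * n. vec_index (bcheck n a b Y) i * cnj (vec_index (bhat n a b Y) i))"

text \<open>The minus signs at b in y^vee are what turns the scalar product of the two boundary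
  vectors into a difference of values at a and b.\<close>

lemma boundary_pairing_eq: "boundary_pairing n a b Y = lagrange_form n Y a - lagrange_form n Y b"
proof -
  have "boundary_pairing n a b Y = (\<Sum>i<n + n. vec_index (bcheck n a b Y) i * cnj (vec_index (bhat n a b Y) i))"
    by (simp add: boundary_pairing_def mult_2)
  also have "\<dots> = (\<Sum>i<n. vec_index (bcheck n a b Y) i * cnj (vec_index (bhat n a b Y) i))
     + (\<Sum>i<n. vec_index (bcheck n a b Y) (n + i) * cnj (vec_index (bhat n a b Y) (n + i)))"
    by (rule sum_lessThan_add)
  also have "\<dots> = lagrange_form n Y a + (\<Sum>i<n. - (Y (2 * n - 1 - i) b * cnj (Y i b)))"
    unfolding lagrange_form_def by (intro arg_cong2[where f = "(+)"] sum.cong) (auto simp: bcheck_def bhat_def)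
  finally show ?thesis by (simp add: lagrange_form_def sum_negf)
qed

text \<open>When the rows of the system are inserted, the mixed products Y (2n-1-j) cnj (Y (j+1))
  arise twice with opposite signs (\<open>S1\<close> and \<open>S2\<close>). Only the squares
  survive.\<close>

lemma lagrange_form_has_derivative:
  assumes n: "n \<ge> 1" and sol: "linsol (2 * n) (sysmat n q \<mu>) a b Y" and x: "x \<in> {a..b}"
  shows "(lagrange_form n Y has_vector_derivative
     of_real (energy_density n q Y x) - \<mu> * of_real ((norm (Y 0 x))\<^sup>2)) (at x within {a..b})"
proof -
  define r where "r = (\<lambda>i. sysrhs n q \<mu> Y i x)"
  have d: "(Y i has_vector_derivative r i) (at x within {a..b})" if "i < 2 * n" for i
    using sol x that unfolding linsol_sysmat_iff[OF n] r_def by blast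
  have "(lagrange_form n Y has_vector_derivative
     (\<Sum>j<n. Y (2 * n - 1 - j) x * cnj (r j) + r (2 * n - 1 - j) * cnj (Y j x))) (at x within {a..b})"
    unfolding lagrange_form_def
    by (intro has_vector_derivative_sum has_vector_derivative_mult d
        bounded_linear.has_vector_derivative[OF bounded_linear_cnj]) auto
  moreover have "(\<Sum>j<n. Y (2 * n - 1 - j) x * cnj (r j) + r (2 * n - 1 - j) * cnj (Y j x))
      = of_real (energy_density n q Y x) - \<mu> * of_real ((norm (Y 0 x))\<^sup>2)"
  proof -
    obtain m where m: "n = Suc m" using n by (cases n) auto
    have r1: "r j = Y (Suc j) x" if "j < m" for j using that m by (simp add: r_def sysrhs_def)
    have r2: "r m = Y n x / of_real (q 0 x)" using m by (simp add: r_def sysrhs_def)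
    have r3: "r (2 * n - 1 - j) = of_real (q (n - j) x) * Y j x - (if j = 0 then \<mu> * Y 0 x else Y (2 * n - j) x)"
      if "j < n" for j
    proof -
      have *: "\<not> 2 * n - 1 - j + 1 < n" "2 * n - 1 - j + 1 \<noteq> n" "2 * n - 1 - j + 1 - n = n - j"
        "2 * n - 1 - (2 * n - 1 - j) = j" "2 * n - 1 - j + 1 < 2 * n \<longleftrightarrow> j \<noteq> 0" "2 * n - 1 - j + 1 = 2 * n - j"
        using that by auto
      show ?thesis unfolding r_def sysrhs_def * using * by auto
    qed
    have S1: "(\<Sum>j<n. Y (2 * n - 1 - j) x * cnj (r j)) = (\<Sum>j<m. Y (2 * n - 1 - j) x * cnj (Y (Suc j) x)) + Y n x * cnj (Y n x) / of_real (q 0 x)"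
    proof -
      have "(\<Sum>j<n. Y (2 * n - 1 - j) x * cnj (r j)) = (\<Sum>j<m. Y (2 * n - 1 - j) x * cnj (r j)) + Y (2 * n - 1 - m) x * cnj (r m)"
        using m by simp
      moreover have "2 * n - 1 - m = n" using m by simp
      ultimately show ?thesis using r1 r2 by simp
    qed
    have S2: "(\<Sum>j<n. (if j = 0 then \<mu> * Y 0 x else Y (2 * n - j) x) * cnj (Y j x))
       = \<mu> * Y 0 x * cnj (Y 0 x) + (\<Sum>j<m. Y (2 * n - 1 - j) x * cnj (Y (Suc j) x))"
      unfolding m by (subst sum.lessThan_Suc_shift) simp
    have "(\<Sum>j<n. r (2 * n - 1 - j) * cnj (Y j x)) = (\<Sum>j<n. of_real (q (n - j) x) * (Y j x * cnj (Y j x))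
        - (if j = 0 then \<mu> * Y 0 x else Y (2 * n - j) x) * cnj (Y j x))"
      using r3 by (intro sum.cong) (auto simp: left_diff_distrib mult.assoc)
    also have "\<dots> = (\<Sum>j<n. of_real (q (n - j) x) * (Y j x * cnj (Y j x)))
        - (\<Sum>j<n. (if j = 0 then \<mu> * Y 0 x else Y (2 * n - j) x) * cnj (Y j x))" by (rule sum_subtractf)
    finally have "(\<Sum>j<n. Y (2 * n - 1 - j) x * cnj (r j) + r (2 * n - 1 - j) * cnj (Y j x))
       = (\<Sum>j<n. of_real (q (n - j) x) * (Y j x * cnj (Y j x))) + Y n x * cnj (Y n x) / of_real (q 0 x) - \<mu> * (Y 0 x * cnj (Y 0 x))"
      unfolding sum.distrib S1 S2 by (simp add: mult.assoc)
    then show ?thesis by (simp add: energy_density_def complex_norm_square[symmetric] del: of_real_power)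
  qed
  ultimately show ?thesis by simp
qed

lemma energy_density_continuous:
  assumes n: "n \<ge> 1" and qc: "\<And>k. k \<le> n \<Longrightarrow> continuous_on {a..b} (q k)" and q0: "\<And>x. x \<in> {a..b} \<Longrightarrow> q 0 x > 0"
    and Yc: "\<And>i. i < 2 * n \<Longrightarrow> continuous_on {a..b} (Y i)"
  shows "continuous_on {a..b} (energy_density n q Y)"
  unfolding energy_density_def
proof (intro continuous_intros qc Yc ballI)
  fix x assume "x \<in> {a..b}" then show "q 0 x \<noteq> 0" using q0[of x] by simp
qed (use n in auto)

text \<open>Green's identity of y with itself. \<mu> may be complex and no boundary condition is
  assumed, which is what allows it to be used off the spectrum.\<close>

lemma energy_identity:
  assumes n: "n \<ge> 1" and ab: "a < b" and qc: "\<And>k. k \<le> n \<Longrightarrow> continuous_on {a..b} (q k)"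
    and q0: "\<And>x. x \<in> {a..b} \<Longrightarrow> q 0 x > 0" and sol: "linsol (2 * n) (sysmat n q \<mu>) a b Y"
  shows "boundary_pairing n a b Y = \<mu> * of_real (sqint a b (Y 0)) - of_real (integral {a..b} (energy_density n q Y))"
proof -
  have Yc: "continuous_on {a..b} (Y i)" if "i < 2 * n" for i using linsol_continuous[OF sol that] .
  have e: "energy_density n q Y integrable_on {a..b}"
    by (intro integrable_continuous_interval energy_density_continuous n qc q0 Yc)
  have s: "(\<lambda>t. (norm (Y 0 t))\<^sup>2) integrable_on {a..b}"
    using n by (intro integrable_continuous_interval continuous_intros Yc) auto
  have "((\<lambda>x. of_real (energy_density n q Y x) - \<mu> * of_real ((norm (Y 0 x))\<^sup>2)) has_integral
      lagrange_form n Y b - lagrange_form n Y a) {a..b}"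
    using ab lagrange_form_has_derivative[OF n sol] by (intro fundamental_theorem_of_calculus) auto
  moreover have "((\<lambda>x. of_real (energy_density n q Y x) - \<mu> * of_real ((norm (Y 0 x))\<^sup>2)) has_integral
      of_real (integral {a..b} (energy_density n q Y)) - \<mu> * of_real (sqint a b (Y 0))) {a..b}"
    by (intro has_integral_diff has_integral_mult_right has_integral_of_real integrable_integral e s)
  ultimately have "lagrange_form n Y b - lagrange_form n Y a
     = of_real (integral {a..b} (energy_density n q Y)) - \<mu> * of_real (sqint a b (Y 0))"
    by (rule has_integral_unique)
  then show ?thesis unfolding boundary_pairing_eq by (simp add: algebra_simps)
qed

text \<open>If y = 0 then row j of the system expresses Y (j + 1) by the derivative of Y j and by
  components of lower index, so all components vanish one after another.\<close>

lemma linsol_zero_of_sqint_zero: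
  assumes n: "n \<ge> 1" and ab: "a < b" and q0: "\<And>x. x \<in> {a..b} \<Longrightarrow> q 0 x > 0"
    and sol: "linsol (2 * n) (sysmat n q \<mu>) a b Y" and z: "sqint a b (Y 0) = 0"
  shows "i < 2 * n \<Longrightarrow> x \<in> {a..b} \<Longrightarrow> Y i x = 0"
proof (induction i arbitrary: x rule: less_induct)
  case (less i)
  show ?case
  proof (cases i)
    case 0
    have "continuous_on {a..b} (\<lambda>t. (norm (Y 0 t))\<^sup>2)"
      using linsol_continuous[OF sol, of 0] n by (intro continuous_intros) auto
    then have "\<forall>x\<in>{a..b}. (norm (Y 0 x))\<^sup>2 = 0" using z integral_eq_0_iff[OF _ ab] by auto
    then show ?thesis using less.prems 0 by simp
  next
    case (Suc j)
    have j0: "Y j x = 0" if "x \<in> {a..b}" for x using less Suc that by simp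
    have "(Y j has_vector_derivative sysrhs n q \<mu> Y j x) (at x within {a..b})"
      using sol less.prems Suc unfolding linsol_sysmat_iff[OF n] by simp
    moreover have "(Y j has_vector_derivative 0) (at x within {a..b})"
      using has_vector_derivative_transform[OF less.prems(2) j0 has_vector_derivative_const] by simp
    ultimately have r0: "sysrhs n q \<mu> Y j x = 0"
      by (elim trans[OF nder_1I[OF ab less.prems(2), symmetric] nder_1I[OF ab less.prems(2)]])
    consider "j + 1 < n" | "j + 1 = n" | "j \<ge> n" by linarith
    then show ?thesis
    proof cases
      case 1 then show ?thesis using r0 Suc by (simp add: sysrhs_def)
    next
      case 2 then show ?thesis using r0 Suc q0[OF less.prems(2)] by (simp add: sysrhs_def)
    next
      case 3
      \<comment> \<open>For j \<ge> n the index 2n - 1 - j is below n, so it has been treated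
        before.\<close>
      have "Y (2 * n - 1 - j) x = 0" using less.IH[of "2 * n - 1 - j" x] less.prems Suc 3 by simp
      then show ?thesis using r0 Suc 3 less.prems by (simp add: sysrhs_def)
    qed
  qed
qed

section \<open>Boundary conditions in Cayley form\<close>

lemma unitary_isometry:
  fixes V :: "complex mat"
  assumes V: "V \<in> carrier_mat N N" and u: "V * mat_adjoint V = 1\<^sub>m N"
  shows "(\<Sum>i<N. (\<Sum>j<N. V $$ (i, j) * x j) * cnj (\<Sum>j<N. V $$ (i, j) * y j)) = (\<Sum>j<N. x j * cnj (y j))"
proof -
  have ac: "mat_adjoint V \<in> carrier_mat N N" using V by (auto simp: mat_adjoint_def)
  have ai: "mat_adjoint V $$ (i, j) = cnj (V $$ (j, i))" if "i < N" "j < N" for i j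
    using V that by (simp add: mat_adjoint_def mat_of_rows_index)
  have "mat_adjoint V * V = 1\<^sub>m N" by (rule mat_mult_left_right_inverse[OF V ac u])
  then have o: "(\<Sum>i<N. cnj (V $$ (i, k)) * V $$ (i, j)) = (if k = j then 1 else 0)" if "k < N" "j < N" for k j
  proof -
    assume a: "mat_adjoint V * V = 1\<^sub>m N"
    have "(mat_adjoint V * V) $$ (k, j) = (\<Sum>i<N. mat_adjoint V $$ (k, i) * V $$ (i, j))"
      using that V ac by (auto simp: scalar_prod_def atLeast0LessThan intro!: sum.cong)
    also have "\<dots> = (\<Sum>i<N. cnj (V $$ (i, k)) * V $$ (i, j))" using ai that by (intro sum.cong) auto
    finally show ?thesis using a that by simp
  qed
  have "(\<Sum>i<N. (\<Sum>j<N. V $$ (i, j) * x j) * cnj (\<Sum>k<N. V $$ (i, k) * y k))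
     = (\<Sum>i<N. \<Sum>j<N. \<Sum>k<N. (cnj (V $$ (i, k)) * V $$ (i, j)) * (x j * cnj (y k)))"
    by (simp add: sum_product cnj_sum mult_ac)
  also have "\<dots> = (\<Sum>j<N. \<Sum>k<N. \<Sum>i<N. (cnj (V $$ (i, k)) * V $$ (i, j)) * (x j * cnj (y k)))"
    by (rule trans[OF sum.swap], rule sum.cong[OF refl], rule sum.swap)
  also have "\<dots> = (\<Sum>j<N. \<Sum>k<N. (\<Sum>i<N. cnj (V $$ (i, k)) * V $$ (i, j)) * (x j * cnj (y k)))"
    by (simp only: sum_distrib_right)
  also have "\<dots> = (\<Sum>j<N. \<Sum>k<N. if k = j then x j * cnj (y k) else 0)"
    using o by (intro sum.cong refl) auto
  finally show ?thesis by simp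
qed

lemma unitary_norm:
  fixes V :: "complex mat"
  assumes V: "V \<in> carrier_mat N N" and u: "V * mat_adjoint V = 1\<^sub>m N"
  shows "(\<Sum>i<N. (norm (\<Sum>j<N. V $$ (i, j) * x j))\<^sup>2) = (\<Sum>j<N. (norm (x j))\<^sup>2)"
proof -
  have "complex_of_real (\<Sum>i<N. (norm (\<Sum>j<N. V $$ (i, j) * x j))\<^sup>2) = of_real (\<Sum>j<N. (norm (x j))\<^sup>2)"
    using unitary_isometry[OF V u, of x x] by (simp only: of_real_sum complex_norm_square)
  then show ?thesis by (simp only: of_real_eq_iff)
qed

definition bc_defect :: "nat \<Rightarrow> real \<Rightarrow> real \<Rightarrow> complex mat \<Rightarrow> (nat \<Rightarrow> real \<Rightarrow> complex) \<Rightarrow> complex Matrix.vec" where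
  "bc_defect n a b V Y = (V - 1\<^sub>m (2 * n)) *\<^sub>v bcheck n a b Y + (\<i> \<cdot>\<^sub>m (V + 1\<^sub>m (2 * n))) *\<^sub>v bhat n a b Y"

lemma boundary_condition_iff_defect: "boundary_condition n a b V Y \<longleftrightarrow> bc_defect n a b V Y = 0\<^sub>v (2 * n)"
  by (simp add: boundary_condition_def bc_defect_def)

text \<open>With v = y^vee and u = y^wedge, the condition says that V maps v + \<i>u to v - \<i>u,
  and the defect is the error in this. Unitarity of V can be exploited in this form.\<close>

lemma bc_defect_index:
  assumes V: "V \<in> carrier_mat (2 * n) (2 * n)" and i: "i < 2 * n"
  shows "vec_index (bc_defect n a b V Y) i =
    (\<Sum>j<2 * n. V $$ (i, j) * (vec_index (bcheck n a b Y) j + \<i> * vec_index (bhat n a b Y) j))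
      - (vec_index (bcheck n a b Y) i - \<i> * vec_index (bhat n a b Y) i)"
proof -
  let ?v = "vec_index (bcheck n a b Y)" and ?u = "vec_index (bhat n a b Y)"
  have c: "bcheck n a b Y \<in> carrier_vec (2 * n)" "bhat n a b Y \<in> carrier_vec (2 * n)" by (auto simp: bcheck_def bhat_def)
  have m: "V - 1\<^sub>m (2 * n) \<in> carrier_mat (2 * n) (2 * n)" "\<i> \<cdot>\<^sub>m (V + 1\<^sub>m (2 * n)) \<in> carrier_mat (2 * n) (2 * n)"
    using V by auto
  have "vec_index (bc_defect n a b V Y) i = vec_index ((V - 1\<^sub>m (2 * n)) *\<^sub>v bcheck n a b Y) i
      + vec_index ((\<i> \<cdot>\<^sub>m (V + 1\<^sub>m (2 * n))) *\<^sub>v bhat n a b Y) i"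
    unfolding bc_defect_def using i V by simp
  also have "\<dots> = (\<Sum>j<2 * n. (V - 1\<^sub>m (2 * n)) $$ (i, j) * ?v j) + (\<Sum>j<2 * n. (\<i> \<cdot>\<^sub>m (V + 1\<^sub>m (2 * n))) $$ (i, j) * ?u j)"
    using mult_mat_vec_index_sum[OF m(1) c(1) i] mult_mat_vec_index_sum[OF m(2) c(2) i] by (simp only:)
  also have "\<dots> = (\<Sum>j<2 * n. V $$ (i, j) * (?v j + \<i> * ?u j) - (if j = i then ?v j - \<i> * ?u j else 0))"
    unfolding sum.distrib[symmetric] using V i by (intro sum.cong) (auto simp: algebra_simps)
  also have "\<dots> = (\<Sum>j<2 * n. V $$ (i, j) * (?v j + \<i> * ?u j)) - (?v i - \<i> * ?u i)"
    using i by (simp add: sum_subtractf)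
  finally show ?thesis .
qed

lemma bc_defect_dim: "V \<in> carrier_mat (2 * n) (2 * n) \<Longrightarrow> dim_vec (bc_defect n a b V Y) = 2 * n"
  by (simp add: bc_defect_def)

lemma boundary_condition_iff_index:
  assumes V: "V \<in> carrier_mat (2 * n) (2 * n)"
  shows "boundary_condition n a b V Y \<longleftrightarrow> (\<forall>i<2 * n. vec_index (bc_defect n a b V Y) i = 0)"
  unfolding boundary_condition_iff_defect using bc_defect_dim[OF V, of a b Y] by (auto intro!: eq_vecI)

lemma norm_cayley_diff: "(norm (v + \<i> * u))\<^sup>2 - (norm (v - \<i> * u))\<^sup>2 = 4 * Im (v * cnj u)"
  unfolding cmod_power2 by (simp add: power2_eq_square algebra_simps)

lemma norm_add_sq: "(norm (r + d :: complex))\<^sup>2 - (norm r)\<^sup>2 = 2 * Re (d * cnj r) + (norm d)\<^sup>2"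
  unfolding cmod_power2 by (simp add: power2_eq_square algebra_simps)

text \<open>The left-hand side is 4 Im <y^vee, y^wedge>, which is |v + \<i>u|^2 - |v - \<i>u|^2. As
  V is isometric, |v + \<i>u| is the norm of v - \<i>u plus the defect, so the difference of squares
  is expressed by the defect.\<close>

lemma energy_defect:
  assumes n: "n \<ge> 1" and ab: "a < b" and qc: "\<And>k. k \<le> n \<Longrightarrow> continuous_on {a..b} (q k)"
    and q0: "\<And>x. x \<in> {a..b} \<Longrightarrow> q 0 x > 0" and sol: "linsol (2 * n) (sysmat n q \<mu>) a b Y"
    and V: "V \<in> carrier_mat (2 * n) (2 * n)" and u: "V * mat_adjoint V = 1\<^sub>m (2 * n)"
  shows "4 * Im \<mu> * sqint a b (Y 0) = (\<Sum>i<2 * n. 2 * Re (vec_index (bc_defect n a b V Y) i *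
      cnj (vec_index (bcheck n a b Y) i - \<i> * vec_index (bhat n a b Y) i)) + (norm (vec_index (bc_defect n a b V Y) i))\<^sup>2)"
proof -
  let ?v = "vec_index (bcheck n a b Y)" and ?u = "vec_index (bhat n a b Y)"
  let ?R = "\<lambda>i. ?v i - \<i> * ?u i" and ?P = "\<lambda>i. ?v i + \<i> * ?u i"
  let ?d = "vec_index (bc_defect n a b V Y)"
  have VP: "(\<Sum>j<2 * n. V $$ (i, j) * ?P j) = ?R i + ?d i" if "i < 2 * n" for i
    using bc_defect_index[OF V that] by simp
  have "(\<Sum>i<2 * n. 2 * Re (?d i * cnj (?R i)) + (norm (?d i))\<^sup>2) = (\<Sum>i<2 * n. (norm (?R i + ?d i))\<^sup>2 - (norm (?R i))\<^sup>2)"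
    by (simp only: norm_add_sq)
  also have "\<dots> = (\<Sum>i<2 * n. (norm (\<Sum>j<2 * n. V $$ (i, j) * ?P j))\<^sup>2) - (\<Sum>i<2 * n. (norm (?R i))\<^sup>2)"
    using VP by (simp add: sum_subtractf)
  also have "\<dots> = (\<Sum>i<2 * n. (norm (?P i))\<^sup>2 - (norm (?R i))\<^sup>2)"
    unfolding unitary_norm[OF V u] by (rule sum_subtractf[symmetric])
  also have "\<dots> = 4 * Im (boundary_pairing n a b Y)"
    unfolding norm_cayley_diff boundary_pairing_def by (simp add: sum_distrib_left)
  also have "boundary_pairing n a b Y = \<mu> * of_real (sqint a b (Y 0)) - of_real (integral {a..b} (energy_density n q Y))"
    by (rule energy_identity[OF n ab qc q0 sol])
  also have "4 * Im \<dots> = 4 * Im \<mu> * sqint a b (Y 0)" by simp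
  finally show ?thesis by simp
qed

text \<open>The condition gives (U - 1)(v + \<i>u) = - 2 \<i> u. A preimage w of the same vector is
  bounded by u, locally uniformly by constant rank, and differs from v + \<i>u by some z in ker(U -
  1). Then v = (w + U w) / 2 + z, where z is orthogonal to u; so only the bounded part contributes
  to the pairing.\<close>

lemma boundary_pairing_locally_bounded:
  fixes U :: "real \<Rightarrow> complex mat"
  assumes carr: "\<And>t. t \<in> T \<Longrightarrow> U t \<in> carrier_mat N N"
    and uni: "\<And>t. t \<in> T \<Longrightarrow> U t * mat_adjoint (U t) = 1\<^sub>m N"
    and cont: "\<And>i j. i < N \<Longrightarrow> j < N \<Longrightarrow> continuous_on T (\<lambda>t. U t $$ (i, j))"
    and rank: "\<And>t. t \<in> T \<Longrightarrow> vec_space.rank N (U t - 1\<^sub>m N) = r" and t0: "t0 \<in> T"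
  shows "\<exists>M\<ge>0. \<exists>\<delta>>0. \<forall>t\<in>T. dist t t0 < \<delta> \<longrightarrow> (\<forall>v u.
     (\<forall>i<N. (\<Sum>j<N. U t $$ (i, j) * (v j + \<i> * u j)) = v i - \<i> * u i) \<longrightarrow>
     norm (\<Sum>i<N. v i * cnj (u i)) \<le> M * (\<Sum>i<N. (norm (u i))\<^sup>2))"
proof -
  have "\<exists>C\<ge>0. \<exists>\<delta>>0. \<forall>t\<in>T. dist t t0 < \<delta> \<longrightarrow> (\<forall>w. \<exists>w'.
     (\<forall>i<N. (\<Sum>j<N. (U t - 1\<^sub>m N) $$ (i, j) * w' j) = (\<Sum>j<N. (U t - 1\<^sub>m N) $$ (i, j) * w j)) \<and>
     (\<Sum>j<N. norm (w' j)) \<le> C * (\<Sum>i<N. norm (\<Sum>j<N. (U t - 1\<^sub>m N) $$ (i, j) * w j)))"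
  proof (rule constant_rank_bounded_preimage[OF _ _ rank t0])
    show "U t - 1\<^sub>m N \<in> carrier_mat N N" if "t \<in> T" for t using carr[OF that] by auto
    fix i j assume ij: "i < N" "j < N"
    have "continuous_on T (\<lambda>t. U t $$ (i, j) - 1\<^sub>m N $$ (i, j))" by (intro continuous_intros cont ij)
    then show "continuous_on T (\<lambda>t. (U t - 1\<^sub>m N) $$ (i, j))"
      by (rule continuous_on_eq) (use carr ij in auto)
  qed
  then obtain C \<delta> where C: "C \<ge> 0" "\<delta> > 0" and pre: "\<forall>t\<in>T. dist t t0 < \<delta> \<longrightarrow> (\<forall>w. \<exists>w'.
     (\<forall>i<N. (\<Sum>j<N. (U t - 1\<^sub>m N) $$ (i, j) * w' j) = (\<Sum>j<N. (U t - 1\<^sub>m N) $$ (i, j) * w j)) \<and>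
     (\<Sum>j<N. norm (w' j)) \<le> C * (\<Sum>i<N. norm (\<Sum>j<N. (U t - 1\<^sub>m N) $$ (i, j) * w j)))"
    by (elim exE conjE) (rule that, assumption+)
  \<comment> \<open>From |<h, u>| \<le> (|h|^2 + |u|^2) / 2 and |h|^2 \<le> |w|^2 \<le> (2 C times
    the sum of |u i|)^2 \<le> 4 C^2 N |u|^2.\<close>
  define M where "M = (4 * C\<^sup>2 * real N + 1) / 2"
  have "norm (\<Sum>i<N. v i * cnj (u i)) \<le> M * (\<Sum>i<N. (norm (u i))\<^sup>2)"
    if t: "t \<in> T" "dist t t0 < \<delta>" and bc: "\<forall>i<N. (\<Sum>j<N. U t $$ (i, j) * (v j + \<i> * u j)) = v i - \<i> * u i" for t v u
  proof -
    let ?U = "\<lambda>x i. \<Sum>j<N. U t $$ (i, j) * x j"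
    define P where "P = (\<lambda>j. v j + \<i> * u j)"
    have UP: "?U P i = v i - \<i> * u i" if "i < N" for i using bc that by (simp add: P_def)
    have A: "(\<Sum>j<N. (U t - 1\<^sub>m N) $$ (i, j) * x j) = ?U x i - x i" if i: "i < N" for i x
    proof -
      have "(\<Sum>j<N. (U t - 1\<^sub>m N) $$ (i, j) * x j) = (\<Sum>j<N. U t $$ (i, j) * x j - (if j = i then x j else 0))"
        using carr[OF t(1)] i by (intro sum.cong) (auto simp: algebra_simps)
      then show ?thesis using i by (simp add: sum_subtractf)
    qed
    obtain w where w: "\<And>i. i < N \<Longrightarrow> ?U w i - w i = ?U P i - P i"
       "(\<Sum>j<N. norm (w j)) \<le> C * (\<Sum>i<N. norm (?U P i - P i))"
      using pre[rule_format, OF t, of P] A by auto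
    define z where "z = (\<lambda>j. P j - w j)"
    have Uz: "?U z i = z i" if "i < N" for i
    proof -
      have e: "?U z i = ?U P i - ?U w i" by (simp add: z_def right_diff_distrib sum_subtractf)
      show ?thesis unfolding e using w(1)[OF that] by (simp add: z_def algebra_simps)
    qed
    have iu: "2 * \<i> * u i = P i - ?U P i" if "i < N" for i using UP[OF that] by (simp add: P_def)
    \<comment> \<open>The kernel of U - 1 is orthogonal to its range: as U z = z, the products of z
      with P and of z = U z with U P agree, and u is a multiple of P - U P.\<close>
    have zu: "(\<Sum>i<N. z i * cnj (u i)) = 0"
    proof -
      have "(\<Sum>i<N. z i * cnj (2 * \<i> * u i)) = (\<Sum>i<N. z i * cnj (P i)) - (\<Sum>i<N. z i * cnj (?U P i))"
        unfolding sum_subtractf[symmetric] by (intro sum.cong) (simp_all add: iu right_diff_distrib)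
      also have "(\<Sum>i<N. z i * cnj (?U P i)) = (\<Sum>i<N. ?U z i * cnj (?U P i))"
        by (intro sum.cong) (simp_all add: Uz)
      also have "\<dots> = (\<Sum>i<N. z i * cnj (P i))" by (rule unitary_isometry[OF carr[OF t(1)] uni[OF t(1)]])
      finally have "(\<Sum>i<N. z i * cnj (2 * \<i> * u i)) = 0" by simp
      moreover have "(\<Sum>i<N. z i * cnj (2 * \<i> * u i)) = - 2 * \<i> * (\<Sum>i<N. z i * cnj (u i))"
        by (simp add: sum_distrib_left mult_ac)
      ultimately show ?thesis by simp
    qed
    define h where "h = (\<lambda>i. (w i + ?U w i) / 2)"
    have v: "v i = h i + z i" if "i < N" for i
    proof -
      have "v i = (P i + ?U P i) / 2" using UP[OF that] by (simp add: P_def)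
      also have "\<dots> = (w i + ?U w i) / 2 + (z i + ?U z i) / 2"
        by (simp add: z_def right_diff_distrib sum_subtractf diff_divide_distrib add_divide_distrib)
      finally show ?thesis using Uz[OF that] by (simp add: h_def)
    qed
    have "(\<Sum>i<N. v i * cnj (u i)) = (\<Sum>i<N. h i * cnj (u i)) + (\<Sum>i<N. z i * cnj (u i))"
      unfolding sum.distrib[symmetric] by (intro sum.cong) (simp_all add: v distrib_right)
    then have "norm (\<Sum>i<N. v i * cnj (u i)) = norm (\<Sum>i<N. h i * cnj (u i))" using zu by simp
    also have "\<dots> \<le> (\<Sum>i<N. ((norm (h i))\<^sup>2 + (norm (u i))\<^sup>2) / 2)"
    proof (rule sum_norm_le)
      fix i
      show "norm (h i * cnj (u i)) \<le> ((norm (h i))\<^sup>2 + (norm (u i))\<^sup>2) / 2"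
        using sum_squares_bound[of "norm (h i)" "norm (u i)"] by (simp add: norm_mult)
    qed
    also have "\<dots> = ((\<Sum>i<N. (norm (h i))\<^sup>2) + (\<Sum>i<N. (norm (u i))\<^sup>2)) / 2"
      by (simp add: sum.distrib sum_divide_distrib[symmetric])
    also have "(\<Sum>i<N. (norm (h i))\<^sup>2) \<le> (\<Sum>i<N. ((norm (w i))\<^sup>2 + (norm (?U w i))\<^sup>2) / 2)"
    proof (rule sum_mono)
      fix i
      have "norm (h i) \<le> (norm (w i) + norm (?U w i)) / 2"
        using norm_triangle_ineq[of "w i" "?U w i"] by (simp add: h_def norm_divide)
      then have "(norm (h i))\<^sup>2 \<le> ((norm (w i) + norm (?U w i)) / 2)\<^sup>2" by (intro power_mono) auto
      also have "\<dots> \<le> ((norm (w i))\<^sup>2 + (norm (?U w i))\<^sup>2) / 2"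
        using sum_squares_bound[of "norm (w i)" "norm (?U w i)"] by (simp add: power2_eq_square field_simps)
      finally show "(norm (h i))\<^sup>2 \<le> ((norm (w i))\<^sup>2 + (norm (?U w i))\<^sup>2) / 2" .
    qed
    also have "(\<Sum>i<N. ((norm (w i))\<^sup>2 + (norm (?U w i))\<^sup>2) / 2) = (\<Sum>i<N. (norm (w i))\<^sup>2)"
      unfolding sum_divide_distrib[symmetric] sum.distrib unitary_norm[OF carr[OF t(1)] uni[OF t(1)]] by simp
    also have "(\<Sum>i<N. (norm (w i))\<^sup>2) \<le> (\<Sum>i<N. norm (w i))\<^sup>2"
    proof -
      have "(\<Sum>i<N. (norm (w i))\<^sup>2) \<le> (\<Sum>i<N. norm (w i) * (\<Sum>i<N. norm (w i)))"
        unfolding power2_eq_square by (intro sum_mono mult_left_mono member_le_sum) auto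
      then show ?thesis by (simp add: power2_eq_square sum_distrib_right)
    qed
    also have "(\<Sum>i<N. norm (w i))\<^sup>2 \<le> (C * (\<Sum>i<N. 2 * norm (u i)))\<^sup>2"
    proof (rule power_mono)
      have "(\<Sum>i<N. norm (?U P i - P i)) = (\<Sum>i<N. 2 * norm (u i))"
      proof (rule sum.cong)
        fix i assume "i \<in> {..<N}"
        then have "?U P i - P i = - (2 * \<i> * u i)" using iu[of i] by simp
        then show "norm (?U P i - P i) = 2 * norm (u i)" by (simp add: norm_mult)
      qed simp
      then show "(\<Sum>i<N. norm (w i)) \<le> C * (\<Sum>i<N. 2 * norm (u i))" using w(2) by simp
    qed (simp add: sum_nonneg)
    also have "(C * (\<Sum>i<N. 2 * norm (u i)))\<^sup>2 = 4 * C\<^sup>2 * (\<Sum>i<N. norm (u i))\<^sup>2"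
      by (simp add: sum_distrib_left[symmetric] power_mult_distrib)
    also have "\<dots> \<le> 4 * C\<^sup>2 * ((\<Sum>i<N. (norm (u i))\<^sup>2) * real N)"
      using sum_squared_le_sum_of_squares[of "\<lambda>i. norm (u i)" "{..<N}"] by (intro mult_left_mono) auto
    finally show ?thesis by (simp add: M_def field_simps)
  qed
  moreover have "M \<ge> 0" by (simp add: M_def)
  ultimately show ?thesis using C(2)
    by (intro exI[of _ M] conjI exI[of _ \<delta>] ballI impI allI)
qed

text \<open>By the energy identity \<mu> ||y||^2 is at least c0 ||y^(n)||^2 minus lower derivatives
  and boundary values, all of which are dominated through \<open>deriv_chain_bounds\<close>. The
  constant depends on q only through P and c0, and on the boundary condition only through M, which
  makes it uniform in l.\<close>

lemma eigenvalue_lower_bound: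
  assumes n: "n \<ge> 1" and ab: "a < b" and P: "P \<ge> 0" and c0: "c0 > 0" and M: "M \<ge> 0"
  shows "\<exists>C. \<forall>q Y \<mu>. (\<forall>k\<le>n. continuous_on {a..b} (q k)) \<longrightarrow> (\<forall>k\<le>n. \<forall>x\<in>{a..b}. \<bar>q k x\<bar> \<le> P) \<longrightarrow>
     (\<forall>x\<in>{a..b}. q 0 x \<ge> c0) \<longrightarrow> linsol (2 * n) (sysmat n q (complex_of_real \<mu>)) a b Y \<longrightarrow>
     norm (boundary_pairing n a b Y) \<le> M * (\<Sum>i<2 * n. (norm (vec_index (bhat n a b Y) i))\<^sup>2) \<longrightarrow>
     sqint a b (Y 0) > 0 \<longrightarrow> \<mu> \<ge> - C"
proof -
  \<comment> \<open>\<open>L\<close> is the total weight to be absorbed: n P for the lower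
    coefficients, 2 n M for the 2 n boundary values. The choice of \<open>e\<close> gives L e \<le>
    c0, so the leading term wins and the bound - L K is left.\<close>
  define L where "L = real n * P + 2 * real n * M"
  have L: "L \<ge> 0" using P M by (simp add: L_def)
  define e where "e = c0 / (L + 1)"
  have e: "e > 0" "L * e \<le> c0" using c0 L by (auto simp: e_def field_simps)
  obtain K where K: "K \<ge> 0" "\<forall>f. deriv_chain n a b f \<longrightarrow> (\<forall>j<n. \<forall>x\<in>{a..b}.
     sqint a b (f j) \<le> e * sqint a b (f n) + K * sqint a b (f 0) \<and>
     (norm (f j x))\<^sup>2 \<le> e * sqint a b (f n) + K * sqint a b (f 0))"
    using deriv_chain_bounds[where n = n, OF ab e(1)] by (elim exE conjE) (rule that, assumption, assumption)
  have "\<mu> \<ge> - (L * K)" if qc: "\<forall>k\<le>n. continuous_on {a..b} (q k)" and qP: "\<forall>k\<le>n. \<forall>x\<in>{a..b}. \<bar>q k x\<bar> \<le> P"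
    and q0: "\<forall>x\<in>{a..b}. q 0 x \<ge> c0" and sol: "linsol (2 * n) (sysmat n q (complex_of_real \<mu>)) a b Y"
    and pb: "norm (boundary_pairing n a b Y) \<le> M * (\<Sum>i<2 * n. (norm (vec_index (bhat n a b Y) i))\<^sup>2)"
    and pos: "sqint a b (Y 0) > 0" for q Y \<mu>
  proof -
    have q0p: "q 0 x > 0" if "x \<in> {a..b}" for x using q0 that c0 by force
    have Yc: "continuous_on {a..b} (Y i)" if "i < 2 * n" for i using linsol_continuous[OF sol that] .
    define w where "w = (\<lambda>x. Y n x / of_real (q 0 x))"
    have wc: "continuous_on {a..b} w"
      unfolding w_def using qc n q0p by (intro continuous_intros Yc) force+
    \<comment> \<open>The top entry is y^(n) = Y n / q 0; Y n itself is the quasi-derivative and not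
      the derivative of Y (n - 1).\<close>
    define f where "f = (\<lambda>j. if j < n then Y j else w)"
    have chain: "deriv_chain n a b f"
      unfolding deriv_chain_def
    proof (intro conjI allI impI ballI)
      show "continuous_on {a..b} (f n)" using wc by (simp add: f_def)
      fix j x assume j: "j < n" and x: "x \<in> {a..b}"
      have "(Y j has_vector_derivative sysrhs n q (complex_of_real \<mu>) Y j x) (at x within {a..b})"
        using sol j x unfolding linsol_sysmat_iff[OF n] by simp
      then show "(f j has_vector_derivative f (Suc j) x) (at x within {a..b})"
        using j by (cases "Suc j < n") (auto simp: f_def sysrhs_def w_def)
    qed
    define I where "I = sqint a b (Y 0)"
    define W where "W = sqint a b w"
    define S where "S = e * W + K * I"
    have f0: "f 0 = Y 0" "f n = w" using n by (auto simp: f_def)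
    have W0: "W \<ge> 0" unfolding W_def by (rule sqint_nonneg[OF wc])
    have S: "sqint a b (Y j) \<le> S" "(norm (Y j x))\<^sup>2 \<le> S" if "j < n" "x \<in> {a..b}" for j x
      using K(2)[rule_format, OF chain that] that f0 by (auto simp: S_def W_def I_def f_def)
    have a: "a \<in> {a..b}" "b \<in> {a..b}" using ab by auto
    have "(\<Sum>i<2 * n. (norm (vec_index (bhat n a b Y) i))\<^sup>2) \<le> (\<Sum>i<2 * n. S)"
      using S(2)[OF _ a(1)] S(2)[OF _ a(2)] by (intro sum_mono) (auto simp: bhat_def)
    then have "M * (\<Sum>i<2 * n. (norm (vec_index (bhat n a b Y) i))\<^sup>2) \<le> M * (2 * real n * S)"
      using M by (intro mult_left_mono) auto
    then have pb': "norm (boundary_pairing n a b Y) \<le> 2 * real n * M * S" using pb by (simp add: mult_ac)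
    have ed: "energy_density n q Y integrable_on {a..b}"
      using qc q0p Yc n by (intro integrable_continuous_interval energy_density_continuous) auto
    have wi: "(\<lambda>x. (norm (w x))\<^sup>2) integrable_on {a..b}" by (intro integrable_continuous_interval continuous_intros wc)
    have yi: "(\<lambda>x. (norm (Y j x))\<^sup>2) integrable_on {a..b}" if "j < n" for j
      using that by (intro integrable_continuous_interval continuous_intros Yc) auto
    have "integral {a..b} (\<lambda>x. c0 * (norm (w x))\<^sup>2 - P * (\<Sum>j<n. (norm (Y j x))\<^sup>2)) \<le> integral {a..b} (energy_density n q Y)"
    proof (rule integral_le)
      show "(\<lambda>x. c0 * (norm (w x))\<^sup>2 - P * (\<Sum>j<n. (norm (Y j x))\<^sup>2)) integrable_on {a..b}"
        by (intro integrable_diff integrable_on_mult_right wi integrable_sum yi) auto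
      fix x assume x: "x \<in> {a..b}"
      have "c0 * (norm (w x))\<^sup>2 \<le> q 0 x * (norm (w x))\<^sup>2" using q0 x by (intro mult_right_mono) auto
      also have "\<dots> = (norm (Y n x))\<^sup>2 / q 0 x"
        using q0p[OF x] by (simp add: w_def norm_divide power2_eq_square field_simps)
      finally have 1: "c0 * (norm (w x))\<^sup>2 \<le> (norm (Y n x))\<^sup>2 / q 0 x" .
      have "(\<Sum>j<n. - P * (norm (Y j x))\<^sup>2) \<le> (\<Sum>j<n. q (n - j) x * (norm (Y j x))\<^sup>2)"
      proof (intro sum_mono mult_right_mono)
        fix j show "- P \<le> q (n - j) x" using qP[rule_format, of "n - j" x] x by (simp add: abs_le_iff)
      qed simp
      then have 2: "- (P * (\<Sum>j<n. (norm (Y j x))\<^sup>2)) \<le> (\<Sum>j<n. q (n - j) x * (norm (Y j x))\<^sup>2)"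
        by (simp add: sum_distrib_left sum_negf)
      show "c0 * (norm (w x))\<^sup>2 - P * (\<Sum>j<n. (norm (Y j x))\<^sup>2) \<le> energy_density n q Y x"
        using 1 2 by (simp add: energy_density_def)
    qed (rule ed)
    moreover have "integral {a..b} (\<lambda>x. c0 * (norm (w x))\<^sup>2 - P * (\<Sum>j<n. (norm (Y j x))\<^sup>2)) = c0 * W - P * (\<Sum>j<n. sqint a b (Y j))"
    proof -
      have "integral {a..b} (\<lambda>x. c0 * (norm (w x))\<^sup>2 - P * (\<Sum>j<n. (norm (Y j x))\<^sup>2))
        = integral {a..b} (\<lambda>x. c0 * (norm (w x))\<^sup>2) - integral {a..b} (\<lambda>x. P * (\<Sum>j<n. (norm (Y j x))\<^sup>2))"
        by (intro integral_diff integrable_on_mult_right wi integrable_sum yi) auto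
      also have "integral {a..b} (\<lambda>x. P * (\<Sum>j<n. (norm (Y j x))\<^sup>2)) = P * (\<Sum>j<n. sqint a b (Y j))"
      proof -
        have "integral {a..b} (\<lambda>x. \<Sum>j<n. (norm (Y j x))\<^sup>2) = (\<Sum>j<n. sqint a b (Y j))"
          by (intro integral_sum yi) auto
        then show ?thesis by simp
      qed
      finally show ?thesis by (simp add: W_def)
    qed
    moreover have "P * (\<Sum>j<n. sqint a b (Y j)) \<le> P * (real n * S)"
      using sum_bounded_above[of "{..<n}" "\<lambda>j. sqint a b (Y j)" S] S(1)[OF _ a(1)] P by (intro mult_left_mono) auto
    ultimately have Q: "integral {a..b} (energy_density n q Y) \<ge> c0 * W - real n * P * S" by (simp add: mult_ac)
    have "boundary_pairing n a b Y = of_real \<mu> * of_real I - of_real (integral {a..b} (energy_density n q Y))"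
      unfolding I_def using qc q0p by (intro energy_identity[OF n ab _ _ sol]) auto
    then have "Re (boundary_pairing n a b Y) = \<mu> * I - integral {a..b} (energy_density n q Y)" by simp
    then have "\<mu> * I \<ge> c0 * W - real n * P * S - 2 * real n * M * S"
      using Q pb' abs_Re_le_cmod[of "boundary_pairing n a b Y"] by linarith
    moreover have "c0 * W - real n * P * S - 2 * real n * M * S = (c0 - L * e) * W - L * K * I"
      by (simp add: L_def S_def algebra_simps)
    moreover have "(c0 - L * e) * W \<ge> 0" using e(2) W0 by simp
    ultimately have "- (L * K) * I \<le> \<mu> * I" by simp
    then show ?thesis using pos mult_right_le_imp_le[of "- (L * K)" I \<mu>] by (simp add: I_def)
  qed
  then show ?thesis by (intro exI[of _ "L * K"] allI impI)
qed

section \<open>Order of vanishing of a determinant\<close>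

text \<open>The Leibniz formula in terms of entry functions shows the determinant as a polynomial in
  the entries, so that it inherits holomorphy and continuity from them.\<close>

lemma det_mat_eq_sum:
  "Determinant.det (mat N N (\<lambda>(i, j). A i j)) = (\<Sum>p\<in>{p. p permutes {0..<N}}. signof p * (\<Prod>i = 0..<N. A i (p i)))"
  for A :: "nat \<Rightarrow> nat \<Rightarrow> complex"
proof -
  have "(\<Prod>i = 0..<N. mat N N (\<lambda>(i, j). A i j) $$ (i, p i)) = (\<Prod>i = 0..<N. A i (p i))" if "p permutes {0..<N}" for p
    using that by (intro prod.cong) (auto simp: permutes_in_image)
  then show ?thesis unfolding Determinant.det_def by simp
qed

lemma det_mat_holomorphic:
  fixes B :: "complex \<Rightarrow> nat \<Rightarrow> nat \<Rightarrow> complex"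
  assumes "\<And>i j. i < N \<Longrightarrow> j < N \<Longrightarrow> (\<lambda>z. B z i j) holomorphic_on S"
  shows "(\<lambda>z. Determinant.det (mat N N (\<lambda>(i, j). B z i j))) holomorphic_on S"
  unfolding det_mat_eq_sum
  by (intro holomorphic_intros assms) (auto simp: permutes_in_image)

lemma det_mat_continuous:
  fixes B :: "'a::topological_space \<Rightarrow> nat \<Rightarrow> nat \<Rightarrow> complex"
  assumes "\<And>i j. i < N \<Longrightarrow> j < N \<Longrightarrow> continuous_on S (\<lambda>z. B z i j)"
  shows "continuous_on S (\<lambda>z. Determinant.det (mat N N (\<lambda>(i, j). B z i j)))"
  unfolding det_mat_eq_sum
  by (intro continuous_intros assms) (auto simp: permutes_in_image)

lemma det_mat_scale_columns:
  fixes A :: "nat \<Rightarrow> nat \<Rightarrow> complex"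
  shows "Determinant.det (mat N N (\<lambda>(i, j). A i j * d j)) = (\<Prod>j = 0..<N. d j) * Determinant.det (mat N N (\<lambda>(i, j). A i j))"
proof -
  have "(\<Prod>i = 0..<N. A i (p i) * d (p i)) = (\<Prod>j = 0..<N. d j) * (\<Prod>i = 0..<N. A i (p i))" if "p permutes {0..<N}" for p
  proof -
    have "(\<Prod>i = 0..<N. d (p i)) = (\<Prod>j = 0..<N. d j)" using prod.permute[OF that, of d] by (simp add: o_def)
    then show ?thesis by (simp add: prod.distrib)
  qed
  then have "(\<Sum>p\<in>{p. p permutes {0..<N}}. signof p * (\<Prod>i = 0..<N. A i (p i) * d (p i)))
    = (\<Sum>p\<in>{p. p permutes {0..<N}}. (\<Prod>j = 0..<N. d j) * (signof p * (\<Prod>i = 0..<N. A i (p i))))"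
    by (intro sum.cong) auto
  then show ?thesis unfolding det_mat_eq_sum by (simp only: sum_distrib_left)
qed

lemma det_mat_nonzero_iff:
  "Determinant.det (mat N N (\<lambda>(i, j). A i j)) \<noteq> 0 \<longleftrightarrow> col_indep N A {..<N}"
proof -
  have c: "mat N N (\<lambda>(i, j). A i j) \<in> carrier_mat N N" by simp
  show ?thesis unfolding det_nonzero_iff_col_indep[OF c]
    by (auto elim!: col_indep_cong)
qed

lemma det_mat_mult:
  fixes A B :: "nat \<Rightarrow> nat \<Rightarrow> complex"
  shows "Determinant.det (mat N N (\<lambda>(i, k). \<Sum>j<N. A i j * B j k))
    = Determinant.det (mat N N (\<lambda>(i, j). A i j)) * Determinant.det (mat N N (\<lambda>(i, j). B i j))"
proof -
  have "mat N N (\<lambda>(i, k). \<Sum>j<N. A i j * B j k) = mat N N (\<lambda>(i, j). A i j) * mat N N (\<lambda>(i, j). B i j)"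
    by (rule eq_matI) (auto simp: scalar_prod_def atLeast0LessThan intro!: sum.cong)
  then show ?thesis by (simp add: det_mult[of _ N])
qed

text \<open>The hypothesis \<open>nondeg\<close> says that the inverse blows up at most like \<open>1 / t\<close> along \<open>z0 + \<i> t\<close>, which is
  what self-adjointness gives; it excludes Jordan chains.\<close>

lemma zorder_det_eq_nullity:
  fixes B :: "complex \<Rightarrow> nat \<Rightarrow> nat \<Rightarrow> complex"
  assumes hol: "\<And>i j. i < N \<Longrightarrow> j < N \<Longrightarrow> (\<lambda>z. B z i j) holomorphic_on UNIV" and m: "m \<le> N"
    and Cker: "\<And>i k. i < N \<Longrightarrow> k < m \<Longrightarrow> (\<Sum>j<N. B z0 i j * C j k) = 0"
    and Cind: "col_indep N C {..<m}"
    and Cspan: "\<And>x. (\<And>i. i < N \<Longrightarrow> (\<Sum>j<N. B z0 i j * x j) = 0) \<Longrightarrow> \<exists>y. \<forall>j<N. x j = (\<Sum>k<m. C j k * y k)"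
    and nondeg: "\<And>w w0 j. (\<And>j. j < N \<Longrightarrow> ((\<lambda>t. w t j) \<longlongrightarrow> w0 j) (at_right 0)) \<Longrightarrow>
       (\<And>i. i < N \<Longrightarrow> ((\<lambda>t. (\<Sum>j<N. B (z0 + \<i> * of_real t) i j * w t j) / of_real t) \<longlongrightarrow> 0) (at_right (0::real))) \<Longrightarrow>
       j < N \<Longrightarrow> w0 j = 0"
  shows "zorder (\<lambda>z. Determinant.det (mat N N (\<lambda>(i, j). B z i j))) z0 = int m"
proof -
  have mN: "{..<m} \<subseteq> {..<N}" using m by auto
  \<comment> \<open>A basis adapted to the kernel at \<open>z0\<close>: its first m members are the
    kernel vectors, so the first m columns of the product B F vanish at \<open>z0\<close>.\<close>
  obtain F where F: "\<And>i k. k < m \<Longrightarrow> F i k = C i k" "col_indep N F {..<N}"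
    using col_indep_extend[OF mN Cind] by auto
  define H where "H = (\<lambda>z i k. \<Sum>j<N. B z i j * F j k)"
  have Hhol: "(\<lambda>z. H z i k) holomorphic_on UNIV" if "i < N" for i k
    unfolding H_def using that by (intro holomorphic_intros hol) auto
  have H0: "H z0 i k = 0" if "i < N" "k < m" for i k using Cker that F(1) by (simp add: H_def)
  \<comment> \<open>A factor z - z0 is taken out of each of the m vanishing columns, the derivative
    filling the removable singularity. Thus det B det F = (z - z0)^m det G, and the claim reduces to
    det (G z0) being nonzero.\<close>
  define G where "G = (\<lambda>z i k. if k < m then (if z = z0 then deriv (\<lambda>z. H z i k) z0 else (H z i k - H z0 i k) / (z - z0)) else H z i k)"
  have Ghol: "(\<lambda>z. G z i k) holomorphic_on UNIV" if "i < N" for i k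
  proof (cases "k < m")
    case True
    then show ?thesis unfolding G_def using pole_lemma_open[OF Hhol[OF that] open_UNIV, of z0 k] by simp
  next
    case False
    then show ?thesis unfolding G_def using Hhol[OF that] by simp
  qed
  have HG: "H z i k = G z i k * (if k < m then z - z0 else 1)" if "i < N" "z \<noteq> z0" for z i k
    using that H0 by (simp add: G_def)
  let ?D = "\<lambda>A. Determinant.det (mat N N (\<lambda>(i, j). A i j))"
  have prodd: "(\<Prod>j = 0..<N. if j < m then z - z0 else 1) = (z - z0) ^ m" for z
  proof -
    have "(\<Prod>j = 0..<N. if j < m then z - z0 else 1) = (\<Prod>j\<in>{0..<m}. z - z0)"
      using m by (intro prod.mono_neutral_cong_right) auto
    then show ?thesis by simp
  qed
  have DF: "?D F \<noteq> 0" using F(2) det_mat_nonzero_iff by blast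
  have main: "?D (B z) = ?D (G z) / ?D F * (z - z0) ^ m" if "z \<noteq> z0" for z
  proof -
    have "?D (B z) * ?D F = ?D (H z)" unfolding H_def det_mat_mult ..
    also have "mat N N (\<lambda>(i, j). H z i j) = mat N N (\<lambda>(i, j). G z i j * (if j < m then z - z0 else 1))"
      using HG that by (intro eq_matI) auto
    also have "Determinant.det \<dots> = (z - z0) ^ m * ?D (G z)" unfolding det_mat_scale_columns prodd ..
    finally show ?thesis using DF by (simp add: field_simps)
  qed
  have "col_indep N (G z0) {..<N}"
  proof (rule col_indepI)
    fix x k assume x: "\<And>i. i < N \<Longrightarrow> (\<Sum>j<N. G z0 i j * x j) = 0" and k: "k \<in> {..<N}"
    \<comment> \<open>Test vectors for \<open>nondeg\<close>, made from x in the kernel of G z0. At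
      z = z0 + \<i> t the first m columns of B F carry the factor \<i> t; the weight - \<i> there
      and t elsewhere give B w = t G x in both cases, which is o(t) since G z0 x = 0.\<close>
    define w where "w = (\<lambda>t::real. \<lambda>j. \<Sum>k<N. F j k * (if k < m then - \<i> * x k else of_real t * x k))"
    define w0 where "w0 = (\<lambda>j. \<Sum>k<N. F j k * (if k < m then - \<i> * x k else of_real 0 * x k))"
    have lim: "((\<lambda>t. w t j) \<longlongrightarrow> w0 j) (at_right 0)" for j
      unfolding w_def w0_def
    proof (intro tendsto_sum tendsto_mult tendsto_const)
      fix k show "((\<lambda>t. if k < m then - \<i> * x k else complex_of_real t * x k) \<longlongrightarrow>
          (if k < m then - \<i> * x k else complex_of_real 0 * x k)) (at_right 0)"
        by (cases "k < m") (auto intro!: tendsto_eq_intros)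
    qed
    have Bw: "(\<Sum>j<N. B z i j * w t j) = (\<Sum>k<N. H z i k * (if k < m then - \<i> * x k else of_real t * x k))" for z i t
      unfolding w_def H_def sum_distrib_left sum_distrib_right by (subst sum.swap) (simp add: mult_ac)
    have quot: "(\<Sum>j<N. B (z0 + \<i> * of_real t) i j * w t j) / of_real t = (\<Sum>k<N. G (z0 + \<i> * of_real t) i k * x k)"
      if i: "i < N" and t: "t > 0" for i t
    proof -
      have z: "z0 + \<i> * of_real t \<noteq> z0" using t by simp
      have "(\<Sum>j<N. B (z0 + \<i> * of_real t) i j * w t j) = (\<Sum>k<N. of_real t * (G (z0 + \<i> * of_real t) i k * x k))"
        unfolding Bw
      proof (rule sum.cong[OF refl])
        fix k
        have alg: "g * (\<i> * T) * (- \<i> * y) = T * (g * y)" for g T y :: complex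
        proof -
          have "g * (j * T) * (- j * y) = - (j * j) * (T * (g * y))" for j by (simp add: mult_ac)
          from this[of \<i>] show ?thesis by simp
        qed
        show "H (z0 + \<i> * of_real t) i k * (if k < m then - \<i> * x k else of_real t * x k)
            = of_real t * (G (z0 + \<i> * of_real t) i k * x k)"
          unfolding HG[OF i z] using alg[of "G (z0 + \<i> * of_real t) i k" "of_real t" "x k"]
          by (cases "k < m") (simp_all only: if_True if_False mult_1_right add_diff_cancel_left', simp add: mult_ac)
      qed
      then show ?thesis using t by (simp add: sum_distrib_left[symmetric])
    qed
    have quot0: "((\<lambda>t. (\<Sum>j<N. B (z0 + \<i> * of_real t) i j * w t j) / of_real t) \<longlongrightarrow> 0) (at_right 0)" if i: "i < N" for i
    proof -
      have "((\<lambda>t. \<Sum>k<N. G (z0 + \<i> * of_real t) i k * x k) \<longlongrightarrow> (\<Sum>k<N. G (z0 + \<i> * of_real 0) i k * x k)) (at_right 0)"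
      proof (intro tendsto_sum tendsto_mult tendsto_const)
        fix k
        have "isCont (\<lambda>z. G z i k) (z0 + \<i> * of_real 0)"
          using holomorphic_on_imp_continuous_on[OF Ghol[OF i]] continuous_on_eq_continuous_at[OF open_UNIV] by blast
        then show "((\<lambda>t. G (z0 + \<i> * of_real t) i k) \<longlongrightarrow> G (z0 + \<i> * of_real 0) i k) (at_right 0)"
          by (rule isCont_tendsto_compose) (intro tendsto_intros)
      qed
      then have "((\<lambda>t. \<Sum>k<N. G (z0 + \<i> * of_real t) i k * x k) \<longlongrightarrow> 0) (at_right 0)" using x[OF i] by simp
      then show ?thesis
      proof (rule Lim_transform_eventually)
        show "\<forall>\<^sub>F t in at_right 0. (\<Sum>k<N. G (z0 + \<i> * of_real t) i k * x k) = (\<Sum>j<N. B (z0 + \<i> * of_real t) i j * w t j) / of_real t"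
          unfolding eventually_at_filter using quot[OF i] by (intro always_eventually) auto
      qed
    qed
    have w00: "w0 j = 0" if "j < N" for j by (rule nondeg[of w w0, OF lim quot0 that])
    have xm: "x k = 0" if "k < m" for k
    proof -
      have "(if k < m then - \<i> * x k else of_real 0 * x k) = 0"
        by (rule col_indepD[OF F(2), where x = "\<lambda>k. if k < m then - \<i> * x k else of_real 0 * x k"])
          (use w00 that m in \<open>auto simp: w0_def\<close>)
      then show ?thesis using that by simp
    qed
    \<comment> \<open>Since x vanishes on the first m indices and G agrees with B F on the others, F
      x lies in the kernel of B z0. It is then a combination of the first m columns of F, and
      independence of all columns gives x = 0.\<close>
    have "(\<Sum>j<N. B z0 i j * (\<Sum>k<N. F j k * x k)) = 0" if i: "i < N" for i
    proof -
      have "(\<Sum>j<N. B z0 i j * (\<Sum>k<N. F j k * x k)) = (\<Sum>k<N. H z0 i k * x k)"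
        unfolding H_def sum_distrib_left sum_distrib_right by (subst sum.swap) (simp add: mult_ac)
      also have "\<dots> = (\<Sum>k<N. G z0 i k * x k)" using xm by (intro sum.cong) (auto simp: G_def)
      finally show ?thesis using x[OF i] by simp
    qed
    then obtain y where y: "\<And>j. j < N \<Longrightarrow> (\<Sum>k<N. F j k * x k) = (\<Sum>k<m. C j k * y k)"
      using Cspan[of "\<lambda>j. \<Sum>k<N. F j k * x k"] by auto
    have "(if k < m then - y k else x k) = 0"
    proof (rule col_indepD[OF F(2) _ k, where x = "\<lambda>k. if k < m then - y k else x k"])
      fix i assume i: "i < N"
      have "(\<Sum>j<N. F i j * (if j < m then - y j else x j)) = (\<Sum>j<N. F i j * x j - (if j < m then C i j * y j else 0))"
        using xm F(1) by (intro sum.cong) auto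
      also have "\<dots> = (\<Sum>j<N. F i j * x j) - (\<Sum>j<N. if j < m then C i j * y j else 0)" by (rule sum_subtractf)
      also have "(\<Sum>j<N. if j < m then C i j * y j else 0) = (\<Sum>j<m. C i j * y j)"
        using m by (intro sum.mono_neutral_cong_right) auto
      finally show "(\<Sum>j<N. F i j * (if j < m then - y j else x j)) = 0" using y[OF i] by simp
    qed
    then show "x k = 0" using xm by (cases "k < m") auto
  qed
  then have DG: "?D (G z0) \<noteq> 0" using det_mat_nonzero_iff by blast
  have hol': "(\<lambda>z. ?D (G z) / ?D F) holomorphic_on UNIV"
    using DF Ghol by (intro holomorphic_intros det_mat_holomorphic) auto
  show ?thesis
  proof (rule zorder_eqI[OF open_UNIV _ hol'])
    show "?D (G z0) / ?D F \<noteq> 0" using DG DF by simp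
    fix z assume "z \<noteq> z0"
    then show "?D (B z) = ?D (G z) / ?D F * (z - z0) powi int m" using main by (simp add: power_int_of_nat)
  qed simp
qed

section \<open>The characteristic determinant\<close>

lemma bcheck_lincomb:
  "i < 2 * n \<Longrightarrow> vec_index (bcheck n a b (\<lambda>i x. \<Sum>j\<in>J. F j i x * c j)) i = (\<Sum>j\<in>J. vec_index (bcheck n a b (F j)) i * c j)"
  by (auto simp: bcheck_def sum_negf)

lemma bhat_lincomb:
  "i < 2 * n \<Longrightarrow> vec_index (bhat n a b (\<lambda>i x. \<Sum>j\<in>J. F j i x * c j)) i = (\<Sum>j\<in>J. vec_index (bhat n a b (F j)) i * c j)"
  by (auto simp: bhat_def)

lemma bc_defect_lincomb:
  assumes V: "V \<in> carrier_mat (2 * n) (2 * n)" and i: "i < 2 * n"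
  shows "vec_index (bc_defect n a b V (\<lambda>i x. \<Sum>j\<in>J. F j i x * c j)) i = (\<Sum>j\<in>J. vec_index (bc_defect n a b V (F j)) i * c j)"
proof -
  let ?v = "\<lambda>j. vec_index (bcheck n a b (F j))" and ?u = "\<lambda>j. vec_index (bhat n a b (F j))"
  have "vec_index (bc_defect n a b V (\<lambda>i x. \<Sum>j\<in>J. F j i x * c j)) i
    = (\<Sum>k<2 * n. V $$ (i, k) * (\<Sum>j\<in>J. (?v j k + \<i> * ?u j k) * c j)) - (\<Sum>j\<in>J. (?v j i - \<i> * ?u j i) * c j)"
    unfolding bc_defect_index[OF V i]
    using bcheck_lincomb[of _ n a b F c J] bhat_lincomb[of _ n a b F c J] i
    by (simp add: sum.distrib sum_subtractf sum_distrib_left distrib_right left_diff_distrib mult.assoc)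
  also have "(\<Sum>k<2 * n. V $$ (i, k) * (\<Sum>j\<in>J. (?v j k + \<i> * ?u j k) * c j))
     = (\<Sum>j\<in>J. (\<Sum>k<2 * n. V $$ (i, k) * (?v j k + \<i> * ?u j k)) * c j)"
    unfolding sum_distrib_left sum_distrib_right by (subst sum.swap) (simp add: mult.assoc)
  finally show ?thesis unfolding bc_defect_index[OF V i] by (simp only: sum_subtractf left_diff_distrib)
qed

lemma bc_defect_cong:
  assumes "a \<le> b" "\<And>i x. i < 2 * n \<Longrightarrow> x \<in> {a..b} \<Longrightarrow> Y i x = Z i x"
  shows "bc_defect n a b V Y = bc_defect n a b V Z"
proof -
  have "bhat n a b Y = bhat n a b Z" by (rule bhat_cong[OF assms])
  moreover have "bcheck n a b Y = bcheck n a b Z" by (rule bcheck_cong[OF assms])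
  ultimately show ?thesis by (simp only: bc_defect_def)
qed

lemma continuous_on_if_const:
  "(P \<Longrightarrow> continuous_on S f) \<Longrightarrow> (\<not> P \<Longrightarrow> continuous_on S g) \<Longrightarrow> continuous_on S (\<lambda>x. if P then f x else g x)"
  by (cases P) auto

text \<open>The smoothness hypotheses are put in one form for 0 \<le> k \<le> n, the case k = n
  being mere continuity, and the common rank of U(l) - 1 is given the name \<open>r\<close>.\<close>

locale parametric_bvp =
  fixes n :: nat and a b :: real and \<Lambda> :: "real set" and p :: "nat \<Rightarrow> real \<Rightarrow> real \<Rightarrow> real"
    and U :: "real \<Rightarrow> complex mat" and r :: nat
  assumes n: "n \<ge> 1" and ab: "a < b" and open_\<Lambda>: "open \<Lambda>"
    and p_cont: "\<And>k. k \<le> n \<Longrightarrow> continuous_on ({a..b} \<times> \<Lambda>) (\<lambda>(x, l). p k x l)"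
    and p0_pos: "\<And>l x. l \<in> \<Lambda> \<Longrightarrow> x \<in> {a..b} \<Longrightarrow> p 0 x l > 0"
    and p_Cm: "\<And>l k. l \<in> \<Lambda> \<Longrightarrow> k \<le> n \<Longrightarrow> Cm (n - k) a b (\<lambda>x. p k x l)"
    and U_carrier: "\<And>l. l \<in> \<Lambda> \<Longrightarrow> U l \<in> carrier_mat (2 * n) (2 * n)"
    and U_unitary: "\<And>l. l \<in> \<Lambda> \<Longrightarrow> U l * mat_adjoint (U l) = 1\<^sub>m (2 * n)"
    and U_cont: "\<And>i j. i < 2 * n \<Longrightarrow> j < 2 * n \<Longrightarrow> continuous_on \<Lambda> (\<lambda>l. U l $$ (i, j))"
    and rank: "\<And>l. l \<in> \<Lambda> \<Longrightarrow> vec_space.rank (2 * n) (U l - 1\<^sub>m (2 * n)) = r"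
begin

abbreviation coef :: "real \<Rightarrow> nat \<Rightarrow> real \<Rightarrow> real" where
  "coef l \<equiv> (\<lambda>k x. p k x l)"

abbreviation system :: "real \<times> complex \<Rightarrow> nat \<Rightarrow> nat \<Rightarrow> real \<Rightarrow> complex" where
  "system \<theta> \<equiv> sysmat n (coef (fst \<theta>)) (snd \<theta>)"

lemma coef_continuous: "l \<in> \<Lambda> \<Longrightarrow> k \<le> n \<Longrightarrow> continuous_on {a..b} (coef l k)"
  using Cm_continuous[OF p_Cm] by blast

text \<open>Rows below n use p_0 through its reciprocal, the other rows use one p_k each, and no
  derivative of a coefficient occurs. Joint continuity of the \<open>p k\<close> therefore
  suffices.\<close>

lemma system_continuous:
  assumes \<Theta>: "\<Theta> \<subseteq> \<Lambda> \<times> UNIV" and i: "i < 2 * n"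
  shows "continuous_on (\<Theta> \<times> {a..b}) (\<lambda>(\<theta>, s). system \<theta> i j s)"
proof -
  have pc: "continuous_on (\<Theta> \<times> {a..b}) (\<lambda>z. p k (snd z) (fst (fst z)))" if "k \<le> n" for k
  proof -
    have "continuous_on (\<Theta> \<times> {a..b}) (\<lambda>z. (\<lambda>(x, l). p k x l) (snd z, fst (fst z)))"
      using \<Theta> by (intro continuous_on_compose2[OF p_cont[OF that]] continuous_intros) auto
    then show ?thesis by simp
  qed
  have nz: "p 0 (snd z) (fst (fst z)) \<noteq> 0" if "z \<in> \<Theta> \<times> {a..b}" for z
    using p0_pos[of "fst (fst z)" "snd z"] that \<Theta> by force
  show ?thesis
  proof (cases "i < n")
    case True
    have c1: "continuous_on (\<Theta> \<times> {a..b}) (\<lambda>z. 1 / complex_of_real (p 0 (snd z) (fst (fst z))))"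
      using nz pc[of 0] by (intro continuous_intros) auto
    show ?thesis unfolding sysmat_def case_prod_beta if_P[OF True]
      by (intro continuous_on_if_const c1 continuous_on_const)
  next
    case False
    have k: "i + 1 - n \<le> n" using i by simp
    show ?thesis unfolding sysmat_def case_prod_beta if_not_P[OF False]
      by (intro continuous_on_if_const continuous_on_diff continuous_on_of_real pc[OF k] continuous_intros)
  qed
qed

lemma system_bounded:
  assumes \<Theta>: "\<Theta> \<subseteq> \<Lambda> \<times> UNIV" and cpt: "compact \<Theta>"
  shows "\<exists>M\<ge>0. \<forall>\<theta>\<in>\<Theta>. \<forall>i<2 * n. \<forall>j<2 * n. \<forall>s\<in>{a..b}. norm (system \<theta> i j s) \<le> M"
proof -
  have "\<exists>C. \<forall>\<theta>\<in>\<Theta>. \<forall>s\<in>{a..b}. norm (system \<theta> i j s) \<le> C" if "i < 2 * n" for i j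
  proof -
    have "bounded ((\<lambda>(\<theta>, s). system \<theta> i j s) ` (\<Theta> \<times> {a..b}))"
      using system_continuous[OF \<Theta> that] cpt by (intro compact_imp_bounded compact_continuous_image compact_Times) auto
    then obtain B where "\<forall>z\<in>(\<lambda>(\<theta>, s). system \<theta> i j s) ` (\<Theta> \<times> {a..b}). norm z \<le> B"
      unfolding bounded_iff by blast
    then show ?thesis by (intro exI[of _ B]) force
  qed
  then obtain C where C: "\<And>i j \<theta> s. i < 2 * n \<Longrightarrow> \<theta> \<in> \<Theta> \<Longrightarrow> s \<in> {a..b} \<Longrightarrow> norm (system \<theta> i j s) \<le> C i j"
    by metis
  define M where "M = (\<Sum>i<2 * n. \<Sum>j<2 * n. \<bar>C i j\<bar>)"
  have "norm (system \<theta> i j s) \<le> M" if "\<theta> \<in> \<Theta>" "i < 2 * n" "j < 2 * n" "s \<in> {a..b}" for \<theta> i j s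
  proof -
    have "norm (system \<theta> i j s) \<le> \<bar>C i j\<bar>" using C[OF that(2,1,4), of j] by linarith
    also have "\<dots> \<le> (\<Sum>j<2 * n. \<bar>C i j\<bar>)" using that by (intro member_le_sum) auto
    also have "\<dots> \<le> M" unfolding M_def using that by (intro member_le_sum) (auto intro: sum_nonneg)
    finally show ?thesis .
  qed
  moreover have "M \<ge> 0" unfolding M_def by (intro sum_nonneg) auto
  ultimately show ?thesis by blast
qed

definition Phi :: "real \<Rightarrow> complex \<Rightarrow> nat \<Rightarrow> nat \<Rightarrow> real \<Rightarrow> complex" where
  "Phi l \<mu> i j x = fundmat (2 * n) (sysmat n (coef l) \<mu>) a i j x"

lemma Phi_continuous:
  assumes \<Theta>: "\<Theta> \<subseteq> \<Lambda> \<times> UNIV" and cpt: "compact \<Theta>" and i: "i < 2 * n"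
  shows "continuous_on (\<Theta> \<times> {a..b}) (\<lambda>(\<theta>, x). Phi (fst \<theta>) (snd \<theta>) i j x)"
proof -
  obtain M where M: "M \<ge> 0" "\<forall>\<theta>\<in>\<Theta>. \<forall>i<2 * n. \<forall>j<2 * n. \<forall>s\<in>{a..b}. norm (system \<theta> i j s) \<le> M"
    using system_bounded[OF \<Theta> cpt] by (elim exE conjE) (rule that, assumption+)
  have "continuous_on (\<Theta> \<times> {a..b}) (\<lambda>(\<theta>, x). fundmat (2 * n) (system \<theta>) a i j x)"
    by (rule fundmat_continuous_param[where M = M, OF system_continuous[OF \<Theta>] M(2)[rule_format] M(1) less_imp_le[OF ab] i])
  then show ?thesis unfolding Phi_def .
qed

lemma fundamental_facts:
  assumes l: "l \<in> \<Lambda>"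
  shows Phi_linsol: "linsol (2 * n) (sysmat n (coef l) \<mu>) a b (\<lambda>i. Phi l \<mu> i j)"
    and Phi_initial: "i < 2 * n \<Longrightarrow> Phi l \<mu> i j a = (if i = j then 1 else 0)"
    and linsol_eq_Phi: "linsol (2 * n) (sysmat n (coef l) \<mu>) a b Y \<Longrightarrow> i < 2 * n \<Longrightarrow> x \<in> {a..b} \<Longrightarrow>
       Y i x = (\<Sum>j<2 * n. Phi l \<mu> i j x * Y j a)"
proof -
  \<comment> \<open>A single parameter point is compact, so the parametric results specialise to
    ordinary existence and uniqueness.\<close>
  let ?\<Theta> = "{(l, \<mu>)}"
  have \<Theta>: "?\<Theta> \<subseteq> \<Lambda> \<times> UNIV" using l by auto
  have cpt: "compact ?\<Theta>" by simp
  obtain M where M: "M \<ge> 0" "\<forall>\<theta>\<in>?\<Theta>. \<forall>i<2 * n. \<forall>j<2 * n. \<forall>s\<in>{a..b}. norm (system \<theta> i j s) \<le> M"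
    using system_bounded[OF \<Theta> cpt] by (elim exE conjE) (rule that, assumption+)
  have c: "continuous_on (?\<Theta> \<times> {a..b}) (\<lambda>(\<theta>, s). system \<theta> i j s)" if "i < 2 * n" "j < 2 * n" for i j
    by (rule system_continuous[OF \<Theta> that(1)])
  have bd: "norm (system \<theta> i j s) \<le> M" if "\<theta> \<in> ?\<Theta>" "i < 2 * n" "j < 2 * n" "s \<in> {a..b}" for \<theta> i j s
    using M(2) that by blast
  note hyp = c bd M(1) less_imp_le[OF ab]
  have mem: "(l, \<mu>) \<in> ?\<Theta>" by simp
  have e: "system (l, \<mu>) = sysmat n (coef l) \<mu>" by simp
  show "linsol (2 * n) (sysmat n (coef l) \<mu>) a b (\<lambda>i. Phi l \<mu> i j)"
    using fundmat_linsol[where A = system and M = M and N = "2 * n", OF hyp mem, of j] unfolding Phi_def e .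
  show "Phi l \<mu> i j a = (if i = j then 1 else 0)" if "i < 2 * n"
    using fundmat_initial[where A = system and M = M and N = "2 * n", OF hyp that mem, of j] unfolding Phi_def e .
  show "Y i x = (\<Sum>j<2 * n. Phi l \<mu> i j x * Y j a)"
    if "linsol (2 * n) (sysmat n (coef l) \<mu>) a b Y" "i < 2 * n" "x \<in> {a..b}"
  proof -
    have "linsol (2 * n) (system (l, \<mu>)) a b Y" using that(1) by simp
    from linsol_eq_fundmat[where A = system and M = M and N = "2 * n" and Y = Y, OF hyp mem this that(2,3)]
    show ?thesis unfolding Phi_def e .
  qed
qed

lemma Phi_holomorphic:
  assumes l: "l \<in> \<Lambda>" and i: "i < 2 * n" and x: "x \<in> {a..b}"
  shows "(\<lambda>\<mu>. Phi l \<mu> i j x) holomorphic_on UNIV"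
proof -
  let ?A0 = "sysmat n (coef l) 0"
  \<comment> \<open>The spectral parameter occurs in one entry only, in the last row and column
    0.\<close>
  let ?A1 = "\<lambda>i j s. (if i + 1 = 2 * n \<and> j = 0 then - 1 else 0) :: complex"
  have e: "sysmat n (coef l) \<mu> = (\<lambda>i j s. ?A0 i j s + \<mu> * ?A1 i j s)" for \<mu>
    using n by (intro ext) (auto simp: sysmat_def)
  have c0: "continuous_on {a..b} (?A0 i j)" if "i < 2 * n" for i j
  proof -
    have "continuous_on ({(l, 0)} \<times> {a..b}) (\<lambda>(\<theta>, s). system \<theta> i j s)"
      using l by (intro system_continuous that) auto
    then have "continuous_on {a..b} ((\<lambda>(\<theta>, s). system \<theta> i j s) \<circ> (\<lambda>s. ((l, 0), s)))"
      by (intro continuous_on_compose continuous_intros) (auto elim!: continuous_on_subset)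
    then show ?thesis by (simp add: o_def)
  qed
  have "(\<lambda>\<mu>. fundmat (2 * n) (\<lambda>i j s. ?A0 i j s + \<mu> * ?A1 i j s) a i j x) holomorphic_on UNIV"
    by (rule fundmat_holomorphic[OF c0 continuous_on_const i x])
  then show ?thesis unfolding Phi_def by (simp only: e[symmetric])
qed

definition sol :: "real \<Rightarrow> complex \<Rightarrow> (nat \<Rightarrow> complex) \<Rightarrow> nat \<Rightarrow> real \<Rightarrow> complex" where
  "sol l \<mu> c = (\<lambda>i x. \<Sum>j<2 * n. Phi l \<mu> i j x * c j)"

lemma sol_linsol: "l \<in> \<Lambda> \<Longrightarrow> linsol (2 * n) (sysmat n (coef l) \<mu>) a b (sol l \<mu> c)"
  unfolding sol_def by (rule linsol_lincomb[where F = "\<lambda>j i. Phi l \<mu> i j"]) (rule Phi_linsol)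

lemma sol_initial: "l \<in> \<Lambda> \<Longrightarrow> i < 2 * n \<Longrightarrow> sol l \<mu> c i a = c i"
  by (simp add: sol_def Phi_initial if_distrib[where f = "\<lambda>t. t * _"] cong: if_cong)

lemma linsol_eq_sol:
  "l \<in> \<Lambda> \<Longrightarrow> linsol (2 * n) (sysmat n (coef l) \<mu>) a b Y \<Longrightarrow> i < 2 * n \<Longrightarrow> x \<in> {a..b} \<Longrightarrow> Y i x = sol l \<mu> (\<lambda>j. Y j a) i x"
  unfolding sol_def by (rule linsol_eq_Phi)

text \<open>Initial data are determined by the L_2 class of the solution. Hence eigenspaces can be
  identified with kernels of the boundary matrix, and a solution of norm 0 has zero data.\<close>

lemma sol_zero:
  assumes l: "l \<in> \<Lambda>" and z: "sqint a b (sol l \<mu> c 0) = 0" and i: "i < 2 * n"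
  shows "c i = 0"
proof -
  have "sol l \<mu> c i a = 0"
    by (rule linsol_zero_of_sqint_zero[OF n ab _ sol_linsol[OF l] z i]) (use p0_pos[OF l] ab in auto)
  then show ?thesis using sol_initial[OF l i] by simp
qed

definition bmat :: "real \<Rightarrow> complex \<Rightarrow> nat \<Rightarrow> nat \<Rightarrow> complex" where
  "bmat l \<mu> i j = vec_index (bc_defect n a b (U l) (\<lambda>i. Phi l \<mu> i j)) i"

lemma bc_defect_sol:
  assumes "l \<in> \<Lambda>" "i < 2 * n"
  shows "vec_index (bc_defect n a b (U l) (sol l \<mu> c)) i = (\<Sum>j<2 * n. bmat l \<mu> i j * c j)"
  unfolding sol_def bmat_def by (rule bc_defect_lincomb[OF U_carrier[OF assms(1)] assms(2)])

definition chardet :: "real \<Rightarrow> complex \<Rightarrow> complex" where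
  "chardet l \<mu> = Determinant.det (mat (2 * n) (2 * n) (\<lambda>(i, j). bmat l \<mu> i j))"

lemma bhat_index: "i < 2 * n \<Longrightarrow> vec_index (bhat n a b Y) i = (if i < n then Y i a else Y (i - n) b)"
  by (simp add: bhat_def)

lemma bcheck_index: "i < 2 * n \<Longrightarrow> vec_index (bcheck n a b Y) i = (if i < n then Y (2 * n - 1 - i) a else - Y (2 * n - 1 - (i - n)) b)"
  by (simp add: bcheck_def)

lemma bmat_holomorphic:
  assumes l: "l \<in> \<Lambda>" and i: "i < 2 * n"
  shows "(\<lambda>\<mu>. bmat l \<mu> i j) holomorphic_on UNIV"
proof -
  have a: "a \<in> {a..b}" "b \<in> {a..b}" using ab by auto
  have v: "(\<lambda>\<mu>. vec_index (bcheck n a b (\<lambda>i. Phi l \<mu> i j)) k) holomorphic_on UNIV" if "k < 2 * n" for k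
    using that a by (cases "k < n") (auto simp: bcheck_index intro!: holomorphic_intros Phi_holomorphic[OF l])
  have u: "(\<lambda>\<mu>. vec_index (bhat n a b (\<lambda>i. Phi l \<mu> i j)) k) holomorphic_on UNIV" if "k < 2 * n" for k
    using that a by (cases "k < n") (auto simp: bhat_index intro!: holomorphic_intros Phi_holomorphic[OF l])
  show ?thesis unfolding bmat_def bc_defect_index[OF U_carrier[OF l] i]
    by (intro holomorphic_intros v u i) auto
qed

lemma bmat_continuous:
  assumes \<Theta>: "\<Theta> \<subseteq> \<Lambda> \<times> UNIV" and cpt: "compact \<Theta>" and i: "i < 2 * n"
  shows "continuous_on \<Theta> (\<lambda>\<theta>. bmat (fst \<theta>) (snd \<theta>) i j)"
proof -
  have a: "a \<in> {a..b}" "b \<in> {a..b}" using ab by auto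
  have P: "continuous_on \<Theta> (\<lambda>\<theta>. Phi (fst \<theta>) (snd \<theta>) k j x)" if "k < 2 * n" "x \<in> {a..b}" for k x
  proof -
    have "continuous_on \<Theta> ((\<lambda>(\<theta>, x). Phi (fst \<theta>) (snd \<theta>) k j x) \<circ> (\<lambda>\<theta>. (\<theta>, x)))"
      using that by (intro continuous_on_compose continuous_intros continuous_on_subset[OF Phi_continuous[OF \<Theta> cpt that(1)]]) auto
    then show ?thesis by (simp add: o_def)
  qed
  have v: "continuous_on \<Theta> (\<lambda>\<theta>. vec_index (bcheck n a b (\<lambda>i. Phi (fst \<theta>) (snd \<theta>) i j)) k)" if "k < 2 * n" for k
    using that a by (cases "k < n") (auto simp: bcheck_index intro!: continuous_intros P)
  have u: "continuous_on \<Theta> (\<lambda>\<theta>. vec_index (bhat n a b (\<lambda>i. Phi (fst \<theta>) (snd \<theta>) i j)) k)" if "k < 2 * n" for k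
    using that a by (cases "k < n") (auto simp: bhat_index intro!: continuous_intros P)
  have Uc: "continuous_on \<Theta> (\<lambda>\<theta>. U (fst \<theta>) $$ (i, k))" if "k < 2 * n" for k
    using \<Theta> by (intro continuous_on_compose2[OF U_cont[OF i that]] continuous_intros) auto
  have "continuous_on \<Theta> (\<lambda>\<theta>. (\<Sum>k<2 * n. U (fst \<theta>) $$ (i, k) * (vec_index (bcheck n a b (\<lambda>i. Phi (fst \<theta>) (snd \<theta>) i j)) k
       + \<i> * vec_index (bhat n a b (\<lambda>i. Phi (fst \<theta>) (snd \<theta>) i j)) k))
      - (vec_index (bcheck n a b (\<lambda>i. Phi (fst \<theta>) (snd \<theta>) i j)) i - \<i> * vec_index (bhat n a b (\<lambda>i. Phi (fst \<theta>) (snd \<theta>) i j)) i))"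
    by (intro continuous_intros Uc v u i) auto
  then show ?thesis
    by (rule continuous_on_eq) (use \<Theta> U_carrier in \<open>auto simp: bmat_def bc_defect_index[OF _ i]\<close>)
qed

lemma chardet_holomorphic: "l \<in> \<Lambda> \<Longrightarrow> chardet l holomorphic_on S"
  unfolding chardet_def
  by (rule holomorphic_on_subset[OF det_mat_holomorphic[OF bmat_holomorphic]]) auto

lemma chardet_continuous:
  assumes "\<Theta> \<subseteq> \<Lambda> \<times> UNIV" "compact \<Theta>"
  shows "continuous_on \<Theta> (\<lambda>\<theta>. chardet (fst \<theta>) (snd \<theta>))"
  unfolding chardet_def by (rule det_mat_continuous[OF bmat_continuous[OF assms]])

lemma chardet_zeroD:
  assumes l: "l \<in> \<Lambda>" and "chardet l \<mu> = 0"
  shows "\<exists>c. (\<forall>i<2 * n. (\<Sum>j<2 * n. bmat l \<mu> i j * c j) = 0) \<and> sqint a b (sol l \<mu> c 0) > 0"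
proof -
  have "\<not> col_indep (2 * n) (bmat l \<mu>) {..<2 * n}"
    using assms(2) unfolding chardet_def using det_mat_nonzero_iff by blast
  then obtain c k where c: "\<forall>i<2 * n. (\<Sum>j<2 * n. bmat l \<mu> i j * c j) = 0" "k < 2 * n" "c k \<noteq> 0"
    unfolding col_indep_def by blast
  have "sqint a b (sol l \<mu> c 0) \<noteq> 0" using sol_zero[OF l _ c(2)] c(3) by blast
  moreover have "sqint a b (sol l \<mu> c 0) \<ge> 0"
    using n by (intro sqint_nonneg linsol_continuous[OF sol_linsol[OF l]]) auto
  ultimately show ?thesis using c(1) by (intro exI[of _ c]) auto
qed

lemma sol_energy_defect:
  assumes l: "l \<in> \<Lambda>"
  shows "4 * Im \<mu> * sqint a b (sol l \<mu> c 0) = (\<Sum>i<2 * n. 2 * Re ((\<Sum>j<2 * n. bmat l \<mu> i j * c j) *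
      cnj (vec_index (bcheck n a b (sol l \<mu> c)) i - \<i> * vec_index (bhat n a b (sol l \<mu> c)) i)) + (norm (\<Sum>j<2 * n. bmat l \<mu> i j * c j))\<^sup>2)"
proof -
  have "4 * Im \<mu> * sqint a b (sol l \<mu> c 0) = (\<Sum>i<2 * n. 2 * Re (vec_index (bc_defect n a b (U l) (sol l \<mu> c)) i *
      cnj (vec_index (bcheck n a b (sol l \<mu> c)) i - \<i> * vec_index (bhat n a b (sol l \<mu> c)) i)) + (norm (vec_index (bc_defect n a b (U l) (sol l \<mu> c)) i))\<^sup>2)"
    by (rule energy_defect[OF n ab _ _ sol_linsol[OF l] U_carrier[OF l] U_unitary[OF l]])
      (use coef_continuous[OF l] p0_pos[OF l] in auto)
  also have "\<dots> = (\<Sum>i<2 * n. 2 * Re ((\<Sum>j<2 * n. bmat l \<mu> i j * c j) *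
      cnj (vec_index (bcheck n a b (sol l \<mu> c)) i - \<i> * vec_index (bhat n a b (sol l \<mu> c)) i)) + (norm (\<Sum>j<2 * n. bmat l \<mu> i j * c j))\<^sup>2)"
    by (rule sum.cong[OF refl]) (simp only: bc_defect_sol[OF l] lessThan_iff)
  finally show ?thesis .
qed

lemma chardet_zero_real:
  assumes l: "l \<in> \<Lambda>" and "chardet l \<mu> = 0"
  shows "Im \<mu> = 0"
proof -
  obtain c where c: "\<forall>i<2 * n. (\<Sum>j<2 * n. bmat l \<mu> i j * c j) = 0" "sqint a b (sol l \<mu> c 0) > 0"
    using chardet_zeroD[OF assms] by (elim exE conjE)
  have "4 * Im \<mu> * sqint a b (sol l \<mu> c 0) = 0"
    unfolding sol_energy_defect[OF l] by (rule sum.neutral) (use c(1) in auto)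
  then show ?thesis using c(2) by simp
qed

section \<open>Absence of Jordan chains\<close>

lemma Phi_tendsto:
  assumes l: "l \<in> \<Lambda>" and i: "i < 2 * n" and x: "x \<in> {a..b}"
  shows "((\<lambda>t. Phi l (\<mu> + \<i> * of_real t) i j x) \<longlongrightarrow> Phi l \<mu> i j x) (at_right 0)"
proof -
  have "isCont (\<lambda>z. Phi l z i j x) (\<mu> + \<i> * of_real 0)"
    using holomorphic_on_imp_continuous_on[OF Phi_holomorphic[OF l i x]] continuous_on_eq_continuous_at[OF open_UNIV] by blast
  then have "((\<lambda>t. Phi l (\<mu> + \<i> * of_real t) i j x) \<longlongrightarrow> Phi l (\<mu> + \<i> * of_real 0) i j x) (at_right 0)"
    by (rule isCont_tendsto_compose) (intro tendsto_intros)
  then show ?thesis by simp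
qed

text \<open>The Gram matrix of the zeroth row of the fundamental matrix. It turns ||y||^2 into a
  finite Hermitian form in the initial data, so that limits of data and of \<mu> can be taken
  together.\<close>

definition gram :: "real \<Rightarrow> complex \<Rightarrow> nat \<Rightarrow> nat \<Rightarrow> complex" where
  "gram l \<mu> j k = integral {a..b} (\<lambda>x. Phi l \<mu> 0 j x * cnj (Phi l \<mu> 0 k x))"

lemma sqint_sol_eq_gram:
  assumes l: "l \<in> \<Lambda>"
  shows "complex_of_real (sqint a b (sol l \<mu> c 0)) = (\<Sum>j<2 * n. \<Sum>k<2 * n. c j * cnj (c k) * gram l \<mu> j k)"
proof -
  have P: "continuous_on {a..b} (Phi l \<mu> 0 j)" for j
    using linsol_continuous[OF Phi_linsol[OF l], of 0] n by simp
  have S: "continuous_on {a..b} (sol l \<mu> c 0)"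
    using linsol_continuous[OF sol_linsol[OF l], of 0] n by simp
  have i: "(\<lambda>t. (norm (sol l \<mu> c 0 t))\<^sup>2) integrable_on {a..b}"
    by (intro integrable_continuous_interval continuous_intros S)
  have "((\<lambda>t. complex_of_real ((norm (sol l \<mu> c 0 t))\<^sup>2)) has_integral complex_of_real (sqint a b (sol l \<mu> c 0))) {a..b}"
    by (intro has_integral_of_real integrable_integral i)
  then have "complex_of_real (sqint a b (sol l \<mu> c 0)) = integral {a..b} (\<lambda>t. complex_of_real ((norm (sol l \<mu> c 0 t))\<^sup>2))"
    by (rule integral_unique[symmetric])
  also have "\<dots> = integral {a..b} (\<lambda>t. \<Sum>j<2 * n. \<Sum>k<2 * n. c j * cnj (c k) * (Phi l \<mu> 0 j t * cnj (Phi l \<mu> 0 k t)))"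
    unfolding complex_norm_square sol_def by (simp only: sum_product cnj_sum complex_cnj_mult mult_ac)
  also have "\<dots> = (\<Sum>j<2 * n. \<Sum>k<2 * n. integral {a..b} (\<lambda>t. c j * cnj (c k) * (Phi l \<mu> 0 j t * cnj (Phi l \<mu> 0 k t))))"
  proof -
    have pi: "(\<lambda>t. c j * cnj (c k) * (Phi l \<mu> 0 j t * cnj (Phi l \<mu> 0 k t))) integrable_on {a..b}" for j k
      by (intro integrable_continuous_interval continuous_intros P)
    show ?thesis
      by (subst integral_sum, simp, intro integrable_sum pi, simp, intro sum.cong refl integral_sum pi, simp)
  qed
  finally show ?thesis by (simp add: gram_def)
qed

lemma gram_tendsto:
  assumes l: "l \<in> \<Lambda>"
  shows "((\<lambda>t. gram l (\<mu> + \<i> * of_real t) j k) \<longlongrightarrow> gram l \<mu> j k) (at_right 0)"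
proof -
  let ?\<Theta> = "{l} \<times> cball \<mu> 1"
  have \<Theta>: "?\<Theta> \<subseteq> \<Lambda> \<times> UNIV" "compact ?\<Theta>" using l by (auto intro: compact_Times)
  have P: "continuous_on (cball \<mu> 1 \<times> {a..b}) (\<lambda>z. Phi l (fst z) 0 j (snd z))" for j
  proof -
    have "continuous_on (cball \<mu> 1 \<times> {a..b}) (\<lambda>z. (\<lambda>(\<theta>, x). Phi (fst \<theta>) (snd \<theta>) 0 j x) ((l, fst z), snd z))"
      using n by (intro continuous_on_compose2[OF Phi_continuous[OF \<Theta>, of 0]] continuous_intros) auto
    then show ?thesis by simp
  qed
  have "continuous_on (cball \<mu> 1) (\<lambda>z. integral (cbox a b) (\<lambda>x. Phi l z 0 j x * cnj (Phi l z 0 k x)))"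
  proof (rule integral_continuous_on_param)
    show "continuous_on (cball \<mu> 1 \<times> cbox a b) (\<lambda>(z, x). Phi l z 0 j x * cnj (Phi l z 0 k x))"
      unfolding case_prod_beta box_real by (intro continuous_intros P)
  qed
  then have "continuous_on (ball \<mu> 1) (\<lambda>z. gram l z j k)"
    unfolding gram_def by (auto elim!: continuous_on_subset)
  then have "\<forall>z\<in>ball \<mu> 1. isCont (\<lambda>z. gram l z j k) z"
    by (simp only: continuous_on_eq_continuous_at[OF open_ball])
  then have "isCont (\<lambda>z. gram l z j k) (\<mu> + \<i> * of_real 0)" by (rule bspec) simp
  then have "((\<lambda>t. gram l (\<mu> + \<i> * of_real t) j k) \<longlongrightarrow> gram l (\<mu> + \<i> * of_real 0) j k) (at_right 0)"
    by (rule isCont_tendsto_compose) (intro tendsto_intros)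
  then show ?thesis by simp
qed

text \<open>At height t above \<mu>, \<open>sol_energy_defect\<close> reads 4 t ||y||^2 = sum of 2
  Re(d cnj R) + |d|^2 with defect d = o(t) and R convergent. Division by t shows ||y|| \<rightarrow>
  0, so the limit data give the zero solution. This is the bound on the inverse boundary matrix that
  self-adjointness provides.\<close>

lemma bmat_nondegenerate:
  fixes \<mu> :: real
  assumes l: "l \<in> \<Lambda>" and w: "\<And>j. j < 2 * n \<Longrightarrow> ((\<lambda>t. w t j) \<longlongrightarrow> w0 j) (at_right 0)"
    and B: "\<And>i. i < 2 * n \<Longrightarrow> ((\<lambda>t. (\<Sum>j<2 * n. bmat l (of_real \<mu> + \<i> * of_real t) i j * w t j) / of_real t) \<longlongrightarrow> 0) (at_right (0::real))"
    and j: "j < 2 * n"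
  shows "w0 j = 0"
proof -
  define z where "z = (\<lambda>t::real. complex_of_real \<mu> + \<i> * of_real t)"
  define Y where "Y = (\<lambda>t. sol l (z t) (w t))"
  define d where "d = (\<lambda>t i. \<Sum>j<2 * n. bmat l (z t) i j * w t j)"
  define R where "R = (\<lambda>t i. vec_index (bcheck n a b (Y t)) i - \<i> * vec_index (bhat n a b (Y t)) i)"
  have aI: "a \<in> {a..b}" "b \<in> {a..b}" using ab by auto
  have Yl: "((\<lambda>t. Y t i x) \<longlongrightarrow> sol l (of_real \<mu>) w0 i x) (at_right 0)" if "i < 2 * n" "x \<in> {a..b}" for i x
    unfolding Y_def sol_def z_def by (intro tendsto_sum tendsto_mult Phi_tendsto[OF l that] w) auto
  have "\<exists>R0. ((\<lambda>t. R t i) \<longlongrightarrow> R0) (at_right 0)" if i: "i < 2 * n" for i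
  proof (cases "i < n")
    case True
    then have "((\<lambda>t. Y t (2 * n - 1 - i) a - \<i> * Y t i a) \<longlongrightarrow>
        sol l (of_real \<mu>) w0 (2 * n - 1 - i) a - \<i> * sol l (of_real \<mu>) w0 i a) (at_right 0)"
      using i by (intro tendsto_diff tendsto_mult tendsto_const Yl aI) auto
    then show ?thesis using True unfolding R_def bcheck_index[OF i] bhat_index[OF i] by auto
  next
    case False
    then have "((\<lambda>t. - Y t (2 * n - 1 - (i - n)) b - \<i> * Y t (i - n) b) \<longlongrightarrow>
        - sol l (of_real \<mu>) w0 (2 * n - 1 - (i - n)) b - \<i> * sol l (of_real \<mu>) w0 (i - n) b) (at_right 0)"
      using i by (intro tendsto_diff tendsto_minus tendsto_mult tendsto_const Yl aI) auto
    then show ?thesis using False unfolding R_def bcheck_index[OF i] bhat_index[OF i] by auto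
  qed
  then obtain R0 where R0: "\<And>i. i < 2 * n \<Longrightarrow> ((\<lambda>t. R t i) \<longlongrightarrow> R0 i) (at_right 0)" by metis
  have dq: "((\<lambda>t. d t i / of_real t) \<longlongrightarrow> 0) (at_right 0)" if "i < 2 * n" for i
    using B[OF that] unfolding d_def z_def .
  have t0: "((\<lambda>t::real. complex_of_real t) \<longlongrightarrow> of_real 0) (at_right 0)" by (intro tendsto_intros)
  have d0: "((\<lambda>t. of_real t * (d t i / of_real t)) \<longlongrightarrow> of_real 0 * 0) (at_right 0)" if "i < 2 * n" for i
    by (intro tendsto_mult t0 dq that)
  \<comment> \<open>The quotient |d|^2 / t is spelled as |d / t| times |t (d / t)|, so that every
    factor has a limit known from \<open>dq\<close> and \<open>d0\<close>.\<close>
  have "((\<lambda>t. \<Sum>i<2 * n. 2 * Re ((d t i / of_real t) * cnj (R t i)) + norm (d t i / of_real t) * norm (of_real t * (d t i / of_real t))) \<longlongrightarrow>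
      (\<Sum>i<2 * n. 2 * Re (0 * cnj (R0 i)) + norm (0::complex) * norm (of_real 0 * 0 :: complex))) (at_right 0)"
    by (intro tendsto_sum tendsto_add tendsto_mult tendsto_const tendsto_Re tendsto_cnj tendsto_norm dq d0 R0 t0) auto
  then have lim0: "((\<lambda>t. \<Sum>i<2 * n. 2 * Re ((d t i / of_real t) * cnj (R t i)) + norm (d t i / of_real t) * norm (of_real t * (d t i / of_real t))) \<longlongrightarrow> 0) (at_right 0)"
    by simp
  have eq: "(\<Sum>i<2 * n. 2 * Re ((d t i / of_real t) * cnj (R t i)) + norm (d t i / of_real t) * norm (of_real t * (d t i / of_real t)))
      = 4 * sqint a b (Y t 0)" if t: "t > 0" for t
  proof -
    have "4 * t * sqint a b (Y t 0) = (\<Sum>i<2 * n. 2 * Re (d t i * cnj (R t i)) + (norm (d t i))\<^sup>2)"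
      using sol_energy_defect[OF l, of "z t" "w t"] unfolding Y_def d_def R_def z_def by simp
    then have "4 * sqint a b (Y t 0) = (\<Sum>i<2 * n. 2 * Re (d t i * cnj (R t i)) + (norm (d t i))\<^sup>2) / t"
      using t by (simp add: field_simps)
    also have "\<dots> = (\<Sum>i<2 * n. 2 * Re ((d t i / of_real t) * cnj (R t i)) + norm (d t i / of_real t) * norm (of_real t * (d t i / of_real t)))"
      unfolding sum_divide_distrib
    proof (rule sum.cong[OF refl])
      fix i
      have "Re ((d t i / of_real t) * cnj (R t i)) = Re (d t i * cnj (R t i)) / t"
        by (simp only: times_divide_eq_left Re_divide_of_real)
      moreover have "norm (d t i / of_real t) * norm (of_real t * (d t i / of_real t)) = (norm (d t i))\<^sup>2 / t"
        using t by (simp add: norm_divide power2_eq_square)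
      ultimately show "(2 * Re (d t i * cnj (R t i)) + (norm (d t i))\<^sup>2) / t
         = 2 * Re ((d t i / of_real t) * cnj (R t i)) + norm (d t i / of_real t) * norm (of_real t * (d t i / of_real t))"
        by (simp only: add_divide_distrib times_divide_eq_right)
    qed
    finally show ?thesis by simp
  qed
  have lim1: "((\<lambda>t. 4 * sqint a b (Y t 0)) \<longlongrightarrow> 0) (at_right 0)"
  proof (rule Lim_transform_eventually[OF lim0])
    show "\<forall>\<^sub>F t in at_right 0. (\<Sum>i<2 * n. 2 * Re ((d t i / of_real t) * cnj (R t i)) + norm (d t i / of_real t) * norm (of_real t * (d t i / of_real t)))
      = 4 * sqint a b (Y t 0)"
      unfolding eventually_at_filter using eq by (intro always_eventually) auto
  qed
  have "((\<lambda>t. complex_of_real (sqint a b (Y t 0))) \<longlongrightarrow> of_real (sqint a b (sol l (of_real \<mu>) w0 0))) (at_right 0)"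
    unfolding Y_def sqint_sol_eq_gram[OF l] z_def
    by (intro tendsto_sum tendsto_mult tendsto_cnj gram_tendsto[OF l] w) auto
  then have "((\<lambda>t. sqint a b (Y t 0)) \<longlongrightarrow> sqint a b (sol l (of_real \<mu>) w0 0)) (at_right 0)"
    by (simp only: tendsto_of_real_iff)
  then have "((\<lambda>t. 4 * sqint a b (Y t 0)) \<longlongrightarrow> 4 * sqint a b (sol l (of_real \<mu>) w0 0)) (at_right 0)"
    by (intro tendsto_mult tendsto_const)
  then have "4 * sqint a b (sol l (of_real \<mu>) w0 0) = 0"
    by (rule tendsto_unique[OF trivial_limit_at_right_real _ lim1])
  then show ?thesis using sol_zero[OF l _ j] by simp
qed

end

section \<open>Counting eigenvalues\<close>

interpretation cfun: vector_space "\<lambda>(c::complex) (f::real \<Rightarrow> complex). (\<lambda>x. c * f x)"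
  by unfold_locales (auto simp: algebra_simps)

lemma sum_fun_apply: "(\<Sum>i\<in>I. f i) x = (\<Sum>i\<in>I. f i x)" for f :: "'i \<Rightarrow> 'a \<Rightarrow> 'b::comm_monoid_add"
  by (induction I rule: infinite_finite_induct) auto

context parametric_bvp
begin

lemma eigsp_quasi:
  assumes l: "l \<in> \<Lambda>" and y: "y \<in> eigsp n p U a b l \<mu>"
  shows eigsp_eq_Phi: "x \<in> {a..b} \<Longrightarrow> y x = (\<Sum>j<2 * n. Phi l \<mu> 0 j x * quasi n p a b l y j a)"
    and eigsp_bmat: "i < 2 * n \<Longrightarrow> (\<Sum>j<2 * n. bmat l \<mu> i j * quasi n p a b l y j a) = 0"
proof -
  let ?Y = "quasi n p a b l y"
  note hyp = n ab p0_pos[OF l] p_Cm[OF l]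
  have lin: "linsol (2 * n) (sysmat n (coef l) \<mu>) a b ?Y" by (rule eigsp_imp_linsol(1)[OF hyp y])
  have bc: "boundary_condition n a b (U l) ?Y" by (rule eigsp_imp_linsol(2)[OF hyp y])
  show "y x = (\<Sum>j<2 * n. Phi l \<mu> 0 j x * ?Y j a)" if "x \<in> {a..b}"
  proof -
    have "?Y 0 x = y x" using n by (simp add: quasi_def)
    moreover have "?Y 0 x = (\<Sum>j<2 * n. Phi l \<mu> 0 j x * ?Y j a)"
      using n by (intro linsol_eq_Phi[OF l lin] that) auto
    ultimately show ?thesis by simp
  qed
  show "(\<Sum>j<2 * n. bmat l \<mu> i j * ?Y j a) = 0" if i: "i < 2 * n"
  proof -
    have "bc_defect n a b (U l) ?Y = bc_defect n a b (U l) (sol l \<mu> (\<lambda>j. ?Y j a))"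
      by (rule bc_defect_cong[OF less_imp_le[OF ab]]) (rule linsol_eq_sol[OF l lin])
    moreover have "vec_index (bc_defect n a b (U l) ?Y) i = 0"
      using bc i unfolding boundary_condition_iff_index[OF U_carrier[OF l]] by blast
    ultimately show ?thesis using bc_defect_sol[OF l i, of \<mu> "\<lambda>j. ?Y j a"] by simp
  qed
qed

lemma sol_in_eigsp:
  assumes l: "l \<in> \<Lambda>" and c: "\<And>i. i < 2 * n \<Longrightarrow> (\<Sum>j<2 * n. bmat l \<mu> i j * c j) = 0"
  shows "(\<lambda>x. if x \<in> {a..b} then sol l \<mu> c 0 x else 0) \<in> eigsp n p U a b l \<mu>"
proof -
  have bc: "boundary_condition n a b (U l) (sol l \<mu> c)"
    unfolding boundary_condition_iff_index[OF U_carrier[OF l]] using bc_defect_sol[OF l] c by simp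
  show ?thesis
    by (rule linsol_imp_eigsp(1)[where U = U and p = p and l = l and Y = "sol l \<mu> c" and \<mu> = \<mu>,
          OF n ab p0_pos[OF l] p_Cm[OF l] sol_linsol[OF l] bc])
qed

text \<open>The multiplicity, a dimension in a space of functions, becomes the nullity of a 2n by 2n
  matrix: the initial data of a basis of the eigenspace form a basis of the kernel of
  \<open>bmat\<close>. The conclusions have the shape that \<open>zorder_det_eq_nullity\<close>
  requires.\<close>

lemma eigsp_basis:
  assumes l: "l \<in> \<Lambda>"
  shows "\<exists>C. emult n p U a b l \<mu> \<le> 2 * n \<and>
    (\<forall>i<2 * n. \<forall>k<emult n p U a b l \<mu>. (\<Sum>j<2 * n. bmat l \<mu> i j * C j k) = 0) \<and>
    col_indep (2 * n) C {..<emult n p U a b l \<mu>} \<and>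
    (\<forall>x. (\<forall>i<2 * n. (\<Sum>j<2 * n. bmat l \<mu> i j * x j) = 0) \<longrightarrow>
       (\<exists>y. \<forall>j<2 * n. x j = (\<Sum>k<emult n p U a b l \<mu>. C j k * y k)))"
proof -
  let ?E = "eigsp n p U a b l \<mu>"
  let ?Q = "\<lambda>y j. quasi n p a b l y j a"
  obtain B where B: "B \<subseteq> ?E" "cfun.independent B" "?E \<subseteq> cfun.span B" "card B = cfun.dim ?E"
    using cfun.basis_exists by blast
  \<comment> \<open>The eigenspace lies in the span of these 2n functions, which makes
    \<open>B\<close> finite and \<open>card B\<close> a genuine dimension.\<close>
  define g where "g = (\<lambda>j x. if x \<in> {a..b} then Phi l \<mu> 0 j x else 0)"
  have out: "y x = 0" if "y \<in> ?E" "x \<notin> {a..b}" for y x using that by (auto simp: eigsp_def)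
  have "?E \<subseteq> cfun.span (g ` {..<2 * n})"
  proof
    fix y assume y: "y \<in> ?E"
    have "y = (\<Sum>j<2 * n. (\<lambda>x. ?Q y j * g j x))"
    proof
      fix x
      show "y x = (\<Sum>j<2 * n. (\<lambda>x. ?Q y j * g j x)) x"
      proof (cases "x \<in> {a..b}")
        case True
        then show ?thesis using eigsp_eq_Phi[OF l y True] by (simp add: sum_fun_apply g_def mult.commute)
      next
        case False
        then show ?thesis using out[OF y False] unfolding sum_fun_apply g_def if_not_P[OF False] by simp
      qed
    qed
    moreover have "(\<Sum>j<2 * n. (\<lambda>x. ?Q y j * g j x)) \<in> cfun.span (g ` {..<2 * n})"
      by (intro cfun.span_sum cfun.span_scale cfun.span_base) auto
    ultimately show "y \<in> cfun.span (g ` {..<2 * n})" by simp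
  qed
  then have bound: "finite B \<and> card B \<le> card (g ` {..<2 * n})"
    using B by (intro cfun.independent_span_bound) auto
  moreover have "card (g ` {..<2 * n}) \<le> 2 * n" using card_image_le[of "{..<2 * n}" g] by simp
  ultimately have fin: "finite B" and le: "card B \<le> 2 * n" by auto
  define m where "m = card B"
  have em: "emult n p U a b l \<mu> = m" by (simp add: emult_def B(4) m_def)
  obtain f where f: "bij_betw f {..<m} B"
    using ex_bij_betw_nat_finite[OF fin] by (auto simp: m_def lessThan_atLeast0)
  have fE: "f k \<in> ?E" if "k < m" for k using bij_betwE[OF f] that B(1) by auto
  \<comment> \<open>Column k holds the values at a of the k-th basis function and of its
    quasi-derivatives.\<close>
  define C where "C = (\<lambda>j k. ?Q (f k) j)"
  have comb: "(\<Sum>k<m. x k * f k t) = sol l \<mu> (\<lambda>j. \<Sum>k<m. C j k * x k) 0 t" if t: "t \<in> {a..b}" for x t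
  proof -
    have "(\<Sum>k<m. x k * f k t) = (\<Sum>k<m. x k * (\<Sum>j<2 * n. Phi l \<mu> 0 j t * C j k))"
      using eigsp_eq_Phi[OF l fE t] by (intro sum.cong) (auto simp: C_def)
    also have "\<dots> = (\<Sum>j<2 * n. Phi l \<mu> 0 j t * (\<Sum>k<m. C j k * x k))"
      unfolding sum_distrib_left by (subst sum.swap) (simp add: mult_ac)
    finally show ?thesis by (simp add: sol_def)
  qed
  show ?thesis unfolding em
  proof (intro exI[of _ C] conjI allI impI)
    show "m \<le> 2 * n" using le by (simp add: m_def)
    show "(\<Sum>j<2 * n. bmat l \<mu> i j * C j k) = 0" if "i < 2 * n" "k < m" for i k
      unfolding C_def by (rule eigsp_bmat[OF l fE[OF that(2)] that(1)])
    show "col_indep (2 * n) C {..<m}"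
    proof (rule col_indepI)
      fix x k assume x: "\<And>i. i < 2 * n \<Longrightarrow> (\<Sum>j\<in>{..<m}. C i j * x j) = 0" and k: "k \<in> {..<m}"
      have z: "(\<Sum>k<m. x k * f k t) = 0" for t
      proof (cases "t \<in> {a..b}")
        case True
        then show ?thesis unfolding comb[OF True] sol_def using x by simp
      next
        case False
        then show ?thesis using out[OF fE] by (intro sum.neutral) auto
      qed
      define u where "u = (\<lambda>v. x (inv_into {..<m} f v))"
      have uf: "u (f k) = x k" if "k < m" for k
        unfolding u_def using f that by (simp add: bij_betw_def inv_into_f_f)
      have "(\<Sum>v\<in>B. (\<lambda>t. u v * v t)) = (\<Sum>k<m. (\<lambda>t. u (f k) * f k t))"
        using sum.reindex_bij_betw[OF f, of "\<lambda>v t. u v * v t"] by simp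
      also have "\<dots> = 0"
      proof
        fix t
        have "(\<Sum>k<m. (\<lambda>t. u (f k) * f k t)) t = (\<Sum>k<m. x k * f k t)"
          unfolding sum_fun_apply using uf by (intro sum.cong) auto
        then show "(\<Sum>k<m. (\<lambda>t. u (f k) * f k t)) t = 0 t" using z by simp
      qed
      finally have "(\<Sum>v\<in>B. (\<lambda>t. u v * v t)) = 0" .
      then have "u (f k) = 0"
        using k bij_betwE[OF f] by (intro cfun.independentD[OF B(2) fin order_refl]) auto
      then show "x k = 0" using uf k by simp
    qed
    fix x assume x: "\<forall>i<2 * n. (\<Sum>j<2 * n. bmat l \<mu> i j * x j) = 0"
    have "(\<lambda>t. if t \<in> {a..b} then sol l \<mu> x 0 t else 0) \<in> cfun.span B"
      using sol_in_eigsp[OF l, of \<mu> x] x B(3) by blast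
    then obtain u where u: "(\<lambda>t. if t \<in> {a..b} then sol l \<mu> x 0 t else 0) = (\<Sum>v\<in>B. (\<lambda>t. u v * v t))"
      unfolding cfun.span_finite[OF fin] by blast
    define y where "y = (\<lambda>k. u (f k))"
    define c where "c = (\<lambda>j. \<Sum>k<m. C j k * y k)"
    have eq: "sol l \<mu> x 0 t = sol l \<mu> c 0 t" if t: "t \<in> {a..b}" for t
    proof -
      have "sol l \<mu> x 0 t = (\<Sum>v\<in>B. u v * v t)"
        using fun_cong[OF u, of t] t by (simp add: sum_fun_apply)
      also have "\<dots> = (\<Sum>k<m. y k * f k t)"
        using sum.reindex_bij_betw[OF f, of "\<lambda>v. u v * v t"] by (simp add: y_def)
      finally show ?thesis using comb[OF t, of y] by (simp add: c_def)
    qed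
    have diff: "sol l \<mu> (\<lambda>j. x j - c j) 0 t = 0" if "t \<in> {a..b}" for t
      using eq[OF that] by (simp add: sol_def right_diff_distrib sum_subtractf)
    have "sqint a b (sol l \<mu> (\<lambda>j. x j - c j) 0) = integral {a..b} (\<lambda>t. 0)"
      using diff by (intro integral_cong) simp
    then have z: "sqint a b (sol l \<mu> (\<lambda>j. x j - c j) 0) = 0" by simp
    have "x j = (\<Sum>k<m. C j k * y k)" if j: "j < 2 * n" for j
    proof -
      have "(\<lambda>j. x j - c j) j = 0" by (rule sol_zero[OF l z j])
      then show ?thesis by (simp add: c_def)
    qed
    then show "\<exists>y. \<forall>j<2 * n. x j = (\<Sum>k<m. C j k * y k)" by (intro exI[of _ y] allI impI)
  qed
qed

text \<open>Algebraic and geometric multiplicity agree at every real point, with common value 0 off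
  the spectrum. The argument principle therefore counts eigenvalues with the multiplicity in
  question.\<close>

lemma zorder_chardet:
  fixes \<mu> :: real
  assumes l: "l \<in> \<Lambda>"
  shows "zorder (chardet l) (of_real \<mu>) = int (emult n p U a b l (of_real \<mu>))"
proof -
  let ?m = "emult n p U a b l (of_real \<mu>)"
  obtain C where C: "?m \<le> 2 * n"
    "\<forall>i<2 * n. \<forall>k<?m. (\<Sum>j<2 * n. bmat l (of_real \<mu>) i j * C j k) = 0"
    "col_indep (2 * n) C {..<?m}"
    "\<forall>x. (\<forall>i<2 * n. (\<Sum>j<2 * n. bmat l (of_real \<mu>) i j * x j) = 0) \<longrightarrow> (\<exists>y. \<forall>j<2 * n. x j = (\<Sum>k<?m. C j k * y k))"
    using eigsp_basis[OF l, of "of_real \<mu>"] by (elim exE conjE) (rule that, assumption+)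
  have "zorder (\<lambda>z. Determinant.det (mat (2 * n) (2 * n) (\<lambda>(i, j). bmat l z i j))) (of_real \<mu>) = int ?m"
  proof (rule zorder_det_eq_nullity[where C = C])
    show "(\<lambda>z. bmat l z i j) holomorphic_on UNIV" if "i < 2 * n" "j < 2 * n" for i j
      by (rule bmat_holomorphic[OF l that(1)])
    show "\<exists>y. \<forall>j<2 * n. x j = (\<Sum>k<?m. C j k * y k)"
      if "\<And>i. i < 2 * n \<Longrightarrow> (\<Sum>j<2 * n. bmat l (of_real \<mu>) i j * x j) = 0" for x
      using C(4) that by simp
    show "w0 j = 0" if "\<And>j. j < 2 * n \<Longrightarrow> ((\<lambda>t. w t j) \<longlongrightarrow> w0 j) (at_right 0)"
       "\<And>i. i < 2 * n \<Longrightarrow> ((\<lambda>t. (\<Sum>j<2 * n. bmat l (of_real \<mu> + \<i> * of_real t) i j * w t j) / of_real t) \<longlongrightarrow> 0) (at_right (0::real))"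
       "j < 2 * n" for w w0 j
      by (rule bmat_nondegenerate[OF l that])
  qed (use C in auto)
  then show ?thesis unfolding chardet_def .
qed

lemma emult_zero:
  fixes \<mu> :: real
  assumes l: "l \<in> \<Lambda>" and nz: "chardet l (of_real \<mu>) \<noteq> 0"
  shows "emult n p U a b l (of_real \<mu>) = 0"
proof -
  have "zorder (chardet l) (of_real \<mu>) = 0"
    by (rule zorder_eqI[OF open_UNIV UNIV_I chardet_holomorphic[OF l] nz]) simp
  then show ?thesis using zorder_chardet[OF l] by simp
qed

text \<open>Compactness of [a, b] times a closed ball provides the bound P for the coefficients and
  the positive minimum c0 of p_0; constant rank provides M. The constant of
  \<open>eigenvalue_lower_bound\<close> depends on no other feature of l.\<close>

lemma eigenvalues_locally_bounded_below:
  assumes l0: "l0 \<in> \<Lambda>"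
  shows "\<exists>\<delta>>0. \<exists>C. cball l0 \<delta> \<subseteq> \<Lambda> \<and> (\<forall>l\<in>cball l0 \<delta>. \<forall>\<mu>. chardet l \<mu> = 0 \<longrightarrow> Re \<mu> \<ge> - C)"
proof -
  have "\<exists>M\<ge>0. \<exists>\<delta>>0. \<forall>t\<in>\<Lambda>. dist t l0 < \<delta> \<longrightarrow> (\<forall>v u.
     (\<forall>i<2 * n. (\<Sum>j<2 * n. U t $$ (i, j) * (v j + \<i> * u j)) = v i - \<i> * u i) \<longrightarrow>
     norm (\<Sum>i<2 * n. v i * cnj (u i)) \<le> M * (\<Sum>i<2 * n. (norm (u i))\<^sup>2))"
    by (rule boundary_pairing_locally_bounded[where T = \<Lambda> and U = U and N = "2 * n" and r = r,
        OF U_carrier U_unitary U_cont rank l0])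
  then obtain M \<delta>1 where M: "M \<ge> 0" "\<delta>1 > 0" "\<forall>t\<in>\<Lambda>. dist t l0 < \<delta>1 \<longrightarrow> (\<forall>v u.
     (\<forall>i<2 * n. (\<Sum>j<2 * n. U t $$ (i, j) * (v j + \<i> * u j)) = v i - \<i> * u i) \<longrightarrow>
     norm (\<Sum>i<2 * n. v i * cnj (u i)) \<le> M * (\<Sum>i<2 * n. (norm (u i))\<^sup>2))"
    by (elim exE conjE) (rule that, assumption+)
  obtain \<delta>2 where d2: "\<delta>2 > 0" "cball l0 \<delta>2 \<subseteq> \<Lambda>" using open_\<Lambda> l0 open_contains_cball by blast
  \<comment> \<open>Halving \<open>\<delta>1\<close> puts a closed ball inside the open condition
    dist t l0 < \<open>\<delta>1\<close>.\<close>
  define \<delta> where "\<delta> = min (\<delta>1 / 2) \<delta>2"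
  have \<delta>: "\<delta> > 0" "\<delta> < \<delta>1" "cball l0 \<delta> \<subseteq> \<Lambda>" using M(2) d2 by (auto simp: \<delta>_def)
  let ?K = "{a..b} \<times> cball l0 \<delta>"
  have K: "compact ?K" "?K \<noteq> {}" "?K \<subseteq> {a..b} \<times> \<Lambda>" using ab \<delta> by (auto intro: compact_Times)
  have pc: "continuous_on ?K (\<lambda>(x, l). p k x l)" if "k \<le> n" for k
    using p_cont[OF that] K(3) continuous_on_subset by blast
  have "\<exists>B. \<forall>x\<in>{a..b}. \<forall>l\<in>cball l0 \<delta>. \<bar>p k x l\<bar> \<le> B" if "k \<le> n" for k
  proof -
    have "bounded ((\<lambda>(x, l). p k x l) ` ?K)" using pc[OF that] K(1) by (intro compact_imp_bounded compact_continuous_image)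
    then obtain B where "\<forall>z\<in>(\<lambda>(x, l). p k x l) ` ?K. norm z \<le> B" unfolding bounded_iff by blast
    then show ?thesis by (intro exI[of _ B]) force
  qed
  then obtain B where B: "\<And>k x l. k \<le> n \<Longrightarrow> x \<in> {a..b} \<Longrightarrow> l \<in> cball l0 \<delta> \<Longrightarrow> \<bar>p k x l\<bar> \<le> B k" by metis
  define P where "P = (\<Sum>k\<le>n. \<bar>B k\<bar>)"
  have P: "\<bar>p k x l\<bar> \<le> P" if "k \<le> n" "x \<in> {a..b}" "l \<in> cball l0 \<delta>" for k x l
  proof -
    have "\<bar>p k x l\<bar> \<le> \<bar>B k\<bar>" using B[OF that] by linarith
    also have "\<dots> \<le> P" unfolding P_def using that by (intro member_le_sum) auto
    finally show ?thesis .
  qed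
  have P0: "P \<ge> 0" unfolding P_def by (intro sum_nonneg) auto
  obtain z where z: "z \<in> ?K" "\<And>y. y \<in> ?K \<Longrightarrow> (\<lambda>(x, l). p 0 x l) z \<le> (\<lambda>(x, l). p 0 x l) y"
    using continuous_attains_inf[OF K(1,2) pc[of 0]] by auto
  define c0 where "c0 = p 0 (fst z) (snd z)"
  have c0: "c0 > 0" unfolding c0_def using z(1) K(3) by (intro p0_pos) auto
  have c0_le: "c0 \<le> p 0 x l" if "x \<in> {a..b}" "l \<in> cball l0 \<delta>" for x l
    using z(2)[of "(x, l)"] that by (simp add: c0_def case_prod_beta)
  obtain C where C: "\<forall>q Y \<mu>. (\<forall>k\<le>n. continuous_on {a..b} (q k)) \<longrightarrow> (\<forall>k\<le>n. \<forall>x\<in>{a..b}. \<bar>q k x\<bar> \<le> P) \<longrightarrow>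
     (\<forall>x\<in>{a..b}. q 0 x \<ge> c0) \<longrightarrow> linsol (2 * n) (sysmat n q (complex_of_real \<mu>)) a b Y \<longrightarrow>
     norm (boundary_pairing n a b Y) \<le> M * (\<Sum>i<2 * n. (norm (vec_index (bhat n a b Y) i))\<^sup>2) \<longrightarrow>
     sqint a b (Y 0) > 0 \<longrightarrow> \<mu> \<ge> - C"
    using eigenvalue_lower_bound[OF n ab P0 c0 M(1)] by (elim exE)
  have "Re \<mu> \<ge> - C" if l: "l \<in> cball l0 \<delta>" and z: "chardet l \<mu> = 0" for l \<mu>
  proof -
    have l\<Lambda>: "l \<in> \<Lambda>" using l \<delta>(3) by blast
    have \<mu>: "complex_of_real (Re \<mu>) = \<mu>" using chardet_zero_real[OF l\<Lambda> z] by (simp add: complex_eq_iff)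
    obtain c where c: "\<forall>i<2 * n. (\<Sum>j<2 * n. bmat l \<mu> i j * c j) = 0" "sqint a b (sol l \<mu> c 0) > 0"
      using chardet_zeroD[OF l\<Lambda> z] by (elim exE conjE)
    let ?Y = "sol l \<mu> c"
    let ?v = "vec_index (bcheck n a b ?Y)" and ?u = "vec_index (bhat n a b ?Y)"
    have "norm (\<Sum>i<2 * n. ?v i * cnj (?u i)) \<le> M * (\<Sum>i<2 * n. (norm (?u i))\<^sup>2)"
    proof (rule M(3)[rule_format, OF l\<Lambda>])
      show "dist l l0 < \<delta>1" using l \<delta>(2) by (simp add: dist_commute)
      show "(\<Sum>j<2 * n. U l $$ (i, j) * (?v j + \<i> * ?u j)) = ?v i - \<i> * ?u i" if i: "i < 2 * n" for i
        using bc_defect_index[OF U_carrier[OF l\<Lambda>] i, of a b ?Y] bc_defect_sol[OF l\<Lambda> i, of \<mu> c] c(1) i by simp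
    qed
    then have pb: "norm (boundary_pairing n a b ?Y) \<le> M * (\<Sum>i<2 * n. (norm (?u i))\<^sup>2)" unfolding boundary_pairing_def .
    have "linsol (2 * n) (sysmat n (coef l) (complex_of_real (Re \<mu>))) a b ?Y" unfolding \<mu> by (rule sol_linsol[OF l\<Lambda>])
    moreover have "\<forall>k\<le>n. continuous_on {a..b} (coef l k)" using coef_continuous[OF l\<Lambda>] by simp
    moreover have "\<forall>k\<le>n. \<forall>x\<in>{a..b}. \<bar>coef l k x\<bar> \<le> P" using P[OF _ _ l] by simp
    moreover have "\<forall>x\<in>{a..b}. coef l 0 x \<ge> c0" using c0_le[OF _ l] by simp
    ultimately show ?thesis
      using C[THEN spec, of "coef l", THEN spec, of ?Y, THEN spec, of "Re \<mu>"] pb c(2) by (simp only: simp_thms)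
  qed
  then have "\<exists>C. cball l0 \<delta> \<subseteq> \<Lambda> \<and> (\<forall>l\<in>cball l0 \<delta>. \<forall>\<mu>. chardet l \<mu> = 0 \<longrightarrow> Re \<mu> \<ge> - C)"
    using \<delta>(3) by (intro exI[of _ C] conjI ballI allI impI)
  from conjI[OF \<delta>(1) this] show ?thesis by (rule exI[of _ \<delta>])
qed

end

section \<open>Extended sums over arbitrary index sets\<close>

lemma esum_mono: "A \<subseteq> B \<Longrightarrow> esum f A \<le> esum f B"
  unfolding esum_def by (rule SUP_subset_mono) auto

lemma esum_le: "(\<And>F. finite F \<Longrightarrow> F \<subseteq> A \<Longrightarrow> enat (sum f F) \<le> x) \<Longrightarrow> esum f A \<le> x"
  unfolding esum_def by (rule SUP_least) auto

lemma esum_ge: "finite F \<Longrightarrow> F \<subseteq> A \<Longrightarrow> enat (sum f F) \<le> esum f A"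
  unfolding esum_def by (rule SUP_upper) auto

lemma esum_neutral:
  assumes "A \<subseteq> B" "\<And>x. x \<in> B - A \<Longrightarrow> f x = 0"
  shows "esum f B = esum f A"
proof (rule antisym)
  show "esum f B \<le> esum f A"
  proof (rule esum_le)
    fix F assume F: "finite F" "F \<subseteq> B"
    have "\<forall>x\<in>F - F \<inter> A. f x = 0" using F assms(2) by blast
    then have "sum f F = sum f (F \<inter> A)" using F by (intro sum.mono_neutral_right) auto
    then show "enat (sum f F) \<le> esum f A" using esum_ge[of "F \<inter> A" A f] F by simp
  qed
qed (rule esum_mono[OF assms(1)])

lemma esum_finite_support:
  assumes "finite Z" "Z \<subseteq> A" "\<And>x. x \<in> A - Z \<Longrightarrow> f x = 0"
  shows "esum f A = enat (sum f Z)"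
proof -
  have "esum f A = esum f Z" by (rule esum_neutral[OF assms(2,3)])
  moreover have "esum f Z = enat (sum f Z)"
  proof (rule antisym)
    show "esum f Z \<le> enat (sum f Z)" by (rule esum_le) (use assms(1) in \<open>auto intro: sum_mono2\<close>)
    show "enat (sum f Z) \<le> esum f Z" by (rule esum_ge[OF assms(1)]) simp
  qed
  ultimately show ?thesis by simp
qed

lemma esum_insert_le: "esum f (insert t A) \<le> esum f A + enat (f t)"
proof (rule esum_le)
  fix F assume F: "finite F" "F \<subseteq> insert t A"
  have "sum f F \<le> sum f (insert t (F - {t}))" using F by (intro sum_mono2) auto
  also have "\<dots> = f t + sum f (F - {t})" using F by (subst sum.insert) auto
  finally have "enat (sum f F) \<le> enat (sum f (F - {t})) + enat (f t)" by simp
  also have "\<dots> \<le> esum f A + enat (f t)" using F by (intro add_right_mono esum_ge) auto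
  finally show "enat (sum f F) \<le> esum f A + enat (f t)" .
qed

lemma esum_add_le:
  assumes "A \<subseteq> B" "t \<in> B" "t \<notin> A"
  shows "esum f A + enat (f t) \<le> esum f B"
proof (cases "esum f B")
  case infinity then show ?thesis by simp
next
  case (enat x)
  have le: "sum f F + f t \<le> x" if "finite F" "F \<subseteq> A" for F
  proof -
    have "enat (sum f (insert t F)) \<le> esum f B" using that assms by (intro esum_ge) auto
    moreover have "t \<notin> F" using that assms by auto
    ultimately show ?thesis using that enat by (simp add: add.commute)
  qed
  \<comment> \<open>The subtraction of natural numbers is exact: \<open>le\<close> with the empty
    set gives f t \<le> x.\<close>
  have "esum f A \<le> enat (x - f t)"
  proof (rule esum_le)
    fix F assume "finite F" "F \<subseteq> A"
    from le[OF this] show "enat (sum f F) \<le> enat (x - f t)" by simp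
  qed
  then have "esum f A + enat (f t) \<le> enat (x - f t) + enat (f t)" by (rule add_right_mono)
  also have "\<dots> = enat x" using le[of "{}"] by simp
  finally show ?thesis using enat by simp
qed

section \<open>Stability of eigenvalue counts\<close>

context parametric_bvp
begin

text \<open>All zeros are real, and no nonempty open subset of the plane lies in the real line. So
  the determinant does not vanish identically, and its zeros in a compact set are finite in
  number.\<close>

lemma chardet_not_constant_zero: "l \<in> \<Lambda> \<Longrightarrow> open S \<Longrightarrow> S \<noteq> {} \<Longrightarrow> \<exists>z\<in>S. chardet l z \<noteq> 0"
proof (rule ccontr)
  assume l: "l \<in> \<Lambda>" and S: "open S" "S \<noteq> {}" and "\<not> (\<exists>z\<in>S. chardet l z \<noteq> 0)"
  then have z: "Im z = 0" if "z \<in> S" for z using chardet_zero_real[OF l] that by blast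
  obtain w e where w: "w \<in> S" "e > 0" "ball w e \<subseteq> S" using S open_contains_ball by blast
  have "w + \<i> * of_real (e / 2) \<in> ball w e" using w(2) by (simp add: dist_norm norm_mult)
  then have "Im (w + \<i> * of_real (e / 2)) = 0" using z w by blast
  then show False using z[OF w(1)] w(2) by simp
qed

lemma finite_chardet_zeros:
  assumes l: "l \<in> \<Lambda>" and K: "compact K"
  shows "finite {z \<in> K. chardet l z = 0}"
proof (cases "chardet l constant_on UNIV")
  case True
  then obtain c where c: "\<And>z. chardet l z = c" unfolding constant_on_def by blast
  have "c \<noteq> 0" using chardet_not_constant_zero[OF l open_UNIV] c by auto
  then show ?thesis using c by simp
next
  case False
  then show ?thesis
    by (intro holomorphic_compact_finite_zeros[OF chardet_holomorphic[OF l] open_UNIV connected_UNIV K]) auto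
qed

abbreviation mult_at :: "real \<Rightarrow> real \<Rightarrow> nat" where
  "mult_at l \<mu> \<equiv> emult n p U a b l (complex_of_real \<mu>)"

text \<open>The circle has the interval as its diameter. As zeros are real, those inside it are the
  eigenvalues in the open interval, with winding number 1; the ball of radius 2 \<rho> may contain
  further zeros, but they lie outside the circle and have winding number 0.\<close>

lemma winding_sum_eq_esum:
  assumes l: "l \<in> \<Lambda>" and \<rho>: "\<rho> > 0" and nz: "\<And>z. z \<in> sphere (complex_of_real c) \<rho> \<Longrightarrow> chardet l z \<noteq> 0"
  shows "\<exists>k. esum (mult_at l) {c - \<rho><..<c + \<rho>} = enat k \<and>
    (\<Sum>z\<in>{z \<in> ball (complex_of_real c) (2 * \<rho>). chardet l z = 0}.
      winding_number (circlepath (of_real c) \<rho>) z * of_int (zorder (chardet l) z)) = of_nat k"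
proof -
  let ?c = "complex_of_real c"
  define Z where "Z = {z \<in> ball ?c (2 * \<rho>). chardet l z = 0}"
  define R where "R = {\<mu> \<in> {c - \<rho><..<c + \<rho>}. chardet l (of_real \<mu>) = 0}"
  have finZ: "finite Z"
    by (rule finite_subset[OF _ finite_chardet_zeros[OF l compact_cball[of ?c "2 * \<rho>"]]]) (auto simp: Z_def)
  have dist: "dist ?c (of_real \<mu>) = \<bar>c - \<mu>\<bar>" for \<mu>
    by (metis dist_of_real dist_real_def)
  have RZ: "of_real ` R = Z \<inter> ball ?c \<rho>"
  proof
    show "of_real ` R \<subseteq> Z \<inter> ball ?c \<rho>"
      using \<rho> by (auto simp: R_def Z_def dist_real_def abs_less_iff)
    show "Z \<inter> ball ?c \<rho> \<subseteq> of_real ` R"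
    proof
      fix z assume z: "z \<in> Z \<inter> ball ?c \<rho>"
      then have "chardet l z = 0" by (simp add: Z_def)
      from chardet_zero_real[OF l this] have e: "z = of_real (Re z)" by (simp add: complex_eq_iff)
      have "\<bar>c - Re z\<bar> < \<rho>" using z dist[of "Re z"] e by simp
      then have "Re z \<in> R" using z e by (auto simp: R_def Z_def)
      then show "z \<in> of_real ` R" using e by blast
    qed
  qed
  have inj: "inj_on complex_of_real R" by (rule inj_onI) simp
  have finR: "finite R"
    using finite_imageD[OF _ inj] RZ finZ by simp
  have es: "esum (mult_at l) {c - \<rho><..<c + \<rho>} = enat (sum (mult_at l) R)"
  proof (rule esum_finite_support[OF finR])
    show "R \<subseteq> {c - \<rho><..<c + \<rho>}" by (auto simp: R_def)
    fix \<mu> assume "\<mu> \<in> {c - \<rho><..<c + \<rho>} - R"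
    then show "mult_at l \<mu> = 0" by (intro emult_zero[OF l]) (auto simp: R_def)
  qed
  have w1: "winding_number (circlepath ?c \<rho>) z = 1" if "z \<in> ball ?c \<rho>" for z
    using that by (intro winding_number_circlepath) (simp add: dist_norm norm_minus_commute)
  have w0: "winding_number (circlepath ?c \<rho>) z = 0" if "z \<in> Z - ball ?c \<rho>" for z
  proof (rule winding_number_zero_outside[where s = "cball ?c \<rho>"])
    have "z \<notin> sphere ?c \<rho>" using nz[of z] that by (auto simp: Z_def)
    then show "z \<notin> cball ?c \<rho>" using that by (auto simp: sphere_def)
  qed (use \<rho> in \<open>auto\<close>)
  have "(\<Sum>z\<in>Z. winding_number (circlepath ?c \<rho>) z * of_int (zorder (chardet l) z))
     = (\<Sum>z\<in>Z \<inter> ball ?c \<rho>. winding_number (circlepath ?c \<rho>) z * of_int (zorder (chardet l) z))"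
    using finZ w0 by (intro sum.mono_neutral_right) auto
  also have "\<dots> = (\<Sum>z\<in>of_real ` R. of_int (zorder (chardet l) z))"
    unfolding RZ[symmetric] using w1 RZ by (intro sum.cong) auto
  also have "\<dots> = (\<Sum>\<mu>\<in>R. of_int (zorder (chardet l) (of_real \<mu>)))"
    by (simp add: sum.reindex[OF inj])
  also have "\<dots> = of_nat (sum (mult_at l) R)"
    by (simp add: zorder_chardet[OF l])
  finally show ?thesis using es unfolding Z_def by blast
qed

text \<open>The circle with diameter from \<alpha> to \<beta> meets the real line only in \<alpha>
  and \<beta>, so the hypotheses at these two points keep the determinant away from 0 on the whole
  circle.\<close>

lemma eigenvalue_count_stable:
  assumes l0: "l0 \<in> \<Lambda>" and \<alpha>\<beta>: "\<alpha> < \<beta>" and nz: "chardet l0 (of_real \<alpha>) \<noteq> 0" "chardet l0 (of_real \<beta>) \<noteq> 0"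
  shows "\<exists>\<delta>>0. \<forall>l. dist l l0 < \<delta> \<longrightarrow> esum (mult_at l) {\<alpha><..<\<beta>} = esum (mult_at l0) {\<alpha><..<\<beta>}"
proof -
  define c where "c = (\<alpha> + \<beta>) / 2"
  define \<rho> where "\<rho> = (\<beta> - \<alpha>) / 2"
  have \<rho>: "\<rho> > 0" using \<alpha>\<beta> by (simp add: \<rho>_def)
  have ends: "c - \<rho> = \<alpha>" "c + \<rho> = \<beta>" by (simp_all add: c_def \<rho>_def field_simps)
  let ?c = "complex_of_real c"
  let ?S = "sphere ?c \<rho>"
  have nzS: "chardet l0 z \<noteq> 0" if "z \<in> ?S" for z
  proof
    assume z0: "chardet l0 z = 0"
    have e: "z = of_real (Re z)" using chardet_zero_real[OF l0 z0] by (simp add: complex_eq_iff)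
    then have "dist ?c (of_real (Re z)) = \<rho>" using that by simp
    then have "\<bar>c - Re z\<bar> = \<rho>" by (metis dist_of_real dist_real_def)
    then have "Re z = \<alpha> \<or> Re z = \<beta>" using ends by linarith
    then show False using nz z0 e by metis
  qed
  have S: "compact ?S" "?S \<noteq> {}" using \<rho> by auto
  obtain \<delta>1 where d1: "\<delta>1 > 0" "cball l0 \<delta>1 \<subseteq> \<Lambda>" using open_\<Lambda> l0 open_contains_cball by blast
  let ?K = "cball l0 \<delta>1 \<times> ?S"
  have K: "?K \<subseteq> \<Lambda> \<times> UNIV" "compact ?K" using d1 S by (auto intro: compact_Times)
  have uc: "uniformly_continuous_on ?K (\<lambda>\<theta>. chardet (fst \<theta>) (snd \<theta>))"
    by (rule compact_uniformly_continuous[OF chardet_continuous[OF K] K(2)])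
  have "continuous_on ?S (\<lambda>z. norm (chardet l0 z))"
    by (intro continuous_on_norm holomorphic_on_imp_continuous_on chardet_holomorphic[OF l0])
  then obtain z0 where z0: "z0 \<in> ?S" "\<forall>z\<in>?S. norm (chardet l0 z0) \<le> norm (chardet l0 z)"
    using continuous_attains_inf[OF S] by blast
  \<comment> \<open>The minimum modulus on the circle. Uniform continuity on the compact cylinder
    keeps the perturbation below it for all points of the circle at once, as Rouche's theorem
    demands.\<close>
  define m where "m = norm (chardet l0 z0)"
  have m: "m > 0" unfolding m_def using nzS[OF z0(1)] by simp
  obtain d where d: "d > 0" "\<forall>\<theta>\<in>?K. \<forall>\<theta>'\<in>?K. dist \<theta>' \<theta> < d \<longrightarrow>
      dist (chardet (fst \<theta>') (snd \<theta>')) (chardet (fst \<theta>) (snd \<theta>)) < m"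
    using uc m unfolding uniformly_continuous_on_def by blast
  have "esum (mult_at l) {\<alpha><..<\<beta>} = esum (mult_at l0) {\<alpha><..<\<beta>}" if l: "dist l l0 < min d \<delta>1" for l
  proof -
    have lb: "l \<in> cball l0 \<delta>1" "l0 \<in> cball l0 \<delta>1" using l d1 by (auto simp: dist_commute)
    have l\<Lambda>: "l \<in> \<Lambda>" using lb d1 by blast
    have less: "norm (chardet l z - chardet l0 z) < norm (chardet l0 z)" if z: "z \<in> ?S" for z
    proof -
      have "dist (l, z) (l0, z) < d" using l by (simp add: dist_Pair_Pair)
      then have "dist (chardet l z) (chardet l0 z) < m" using d(2) lb z by fastforce
      also have "m \<le> norm (chardet l0 z)" using z0(2) z by (simp add: m_def)
      finally show ?thesis by (simp add: dist_norm)
    qed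
    have nzl: "chardet l z \<noteq> 0" if "z \<in> ?S" for z using less[OF that] by auto
    obtain k where k: "esum (mult_at l) {c - \<rho><..<c + \<rho>} = enat k"
      "(\<Sum>z\<in>{z \<in> ball ?c (2 * \<rho>). chardet l z = 0}. winding_number (circlepath ?c \<rho>) z * of_int (zorder (chardet l) z)) = of_nat k"
      using winding_sum_eq_esum[OF l\<Lambda> \<rho> nzl] by blast
    obtain k0 where k0: "esum (mult_at l0) {c - \<rho><..<c + \<rho>} = enat k0"
      "(\<Sum>z\<in>{z \<in> ball ?c (2 * \<rho>). chardet l0 z = 0}. winding_number (circlepath ?c \<rho>) z * of_int (zorder (chardet l0) z)) = of_nat k0"
      using winding_sum_eq_esum[OF l0 \<rho> nzS] by blast
    let ?g = "\<lambda>z. chardet l z - chardet l0 z"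
    have fg: "(\<lambda>z. chardet l0 z + ?g z) = chardet l" by auto
    have fin: "finite {z \<in> ball ?c (2 * \<rho>). chardet l' z = 0}" if "l' \<in> \<Lambda>" for l'
      by (rule finite_subset[OF _ finite_chardet_zeros[OF that compact_cball[of ?c "2 * \<rho>"]]]) auto
    have "(\<Sum>z\<in>{z \<in> ball ?c (2 * \<rho>). chardet l0 z + ?g z = 0}. winding_number (circlepath ?c \<rho>) z * of_int (zorder (\<lambda>z. chardet l0 z + ?g z) z))
      = (\<Sum>z\<in>{z \<in> ball ?c (2 * \<rho>). chardet l0 z = 0}. winding_number (circlepath ?c \<rho>) z * of_int (zorder (chardet l0) z))"
    proof (rule Rouche_theorem)
      show "finite {z \<in> ball ?c (2 * \<rho>). chardet l0 z + ?g z = 0}" using fin[OF l\<Lambda>] by simp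
      show "finite {z \<in> ball ?c (2 * \<rho>). chardet l0 z = 0}" using fin[OF l0] .
      show "chardet l0 holomorphic_on ball ?c (2 * \<rho>)" by (rule chardet_holomorphic[OF l0])
      show "?g holomorphic_on ball ?c (2 * \<rho>)" by (intro holomorphic_intros chardet_holomorphic l\<Lambda> l0)
      show "path_image (circlepath ?c \<rho>) \<subseteq> ball ?c (2 * \<rho>)" using \<rho> by (auto simp: path_image_circlepath_nonneg)
      show "\<forall>z\<in>path_image (circlepath ?c \<rho>). norm (?g z) < norm (chardet l0 z)"
        using less \<rho> by (simp add: path_image_circlepath_nonneg)
      show "\<forall>z. z \<notin> ball ?c (2 * \<rho>) \<longrightarrow> winding_number (circlepath ?c \<rho>) z = 0"
        using \<rho> by (intro allI impI winding_number_zero_outside[where s = "ball ?c (2 * \<rho>)"]) (auto simp: path_image_circlepath_nonneg)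
    qed auto
    then have "(of_nat k :: complex) = of_nat k0" unfolding fg using k(2) k0(2) by simp
    then show ?thesis using k(1) k0(1) unfolding ends by simp
  qed
  moreover have "min d \<delta>1 > 0" using d d1 by simp
  ultimately show ?thesis by blast
qed

text \<open>Isolation of 0 from the other eigenvalues. The bound \<epsilon> < 1 lets - \<epsilon>
  stay to the right of the left end - |C| - 1 chosen for the counting windows.\<close>

lemma chardet_zero_gap:
  assumes l: "l \<in> \<Lambda>"
  shows "\<exists>\<epsilon>>0. \<epsilon> < 1 \<and> (\<forall>x. x \<noteq> 0 \<longrightarrow> \<bar>x\<bar> \<le> \<epsilon> \<longrightarrow> chardet l (complex_of_real x) \<noteq> 0)"
proof -
  obtain d where d: "d > 0" "\<forall>z\<in>{z \<in> cball 0 1. chardet l z = 0}. z \<noteq> 0 \<longrightarrow> d \<le> dist 0 z"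
    using finite_set_avoid[OF finite_chardet_zeros[OF l compact_cball[of 0 1]], of 0] by blast
  have "chardet l (complex_of_real x) \<noteq> 0" if "x \<noteq> 0" "\<bar>x\<bar> \<le> min (d / 2) (1 / 2)" for x
    using d that by force
  moreover have "min (d / 2) (1 / 2) > 0" "min (d / 2) (1 / 2) < 1" using d by auto
  ultimately show ?thesis by blast
qed

text \<open>Two windows with stable count are compared, (\<alpha>, - \<epsilon>) and (\<alpha>,
  \<epsilon>). The first holds all negative eigenvalues at l0 and only negative ones at l, giving
  the lower estimate; the second holds all negative ones at l, and at l0 nothing beyond the negative
  ones and 0, giving the upper estimate.\<close>

lemma nuS_semicontinuous:
  assumes l0: "l0 \<in> \<Lambda>"
  shows "\<exists>\<delta>>0. \<forall>l. dist l l0 < \<delta> \<longrightarrow> nuS n p U a b l0 \<le> nuS n p U a b l \<and>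
      nuS n p U a b l \<le> nuS n p U a b l0 + enat (emult n p U a b l0 0)"
proof -
  obtain \<delta>0 C where d0: "\<delta>0 > 0" "cball l0 \<delta>0 \<subseteq> \<Lambda>"
    "\<forall>l\<in>cball l0 \<delta>0. \<forall>\<mu>. chardet l \<mu> = 0 \<longrightarrow> Re \<mu> \<ge> - C"
    using eigenvalues_locally_bounded_below[OF l0] by blast
  obtain \<epsilon> where e: "\<epsilon> > 0" "\<epsilon> < 1" "\<forall>x. x \<noteq> 0 \<longrightarrow> \<bar>x\<bar> \<le> \<epsilon> \<longrightarrow> chardet l0 (complex_of_real x) \<noteq> 0"
    using chardet_zero_gap[OF l0] by blast
  \<comment> \<open>Strictly below - C, so that neither \<alpha> nor any point to its left is an
    eigenvalue for l in the ball.\<close>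
  define \<alpha> where "\<alpha> = - \<bar>C\<bar> - 1"
  have low: "chardet l (of_real \<mu>) \<noteq> 0" if "l \<in> cball l0 \<delta>0" "\<mu> \<le> \<alpha>" for l \<mu>
    using d0(3) that unfolding \<alpha>_def by force
  have l0b: "l0 \<in> cball l0 \<delta>0" using d0 by simp
  have ne: "chardet l0 (of_real (- \<epsilon>)) \<noteq> 0" "chardet l0 (of_real \<epsilon>) \<noteq> 0"
    using e(3)[rule_format, of "- \<epsilon>"] e(3)[rule_format, of \<epsilon>] e(1) by auto
  have lt: "\<alpha> < - \<epsilon>" "\<alpha> < \<epsilon>" "\<alpha> < 0" using e unfolding \<alpha>_def by auto
  obtain \<delta>1 where d1: "\<delta>1 > 0" "\<forall>l. dist l l0 < \<delta>1 \<longrightarrow> esum (mult_at l) {\<alpha><..<- \<epsilon>} = esum (mult_at l0) {\<alpha><..<- \<epsilon>}"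
    using eigenvalue_count_stable[OF l0 lt(1) low[OF l0b order_refl] ne(1)] by blast
  obtain \<delta>2 where d2: "\<delta>2 > 0" "\<forall>l. dist l l0 < \<delta>2 \<longrightarrow> esum (mult_at l) {\<alpha><..<\<epsilon>} = esum (mult_at l0) {\<alpha><..<\<epsilon>}"
    using eigenvalue_count_stable[OF l0 lt(2) low[OF l0b order_refl] ne(2)] by blast
  have "nuS n p U a b l0 \<le> nuS n p U a b l \<and> nuS n p U a b l \<le> nuS n p U a b l0 + enat (emult n p U a b l0 0)"
    if l: "dist l l0 < min \<delta>0 (min \<delta>1 \<delta>2)" for l
  proof
    have lb: "l \<in> cball l0 \<delta>0" using l by (simp add: dist_commute)
    then have l\<Lambda>: "l \<in> \<Lambda>" using d0 by blast
    have z0: "mult_at l0 \<mu> = 0" if "\<mu> \<le> \<alpha> \<or> (\<mu> \<noteq> 0 \<and> \<bar>\<mu>\<bar> \<le> \<epsilon>)" for \<mu>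
      using low[OF l0b] e(3) that by (intro emult_zero[OF l0]) blast
    have zl: "mult_at l \<mu> = 0" if "\<mu> \<le> \<alpha>" for \<mu>
      by (rule emult_zero[OF l\<Lambda> low[OF lb that]])
    have "nuS n p U a b l0 = esum (mult_at l0) {\<alpha><..<- \<epsilon>}"
      unfolding nuS_def
    proof (rule esum_neutral)
      show "{\<alpha><..<- \<epsilon>} \<subseteq> {\<mu>. \<mu> < 0}" using e(1) by auto
      fix \<mu> assume "\<mu> \<in> {\<mu>. \<mu> < 0} - {\<alpha><..<- \<epsilon>}"
      then have "\<mu> \<le> \<alpha> \<or> (\<mu> \<noteq> 0 \<and> \<bar>\<mu>\<bar> \<le> \<epsilon>)" by auto
      then show "mult_at l0 \<mu> = 0" by (rule z0)
    qed
    also have "\<dots> = esum (mult_at l) {\<alpha><..<- \<epsilon>}" by (rule d1(2)[rule_format, symmetric]) (use l in simp)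
    also have "\<dots> \<le> nuS n p U a b l" unfolding nuS_def using e(1) by (intro esum_mono) auto
    finally show "nuS n p U a b l0 \<le> nuS n p U a b l" .
    have "nuS n p U a b l = esum (mult_at l) {\<alpha><..<0}"
      unfolding nuS_def
    proof (rule esum_neutral)
      fix \<mu> assume "\<mu> \<in> {\<mu>. \<mu> < 0} - {\<alpha><..<0}"
      then have "\<mu> \<le> \<alpha>" by auto
      then show "mult_at l \<mu> = 0" by (rule zl)
    qed auto
    also have "\<dots> \<le> esum (mult_at l) {\<alpha><..<\<epsilon>}" using e(1) by (intro esum_mono) auto
    also have "\<dots> = esum (mult_at l0) {\<alpha><..<\<epsilon>}" by (rule d2(2)[rule_format]) (use l in simp)
    also have "\<dots> = esum (mult_at l0) (insert 0 {\<alpha><..<0})"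
    proof (rule esum_neutral)
      show "insert 0 {\<alpha><..<0} \<subseteq> {\<alpha><..<\<epsilon>}" using e(1) lt by auto
      fix \<mu> assume "\<mu> \<in> {\<alpha><..<\<epsilon>} - insert 0 {\<alpha><..<0}"
      then have "\<mu> \<le> \<alpha> \<or> (\<mu> \<noteq> 0 \<and> \<bar>\<mu>\<bar> \<le> \<epsilon>)" by auto
      then show "mult_at l0 \<mu> = 0" by (rule z0)
    qed
    also have "\<dots> \<le> esum (mult_at l0) {\<alpha><..<0} + enat (mult_at l0 0)" by (rule esum_insert_le)
    also have "\<dots> \<le> nuS n p U a b l0 + enat (emult n p U a b l0 0)"
      unfolding nuS_def by (intro add_mono esum_mono) auto
    finally show "nuS n p U a b l \<le> nuS n p U a b l0 + enat (emult n p U a b l0 0)" .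
  qed
  moreover have "min \<delta>0 (min \<delta>1 \<delta>2) > 0" using d0 d1 d2 by simp
  ultimately show ?thesis by blast
qed

end

text \<open>The infimum t of the parameters violating the estimate leads to a contradiction.
  Approaching t from the left costs nothing, because N t \<le> N s for s near t, so t itself
  satisfies the estimate. Leaving t to the right costs at most f t, and t belongs to [\<xi>1, s) for
  every s > t, so that cost is covered. This asymmetry is why the interval is closed on the left and
  open on the right.\<close>

lemma counting_inequality:
  fixes N :: "real \<Rightarrow> enat" and f :: "real \<Rightarrow> nat"
  assumes ord: "\<xi>1 \<le> \<xi>2"
    and semi: "\<And>t. t \<in> {\<xi>1..\<xi>2} \<Longrightarrow> \<exists>\<delta>>0. \<forall>s. dist s t < \<delta> \<longrightarrow> N t \<le> N s \<and> N s \<le> N t + enat (f t)"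
  shows "N \<xi>2 \<le> N \<xi>1 + esum f {\<xi>1..<\<xi>2}"
proof (rule ccontr)
  define good where "good t \<longleftrightarrow> N t \<le> N \<xi>1 + esum f {\<xi>1..<t}" for t
  define bad where "bad = {t \<in> {\<xi>1..\<xi>2}. \<not> good t}"
  assume "\<not> ?thesis"
  then have "\<xi>2 \<in> bad" using ord by (simp add: bad_def good_def)
  then have ne: "bad \<noteq> {}" by auto
  have bdd: "bdd_below bad" unfolding bad_def by (intro bdd_belowI[of _ \<xi>1]) auto
  define t where "t = Inf bad"
  have t: "t \<in> {\<xi>1..\<xi>2}"
    unfolding t_def using cInf_lower[OF \<open>\<xi>2 \<in> bad\<close> bdd] ne by (auto intro!: cInf_greatest simp: bad_def)
  have below: "good s" if "s \<in> {\<xi>1..<t}" for s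
  proof (rule ccontr)
    assume "\<not> good s"
    then have "s \<in> bad" using that t by (simp add: bad_def)
    then have "t \<le> s" unfolding t_def by (rule cInf_lower[OF _ bdd])
    then show False using that by simp
  qed
  obtain \<delta> where \<delta>: "\<delta> > 0" "\<forall>s. dist s t < \<delta> \<longrightarrow> N t \<le> N s \<and> N s \<le> N t + enat (f t)"
    using semi[OF t] by blast
  have gt: "good t"
  proof (cases "t = \<xi>1")
    case True
    then show ?thesis by (simp add: good_def)
  next
    case False
    define s where "s = max \<xi>1 (t - \<delta> / 2)"
    have s: "s \<in> {\<xi>1..<t}" "dist s t < \<delta>" using False t \<delta>(1) by (auto simp: s_def dist_real_def)
    have "N t \<le> N s" using \<delta>(2) s(2) by blast
    also have "\<dots> \<le> N \<xi>1 + esum f {\<xi>1..<s}" using below[OF s(1)] by (simp add: good_def)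
    also have "\<dots> \<le> N \<xi>1 + esum f {\<xi>1..<t}" using s(1) by (intro add_left_mono esum_mono) auto
    finally show ?thesis by (simp add: good_def)
  qed
  \<comment> \<open>The point t is missing from [\<xi>1, t) and present in [\<xi>1, s), so f t is
    charged exactly once.\<close>
  have above: "good s" if "t < s" "s < t + \<delta>" for s
  proof -
    have "N s \<le> N t + enat (f t)" using \<delta>(2) that by (simp add: dist_real_def)
    also have "\<dots> \<le> (N \<xi>1 + esum f {\<xi>1..<t}) + enat (f t)"
      using gt by (intro add_right_mono) (simp add: good_def)
    also have "\<dots> = N \<xi>1 + (esum f {\<xi>1..<t} + enat (f t))" by (simp only: add.assoc)
    also have "\<dots> \<le> N \<xi>1 + esum f {\<xi>1..<s}"
      using that t by (intro add_left_mono esum_add_le) auto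
    finally show ?thesis by (simp add: good_def)
  qed
  have "t + \<delta> \<le> Inf bad"
  proof (rule cInf_greatest[OF ne])
    fix s assume s: "s \<in> bad"
    then have "t \<le> s" unfolding t_def by (rule cInf_lower[OF _ bdd])
    moreover have "\<not> good s" using s by (simp add: bad_def)
    ultimately show "t + \<delta> \<le> s" using gt above[of s] by (cases "s = t") force+
  qed
  then show False using \<delta>(1) by (simp add: t_def)
qed

theorem theorem4:
  fixes n :: nat and a b :: real and \<sigma> \<tau> :: ereal
    and p :: "nat \<Rightarrow> real \<Rightarrow> real \<Rightarrow> real"
    and U :: "real \<Rightarrow> complex mat"
    and \<xi>1 \<xi>2 :: real
  defines "\<Lambda> \<equiv> {l::real. \<sigma> < ereal l \<and> ereal l < \<tau>}"
  assumes n: "n \<ge> 1" and ab: "a < b" and st: "\<sigma> < \<tau>"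
    and p_cont: "\<forall>k\<le>n. continuous_on ({a..b} \<times> \<Lambda>) (\<lambda>(x, l). p k x l)"
    and p0_pos: "\<forall>l\<in>\<Lambda>. \<forall>x\<in>{a..b}. p 0 x l > 0"
    and p0_smooth: "\<forall>l\<in>\<Lambda>. Cm n a b (\<lambda>x. p 0 x l)"
    and pk_smooth: "\<forall>l\<in>\<Lambda>. \<forall>k. 1 \<le> k \<and> k \<le> n - 1 \<longrightarrow> Cm (n - k) a b (\<lambda>x. p k x l)"
    and U_carrier: "\<forall>l\<in>\<Lambda>. U l \<in> carrier_mat (2 * n) (2 * n)"
    and U_unitary: "\<forall>l\<in>\<Lambda>. U l * mat_adjoint (U l) = 1\<^sub>m (2 * n)"
    and U_cont: "\<forall>i<2 * n. \<forall>j<2 * n. continuous_on \<Lambda> (\<lambda>l. U l $$ (i, j))"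
    and rank_const: "\<forall>l1\<in>\<Lambda>. \<forall>l2\<in>\<Lambda>.
        vec_space.rank (2 * n) (U l1 - 1\<^sub>m (2 * n))
      = vec_space.rank (2 * n) (U l2 - 1\<^sub>m (2 * n))"
    and xi: "\<xi>1 < \<xi>2" "{\<xi>1..\<xi>2} \<subseteq> \<Lambda>"
  shows "nuS n p U a b \<xi>2 \<le> NS n p U a b \<xi>1 \<xi>2 + nuS n p U a b \<xi>1"
proof -
  have xi1: "\<xi>1 \<in> \<Lambda>" using xi by auto
  have "\<Lambda> = ereal -` {\<sigma><..<\<tau>}" by (auto simp: \<Lambda>_def)
  moreover have "open (ereal -` {\<sigma><..<\<tau>})"
    by (intro open_vimage continuous_on_ereal continuous_on_id) auto
  ultimately have opn: "open \<Lambda>" by simp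
  interpret parametric_bvp n a b \<Lambda> p U "vec_space.rank (2 * n) (U \<xi>1 - 1\<^sub>m (2 * n))"
  proof
    show "Cm (n - k) a b (\<lambda>x. p k x l)" if l: "l \<in> \<Lambda>" and k: "k \<le> n" for l k
    proof -
      consider "k = 0" | "1 \<le> k" "k \<le> n - 1" | "k = n" using k by linarith
      then show ?thesis
      proof cases
        case 1 then show ?thesis using p0_smooth l by simp
      next
        case 2 then show ?thesis using pk_smooth l by simp
      next
        case 3
        \<comment> \<open>For k = n the required class is C^0, and this comes from joint continuity
          restricted to a fixed l.\<close>
        have pk: "continuous_on ({a..b} \<times> \<Lambda>) (\<lambda>(x, l). p k x l)" using p_cont k by blast
        have "continuous_on {a..b} (\<lambda>x. (\<lambda>(x, l). p k x l) (x, l))"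
          using l by (intro continuous_on_compose2[OF pk] continuous_intros) auto
        then show ?thesis using 3 by (simp add: Cm_0)
      qed
    qed
    show "vec_space.rank (2 * n) (U l - 1\<^sub>m (2 * n)) = vec_space.rank (2 * n) (U \<xi>1 - 1\<^sub>m (2 * n))"
      if "l \<in> \<Lambda>" for l using rank_const that xi1 by blast
  qed (use n ab opn p_cont p0_pos U_carrier U_unitary U_cont in auto)
  have "nuS n p U a b \<xi>2 \<le> nuS n p U a b \<xi>1 + esum (\<lambda>l. emult n p U a b l 0) {\<xi>1..<\<xi>2}"
    by (rule counting_inequality[OF less_imp_le[OF xi(1)] nuS_semicontinuous]) (use xi(2) in auto)
  then show ?thesis by (simp add: NS_def add.commute)
qed

end
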